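(* Let $W$ be a weight satisfying $(C_1)$, $(C_2)$ and $(C_3)$, let $\{\omega(n)\}_{n\geq 0}$ be the associated moment sequence, and let $\Omega(n) = 1/\omega(n)$. For compact sets $E\subseteq \mathbb{T}$, the following statements are all equivalent: (i) $E$ has zero $\omega$-capacity. (ii) Every function $f\in C(\mathbb{T})\cap \ell^2(\Omega)$ with zero set $\{\zeta \in \mathbb{T}: f(\zeta)=0\} \subseteq E$ is bicyclic in $\ell^2(\Omega)$. (iii) The space $C^\infty_0(\mathbb{T} \setminus E)$ of smooth functions compactly supported in $\mathbb{T} \setminus E$ is dense in $\ell^2(\Omega)$.
   Context: $\mathbb{T}$ is the unit circle. A weight is a non-negative continuously differentiable function $W$ on $(0,1]$ which is integrable on $[0,1]$ with respect to Lebesgue measure. Its associated moment sequence is $\omega(n)=\int_0^1 r^n W(1-r)\,dr$, $n=0,1,2,\dots$. The conditions on $W$ are: $(C_1)$ $W$ is either monotone non-decreasing or monotone non-increasing; $(C_2)$ $\int_0^1 \frac{W(t)}{t}\,dt=+\infty$; $(C_3)$ there is a constant $0<c<2$, depending only on $W$, such that $W(t)\leq c\,W(t/2)$ for all $0<t<1$. For a positive finite Borel measure $\mu$ on $\mathbb{T}$, its $\omega$-energy is $\mathcal{E}_\omega(\mu)=\sum_{n\in\mathbb{Z}}\omega(|n|)|\widehat\mu(n)|^2\in(0,\infty]$, where $\widehat\mu(n)=\int_{\mathbb{T}}\zeta^{-n}d\mu(\zeta)$. For compact $E\subset\mathbb{T}$, $\operatorname{Cap}_\omega(E)=\sup_\mu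 1/\mathcal{E}_\omega(\mu)$, the supremum over probability measures $\mu$ supported on $E$ (with $1/\infty=0$); $E$ has zero $\omega$-capacity if $\operatorname{Cap}_\omega(E)=0$. $\ell^2(\Omega)$ is the Hilbert space of $f\in L^2(\mathbb{T})$ with $\|f\|_{\ell^2(\Omega)}^2=\sum_{n\in\mathbb{Z}}|\widehat f(n)|^2\Omega(|n|)<\infty$. An element $f\in\ell^2(\Omega)$ is bicyclic if the linear span of $\{f(\zeta)\zeta^n: n\in\mathbb{Z}\}$ is dense in $\ell^2(\Omega)$. *)

theory Defs
  imports "HOL-Probability.Probability"
begin

section \<open>Weights and moment sequences\<close>

text \<open>A weight is only meaningful on \<open>(0,1]\<close>; its values elsewhere are never used. At the endpoint
  \<open>1\<close> the derivative is one-sided.\<close>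

definition weight :: "(real \<Rightarrow> real) \<Rightarrow> bool" where
  "weight W \<longleftrightarrow>
     (\<forall>t\<in>{0<..1}. 0 \<le> W t) \<and>
     (\<exists>W'. (\<forall>t\<in>{0<..1}. (W has_real_derivative W' t) (at t within {0<..1})) \<and>
           continuous_on {0<..1} W') \<and>
     set_integrable lborel {0<..1} W"

definition weight_C1 :: "(real \<Rightarrow> real) \<Rightarrow> bool" where
  "weight_C1 W \<longleftrightarrow> mono_on {0<..1} W \<or> antimono_on {0<..1} W"

definition weight_C2 :: "(real \<Rightarrow> real) \<Rightarrow> bool" where
  "weight_C2 W \<longleftrightarrow> (\<integral>\<^sup>+t\<in>{0<..1}. ennreal (W t / t) \<partial>lborel) = \<infinity>"

definition weight_C3 :: "(real \<Rightarrow> real) \<Rightarrow> bool" where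
  "weight_C3 W \<longleftrightarrow> (\<exists>c. 0 < c \<and> c < 2 \<and> (\<forall>t. 0 < t \<and> t < 1 \<longrightarrow> W t \<le> c * W (t / 2)))"

definition moment_seq :: "(real \<Rightarrow> real) \<Rightarrow> nat \<Rightarrow> real" where
  "moment_seq W n = (LINT r:{0..<1}|lborel. r ^ n * W (1 - r))"

section \<open>Energy and capacity\<close>

abbreviation circle :: "complex set" where
  "circle \<equiv> sphere 0 1"

abbreviation circle_borel :: "complex measure" where
  "circle_borel \<equiv> restrict_space borel circle"

definition measure_coeff :: "complex measure \<Rightarrow> int \<Rightarrow> complex" where
  "measure_coeff \<mu> n = (LINT \<zeta>|\<mu>. \<zeta> powi (- n))"

definition energy :: "(nat \<Rightarrow> real) \<Rightarrow> complex measure \<Rightarrow> ennreal" where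
  "energy \<omega> \<mu> = (\<Sum>\<^sub>\<infinity>n::int. ennreal (\<omega> (nat \<bar>n\<bar>) * (cmod (measure_coeff \<mu> n))\<^sup>2))"

definition prob_measures_on :: "complex set \<Rightarrow> complex measure set" where
  "prob_measures_on E =
     {\<mu>. prob_space \<mu> \<and> sets \<mu> = sets circle_borel \<and> emeasure \<mu> (circle - E) = 0}"

text \<open>In \<^typ>\<open>ennreal\<close> one has \<open>1 / \<infinity> = 0\<close>, and the supremum over the empty set (the case
  \<open>E = {}\<close>) is \<open>0\<close>.\<close>

definition capacity :: "(nat \<Rightarrow> real) \<Rightarrow> complex set \<Rightarrow> ennreal" where
  "capacity \<omega> E = (SUP \<mu>\<in>prob_measures_on E. 1 / energy \<omega> \<mu>)"

section \<open>The space \<open>\<ell>\<^sup>2(\<Omega>)\<close>\<close>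

definition circle_measure :: "complex measure" where \<comment> \<open>normalised arc length\<close>
  "circle_measure = distr (uniform_measure lborel {0..2 * pi}) circle_borel cis"

definition fourier :: "(complex \<Rightarrow> complex) \<Rightarrow> int \<Rightarrow> complex" where
  "fourier f n = (LINT \<zeta>|circle_measure. \<zeta> powi (- n) * f \<zeta>)"

text \<open>Elements of \<open>L\<^sup>2\<close> are represented by functions on the plane whose values off the circle are
  irrelevant, and a.e.\ equal functions are not identified: \<open>ell2_norm\<close> is a seminorm on these
  representatives, vanishing exactly on the a.e.\ zero functions when \<open>\<Omega>\<close> is positive. Density is
  expressed directly through \<open>ell2_norm\<close>, so it agrees with density in the Hilbert space of
  equivalence classes.\<close>

definition ell2 :: "(nat \<Rightarrow> real) \<Rightarrow> (complex \<Rightarrow> complex) set" where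
  "ell2 \<Omega> = {f. f \<in> borel_measurable circle_measure \<and>
               integrable circle_measure (\<lambda>\<zeta>. (cmod (f \<zeta>))\<^sup>2) \<and>
               (\<lambda>n::int. (cmod (fourier f n))\<^sup>2 * \<Omega> (nat \<bar>n\<bar>)) summable_on UNIV}"

definition ell2_norm :: "(nat \<Rightarrow> real) \<Rightarrow> (complex \<Rightarrow> complex) \<Rightarrow> real" where
  "ell2_norm \<Omega> f = sqrt (\<Sum>\<^sub>\<infinity>n::int. (cmod (fourier f n))\<^sup>2 * \<Omega> (nat \<bar>n\<bar>))"

definition dense_in_ell2 :: "(nat \<Rightarrow> real) \<Rightarrow> (complex \<Rightarrow> complex) set \<Rightarrow> bool" where
  "dense_in_ell2 \<Omega> S \<longleftrightarrow>
     S \<subseteq> ell2 \<Omega> \<and>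
     (\<forall>g\<in>ell2 \<Omega>. \<forall>\<epsilon>>0. \<exists>h\<in>S. ell2_norm \<Omega> (\<lambda>\<zeta>. g \<zeta> - h \<zeta>) < \<epsilon>)"

definition complex_span :: "(complex \<Rightarrow> complex) set \<Rightarrow> (complex \<Rightarrow> complex) set" where
  "complex_span S = {\<lambda>\<zeta>. \<Sum>g\<in>F. c g * g \<zeta> | F c. finite F \<and> F \<subseteq> S}"

definition bicyclic :: "(nat \<Rightarrow> real) \<Rightarrow> (complex \<Rightarrow> complex) \<Rightarrow> bool" where
  "bicyclic \<Omega> f \<longleftrightarrow> dense_in_ell2 \<Omega> (complex_span (range (\<lambda>n::int. \<lambda>\<zeta>. f \<zeta> * \<zeta> powi n)))"

section \<open>Smooth functions on the circle\<close>

text \<open>Here \<open>D k\<close> is the \<open>k\<close>-th derivative of \<open>\<theta> \<mapsto> f (e\<^sup>i\<^sup>\<theta>)\<close>.\<close>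

definition smooth_on_circle :: "(complex \<Rightarrow> complex) \<Rightarrow> bool" where
  "smooth_on_circle f \<longleftrightarrow>
     (\<exists>D::nat \<Rightarrow> real \<Rightarrow> complex. D 0 = (\<lambda>\<theta>. f (cis \<theta>)) \<and>
        (\<forall>k \<theta>. (D k has_vector_derivative D (Suc k) \<theta>) (at \<theta>)))"

definition smooth_compact_support :: "complex set \<Rightarrow> (complex \<Rightarrow> complex) set" where
  "smooth_compact_support U =
     {f. smooth_on_circle f \<and>
         compact (closure (support_on circle f)) \<and> closure (support_on circle f) \<subseteq> U}"

end

theory Submission
  imports Defs
begin

text \<open>By \<open>(C\<^sub>3)\<close> the substitution \<open>t = s/2\<close> gives \<open>\<Omega>(2n) \<le> q \<Omega>(n)\<close> with \<open>q < 4\<close>. This growth bound makes the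
  norm of \<open>\<ell>\<^sup>2(\<Omega>)\<close> equivalent to a Dirichlet-type norm built from averages of
  \<open>\<parallel>f(e\<^sup>i\<^sup>s \<cdot>) - f\<parallel>\<^sub>2\<^sup>2\<close> over small \<open>s\<close>, so that Lipschitz images of continuous elements
  stay in the space and continuous elements form an algebra.

  If \<open>E\<close> carries a measure of finite energy, integration against it is a continuous functional that kills
  every continuous element vanishing on \<open>E\<close>, but not \<open>1\<close>. Conversely, let \<open>K\<close> be the convex set of real
  smooth functions that are at least \<open>1\<close> on \<open>E\<close>. If \<open>0\<close> is not in the closure of \<open>K\<close>, a separating
  functional is nonnegative on functions that are nonnegative on \<open>E\<close>, hence is a finite energy measure on
  \<open>E\<close>. So for \<open>E\<close> of capacity zero some \<open>h\<close> in \<open>K\<close> has small norm, and a flat cut-off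
  of \<open>h\<close> approximates \<open>1\<close> by smooth functions supported off \<open>E\<close>; multiplying by trigonometric polynomials
  gives density. Finally a smooth \<open>\<phi>\<close> supported off the zeros of \<open>f\<close> factors as \<open>f g\<close>, and it is the weak
  limit of the products of \<open>f\<close> with the Fejer means of \<open>g\<close>.\<close>

section \<open>Square-summable families\<close>

text \<open>Why increments: products and cut-offs are hard to estimate on the Fourier side, whereas
  increments under a rotation can be compared pointwise and still see the coefficients through
  Parseval. At scale 2^-j the frequency n enters with a factor of at most min(4, n^2 4^-j).
  Comparing the sum over all scales with \<Omega> asks for geometric decay of 4^-j \<Omega>(2^j),
  which is the meaning of q < 4.

  Why weak limits suffice: the closure of a subspace is detected by bounded functionals, so norm
  bounds together with convergence of each coefficient are enough. The bounds come from the product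
  estimate, because Fejer means increase neither the sup norm nor the norm of the space.

  Why the separating functional yields a measure on E and not just on the circle: the members of K
  are constrained on E only, so positivity is available for functions that may be negative
  elsewhere. Testing it on a small constant minus the distance to E forces the measure to be carried
  by E.

  Only squared norms occur in the estimates, which keeps square roots out of them.\<close>

definition l2 :: "('a \<Rightarrow> complex) set" where
  "l2 = {x. (\<lambda>n. (cmod (x n))\<^sup>2) summable_on UNIV}"

text \<open>The squared norm. A family outside \<open>l2\<close> gets the default value 0 of a
  divergent \<open>infsum\<close>, so an upper bound on \<open>nsq\<close> is informative only
  together with membership in \<open>l2\<close>.\<close>

definition nsq :: "('a \<Rightarrow> complex) \<Rightarrow> real" where
  "nsq x = (\<Sum>\<^sub>\<infinity>n. (cmod (x n))\<^sup>2)"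

lemma nsq_nonneg: "0 \<le> nsq x"
  unfolding nsq_def by (rule infsum_nonneg) simp

lemma l2_bound:
  assumes "\<And>F. finite F \<Longrightarrow> (\<Sum>n\<in>F. (cmod (x n))\<^sup>2) \<le> B"
  shows "x \<in> l2" and "nsq x \<le> B"
proof -
  have s: "(\<lambda>n. (cmod (x n))\<^sup>2) summable_on UNIV"
    by (rule nonneg_bdd_above_summable_on) (auto intro!: bdd_aboveI[where M=B] assms)
  then show "x \<in> l2" by (simp add: l2_def)
  show "nsq x \<le> B" unfolding nsq_def
    by (rule infsum_le_finite_sums[OF s]) (auto intro: assms)
qed

lemma sum_le_nsq:
  assumes "x \<in> l2" "finite F"
  shows "(\<Sum>n\<in>F. (cmod (x n))\<^sup>2) \<le> nsq x"
  unfolding nsq_def using assms by (intro finite_sum_le_infsum) (auto simp: l2_def)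

lemma l2_mono:
  assumes "y \<in> l2" "\<And>n. cmod (x n) \<le> cmod (y n)"
  shows "x \<in> l2" "nsq x \<le> nsq y"
proof -
  have "(\<Sum>n\<in>F. (cmod (x n))\<^sup>2) \<le> nsq y" if "finite F" for F
  proof -
    have "(\<Sum>n\<in>F. (cmod (x n))\<^sup>2) \<le> (\<Sum>n\<in>F. (cmod (y n))\<^sup>2)"
      by (intro sum_mono power_mono assms) auto
    then show ?thesis using sum_le_nsq[OF assms(1) that] by linarith
  qed
  from l2_bound[of x, OF this] show "x \<in> l2" "nsq x \<le> nsq y" by auto
qed

text \<open>A Fatou property: every finite partial sum obeys the bound, and finite sums pass to
  coordinatewise limits. It plays the part of completeness in the projection argument below.\<close>

lemma l2_limit:
  assumes "\<And>N::nat. X N \<in> l2" "\<And>N. nsq (X N) \<le> B" "\<And>n. (\<lambda>N. X N n) \<longlonglongrightarrow> x n"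
  shows "x \<in> l2" "nsq x \<le> B"
proof -
  have "(\<Sum>n\<in>F. (cmod (x n))\<^sup>2) \<le> B" if "finite F" for F
  proof (rule LIMSEQ_le_const2)
    show "(\<lambda>N. \<Sum>n\<in>F. (cmod (X N n))\<^sup>2) \<longlonglongrightarrow> (\<Sum>n\<in>F. (cmod (x n))\<^sup>2)"
      by (intro tendsto_intros assms)
    show "\<exists>N. \<forall>n\<ge>N. (\<Sum>k\<in>F. (cmod (X n k))\<^sup>2) \<le> B"
      using sum_le_nsq[OF assms(1) that] assms(2) order_trans by blast
  qed
  from l2_bound[of x, OF this] show "x \<in> l2" "nsq x \<le> B" by auto
qed

text \<open>The free parameter lets the factor of x come arbitrarily close to 1, as the projection
  argument requires; elsewhere e = 1 is enough.\<close>

lemma norm_add_sq_le: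
  fixes x y :: complex assumes "0 < e"
  shows "(cmod (x + y))\<^sup>2 \<le> (1 + e) * (cmod x)\<^sup>2 + (1 + 1 / e) * (cmod y)\<^sup>2"
proof -
  have "0 \<le> (e * cmod x - cmod y)\<^sup>2 / e" using assms by simp
  also have "\<dots> = e * (cmod x)\<^sup>2 - 2 * cmod x * cmod y + (cmod y)\<^sup>2 / e"
    using assms by (simp add: power2_eq_square field_simps)
  finally have "2 * cmod x * cmod y \<le> e * (cmod x)\<^sup>2 + (cmod y)\<^sup>2 / e" by linarith
  moreover have "(cmod (x + y))\<^sup>2 \<le> (cmod x + cmod y)\<^sup>2"
    by (intro power_mono norm_triangle_ineq) auto
  ultimately show ?thesis by (simp add: power2_sum algebra_simps)
qed

lemma l2_add:
  assumes "x \<in> l2" "y \<in> l2"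
  shows "(\<lambda>n. x n + y n) \<in> l2"
    and "0 < e \<Longrightarrow> nsq (\<lambda>n. x n + y n) \<le> (1 + e) * nsq x + (1 + 1 / e) * nsq y"
proof -
  have *: "(\<Sum>n\<in>F. (cmod (x n + y n))\<^sup>2) \<le> (1 + e) * nsq x + (1 + 1 / e) * nsq y"
    if "finite F" "0 < e" for F and e :: real
  proof -
    have "(\<Sum>n\<in>F. (cmod (x n + y n))\<^sup>2)
        \<le> (\<Sum>n\<in>F. (1 + e) * (cmod (x n))\<^sup>2 + (1 + 1 / e) * (cmod (y n))\<^sup>2)"
      by (intro sum_mono norm_add_sq_le that)
    also have "\<dots> = (1 + e) * (\<Sum>n\<in>F. (cmod (x n))\<^sup>2) + (1 + 1 / e) * (\<Sum>n\<in>F. (cmod (y n))\<^sup>2)"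
      by (simp add: sum.distrib sum_distrib_left)
    also have "\<dots> \<le> (1 + e) * nsq x + (1 + 1 / e) * nsq y"
      using that by (intro add_mono mult_left_mono sum_le_nsq assms) auto
    finally show ?thesis .
  qed
  show "(\<lambda>n. x n + y n) \<in> l2" by (rule l2_bound(1)) (rule *[of _ 1], auto)
  show "nsq (\<lambda>n. x n + y n) \<le> (1 + e) * nsq x + (1 + 1 / e) * nsq y" if "0 < e"
    by (rule l2_bound(2)) (rule *, auto simp: that)
qed

lemma l2_scale:
  assumes "x \<in> l2"
  shows "(\<lambda>n. c * x n) \<in> l2" "nsq (\<lambda>n. c * x n) = (cmod c)\<^sup>2 * nsq x"
  using assms unfolding l2_def nsq_def
  by (auto simp: norm_mult power_mult_distrib infsum_cmult_right intro: summable_on_cmult_right)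

lemma l2_diff:
  assumes "x \<in> l2" "y \<in> l2"
  shows "(\<lambda>n. x n - y n) \<in> l2" "nsq (\<lambda>n. x n - y n) \<le> 2 * nsq x + 2 * nsq y"
  using l2_add[OF assms(1) l2_scale(1)[OF assms(2), of "-1"]] l2_scale(2)[OF assms(2), of "-1"]
    l2_add(2)[OF assms(1) l2_scale(1)[OF assms(2), of "-1"], of 1] by auto

section \<open>The bilinear pairing, weak convergence and projection\<close>

lemma pairing_summable:
  assumes "x \<in> l2" "y \<in> l2"
  shows "(\<lambda>n. cmod (x n * y n)) summable_on UNIV"
proof (rule abs_summable_product)
  show "(\<lambda>n. cmod (x n * x n)) summable_on UNIV" "(\<lambda>n. cmod (y n * y n)) summable_on UNIV"
    using assms by (simp_all add: l2_def norm_mult power2_eq_square)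
qed

lemma pairing_summable':
  assumes "x \<in> l2" "y \<in> l2"
  shows "(\<lambda>n. x n * y n) summable_on UNIV"
  using pairing_summable[OF assms] by (rule abs_summable_summable)

text \<open>Cauchy-Schwarz with a free scaling t, from a b \<le> (t a^2 + b^2 / t) / 2 in each
  coordinate; this form avoids square roots.\<close>

lemma pairing_bound:
  fixes t :: real
  assumes "x \<in> l2" "y \<in> l2" "0 < t"
  shows "cmod (\<Sum>\<^sub>\<infinity>n. x n * y n) \<le> (t * nsq x + nsq y / t) / 2"
proof -
  have s: "(\<lambda>n. (cmod (x n))\<^sup>2) summable_on UNIV" "(\<lambda>n. (cmod (y n))\<^sup>2) summable_on UNIV"
    using assms by (auto simp: l2_def)
  have "cmod (\<Sum>\<^sub>\<infinity>n. x n * y n) \<le> (\<Sum>\<^sub>\<infinity>n. cmod (x n * y n))"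
    by (rule norm_infsum_bound[OF pairing_summable[OF assms(1,2)]])
  also have "\<dots> \<le> (\<Sum>\<^sub>\<infinity>n. t / 2 * (cmod (x n))\<^sup>2 + 1 / (2 * t) * (cmod (y n))\<^sup>2)"
  proof (rule infsum_mono)
    show "(\<lambda>n. cmod (x n * y n)) summable_on UNIV" using pairing_summable[OF assms(1,2)] .
    show "(\<lambda>n. t / 2 * (cmod (x n))\<^sup>2 + 1 / (2 * t) * (cmod (y n))\<^sup>2) summable_on UNIV"
      by (intro summable_on_add summable_on_cmult_right s)
    fix n
    have "0 \<le> (t * cmod (x n) - cmod (y n))\<^sup>2 / (2 * t)" using assms(3) by simp
    also have "\<dots> = t / 2 * (cmod (x n))\<^sup>2 - cmod (x n) * cmod (y n) + 1 / (2 * t) * (cmod (y n))\<^sup>2"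
      using assms(3) by (simp add: power2_eq_square field_simps)
    finally show "cmod (x n * y n) \<le> t / 2 * (cmod (x n))\<^sup>2 + 1 / (2 * t) * (cmod (y n))\<^sup>2"
      by (simp add: norm_mult)
  qed
  also have "\<dots> = t / 2 * nsq x + 1 / (2 * t) * nsq y"
    unfolding nsq_def infsum_cmult_right[OF s(1), symmetric] infsum_cmult_right[OF s(2), symmetric]
    by (intro infsum_add summable_on_cmult_right s)
  finally show ?thesis by (simp add: field_simps)
qed

lemma nsq_expand:
  fixes t :: real
  assumes "x \<in> l2" "y \<in> l2"
  shows "nsq (\<lambda>n. x n + of_real t * y n) = nsq x + 2 * t * Re (\<Sum>\<^sub>\<infinity>n. cnj (x n) * y n) + t\<^sup>2 * nsq y"
proof -
  have s: "(\<lambda>n. (cmod (x n))\<^sup>2) summable_on UNIV" "(\<lambda>n. (cmod (y n))\<^sup>2) summable_on UNIV"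
    using assms by (auto simp: l2_def)
  have cx: "(\<lambda>n. cnj (x n)) \<in> l2" using assms by (simp add: l2_def)
  have p: "(\<lambda>n. cnj (x n) * y n) summable_on UNIV" by (rule pairing_summable'[OF cx assms(2)])
  then have p': "(\<lambda>n. Re (cnj (x n) * y n)) summable_on UNIV" by (rule summable_on_Re)
  have e: "(cmod (x n + of_real t * y n))\<^sup>2
      = (cmod (x n))\<^sup>2 + 2 * t * Re (cnj (x n) * y n) + t\<^sup>2 * (cmod (y n))\<^sup>2" for n
    unfolding cmod_power2 by (simp add: power2_eq_square algebra_simps)
  show ?thesis
    unfolding nsq_def e infsum_Re[OF p, symmetric] infsum_cmult_right'[symmetric]
    by (subst infsum_add[symmetric], intro s, intro summable_on_cmult_right p', subst infsum_add[symmetric],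
      intro summable_on_add summable_on_cmult_right s p', intro summable_on_cmult_right s) (rule refl)
qed

lemma nsq_parallelogram:
  assumes "x \<in> l2" "y \<in> l2"
  shows "nsq (\<lambda>n. x n - y n) + nsq (\<lambda>n. x n + y n) = 2 * nsq x + 2 * nsq y"
  using nsq_expand[OF assms, of "-1"] nsq_expand[OF assms, of 1] by simp

lemma l2_truncate:
  assumes y: "y \<in> l2" and e: "0 < e"
  obtains F where "finite F" "nsq (\<lambda>n. if n \<in> F then 0 else y n) \<le> e"
proof -
  obtain F where F: "finite F" "dist (\<Sum>n\<in>F. (cmod (y n))\<^sup>2) (nsq y) \<le> e"
    using infsum_finite_approximation[of "\<lambda>n. (cmod (y n))\<^sup>2" UNIV e] y e
    unfolding l2_def nsq_def by auto
  have "nsq (\<lambda>n. if n \<in> F then 0 else y n) \<le> e"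
  proof (rule l2_bound(2))
    fix G :: "'a set" assume G: "finite G"
    have "(\<Sum>n\<in>G. (cmod (if n \<in> F then 0 else y n))\<^sup>2) = (\<Sum>n\<in>G - F. (cmod (y n))\<^sup>2)"
      using G by (intro sum.mono_neutral_cong_right) auto
    also have "\<dots> + (\<Sum>n\<in>F. (cmod (y n))\<^sup>2) = (\<Sum>n\<in>(G - F) \<union> F. (cmod (y n))\<^sup>2)"
      using G F by (subst sum.union_disjoint) auto
    also have "\<dots> \<le> nsq y" using G F by (intro sum_le_nsq y) auto
    finally show "(\<Sum>n\<in>G. (cmod (if n \<in> F then 0 else y n))\<^sup>2) \<le> e"
      using F(2) unfolding dist_real_def by linarith
  qed
  with F(1) show thesis by (rule that)
qed

text \<open>Cut y to finitely many coordinates: there coordinatewise convergence applies, and the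
  small remaining tail of y is paired with a family that is bounded in norm.\<close>

lemma weak_convergence:
  assumes "\<And>N::nat. X N \<in> l2" "\<And>N. nsq (X N) \<le> B" "\<And>n. (\<lambda>N. X N n) \<longlonglongrightarrow> x n" "y \<in> l2"
  shows "(\<lambda>N. \<Sum>\<^sub>\<infinity>n. X N n * y n) \<longlonglongrightarrow> (\<Sum>\<^sub>\<infinity>n. x n * y n)"
proof -
  have xl: "x \<in> l2" "nsq x \<le> B" using l2_limit[OF assms(1-3)] by auto
  define z where "z N n = X N n - x n" for N n
  have zl: "z N \<in> l2" "nsq (z N) \<le> 4 * B" for N
    unfolding z_def using l2_diff[OF assms(1) xl(1), of N] assms(2)[of N] xl(2) by auto
  have z0: "(\<lambda>N. z N n) \<longlonglongrightarrow> 0" for n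
    unfolding z_def by (rule LIM_zero[OF assms(3)])
  have eq: "(\<Sum>\<^sub>\<infinity>n. X N n * y n) - (\<Sum>\<^sub>\<infinity>n. x n * y n) = (\<Sum>\<^sub>\<infinity>n. z N n * y n)" for N
    unfolding z_def left_diff_distrib
    using infsum_add[OF pairing_summable'[OF assms(1)[of N] assms(4)] summable_on_uminus[THEN iffD2, OF pairing_summable'[OF xl(1) assms(4)]]]
    by (simp add: infsum_uminus)
  have "(\<lambda>N. \<Sum>\<^sub>\<infinity>n. z N n * y n) \<longlonglongrightarrow> 0"
  proof (rule LIMSEQ_I)
    fix r :: real assume r: "0 < r"
    have B0: "0 \<le> B" using nsq_nonneg[of "X 0"] assms(2)[of 0] by linarith
    \<comment> \<open>The differences have squared norm at most 4 B, so this t makes their share of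
      the pairing bound at most r / 2. The tail of y is then chosen with squared norm at most t r /
      2, which makes its share r / 2 as well.\<close>
    define t where "t = r / (8 * B + 1)"
    have t: "0 < t" "t * (4 * B) \<le> r / 2"
      using r B0 by (auto simp: t_def field_simps mult_nonneg_nonneg)
    have "0 < t * r / 2" using t(1) r by simp
    then obtain F where F: "finite F" "nsq (\<lambda>n. if n \<in> F then 0 else y n) \<le> t * r / 2"
      by (rule l2_truncate[OF assms(4)]) (rule that)
    define y' where "y' n = (if n \<in> F then 0 else y n)" for n
    have y'l: "y' \<in> l2" by (rule l2_mono(1)[OF assms(4)]) (auto simp: y'_def)
    have y': "nsq y' \<le> t * r / 2" using F(2) by (simp add: y'_def[abs_def])
    have fin: "(\<lambda>N. \<Sum>n\<in>F. z N n * y n) \<longlonglongrightarrow> 0"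
      by (intro tendsto_null_sum tendsto_mult_left_zero z0)
    then obtain N0 where N0: "\<And>N. N \<ge> N0 \<Longrightarrow> cmod (\<Sum>n\<in>F. z N n * y n) < r / 2"
      using LIMSEQ_D[OF fin, of "r/2"] r by auto
    show "\<exists>no. \<forall>N\<ge>no. norm ((\<Sum>\<^sub>\<infinity>n. z N n * y n) - 0) < r"
    proof (intro exI allI impI)
      fix N assume "N \<ge> N0"
      have "(\<Sum>\<^sub>\<infinity>n. z N n * y n) = (\<Sum>\<^sub>\<infinity>n. (if n \<in> F then z N n * y n else 0) + z N n * y' n)"
        by (intro infsum_cong) (auto simp: y'_def)
      also have "\<dots> = (\<Sum>\<^sub>\<infinity>n. (if n \<in> F then z N n * y n else 0)) + (\<Sum>\<^sub>\<infinity>n. z N n * y' n)"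
      proof (rule infsum_add)
        show "(\<lambda>n. if n \<in> F then z N n * y n else 0) summable_on UNIV"
          using summable_on_cong_neutral[of F UNIV "\<lambda>n. z N n * y n" "\<lambda>n. if n \<in> F then z N n * y n else 0"] F(1)
          by auto
      qed (rule pairing_summable'[OF zl(1) y'l])
      also have "(\<Sum>\<^sub>\<infinity>n. (if n \<in> F then z N n * y n else 0)) = (\<Sum>n\<in>F. z N n * y n)"
        using infsum_cong_neutral[of F UNIV "\<lambda>n. z N n * y n" "\<lambda>n. if n \<in> F then z N n * y n else 0"] F(1)
        by auto
      finally have "cmod (\<Sum>\<^sub>\<infinity>n. z N n * y n) \<le> cmod (\<Sum>n\<in>F. z N n * y n) + cmod (\<Sum>\<^sub>\<infinity>n. z N n * y' n)"
        by (simp add: norm_triangle_ineq)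
      also have "cmod (\<Sum>\<^sub>\<infinity>n. z N n * y' n) \<le> (t * nsq (z N) + nsq y' / t) / 2"
        by (rule pairing_bound[OF zl(1) y'l t(1)])
      also have "\<dots> \<le> (r / 2 + r / 2) / 2"
      proof -
        have "t * nsq (z N) \<le> t * (4 * B)" using zl(2)[of N] t(1) by (intro mult_left_mono) auto
        moreover have "nsq y' / t \<le> r / 2" using y' t(1) by (simp add: field_simps)
        ultimately show ?thesis using t(2) by (intro divide_right_mono add_mono) linarith+
      qed
      finally show "norm ((\<Sum>\<^sub>\<infinity>n. z N n * y n) - 0) < r" using N0[OF \<open>N \<ge> N0\<close>] by simp
    qed
  qed
  then show ?thesis unfolding eq[symmetric] by (rule LIM_zero_cancel)
qed

text \<open>The separating functional is the pairing with (the conjugate of) the element of least norm of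
  the closure of \<open>K\<close>.\<close>

lemma l2_separation:
  fixes K :: "('a \<Rightarrow> complex) set"
  assumes K: "K \<subseteq> l2" "K \<noteq> {}"
    and conv: "\<And>x y t. x \<in> K \<Longrightarrow> y \<in> K \<Longrightarrow> 0 \<le> t \<Longrightarrow> t \<le> 1 \<Longrightarrow>
      (\<lambda>n. of_real (1 - t) * x n + of_real t * y n) \<in> K"
    and d: "\<And>x. x \<in> K \<Longrightarrow> d \<le> nsq x"
  obtains u where "u \<in> l2" "\<And>x. x \<in> K \<Longrightarrow> d \<le> Re (\<Sum>\<^sub>\<infinity>n. u n * x n)"
proof -
  define D where "D = Inf (nsq ` K)"
  have bdd: "bdd_below (nsq ` K)" by (rule bdd_belowI[where m=0]) (auto simp: nsq_nonneg)
  have D: "D \<le> nsq x" if "x \<in> K" for x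
    unfolding D_def by (rule cINF_lower[OF bdd that])
  have dD: "d \<le> D" unfolding D_def by (rule cINF_greatest[OF K(2) d])
  have "\<exists>x\<in>K. nsq x < D + 1 / real (Suc k)" for k
    using cInf_lessD[of "nsq ` K" "D + 1 / real (Suc k)"] K(2) unfolding D_def by auto
  then obtain h where hK: "\<And>k. h k \<in> K" and hn: "\<And>k. nsq (h k) < D + 1 / real (Suc k)" by metis
  have hl: "h k \<in> l2" for k using hK K(1) by auto
  \<comment> \<open>Midpoints stay in \<open>K\<close>, so their squared norm is at least
    \<open>D\<close>; the parallelogram identity then makes a minimising sequence Cauchy.\<close>
  have hd: "nsq (\<lambda>n. h k n - h l n) \<le> 2 / real (Suc k) + 2 / real (Suc l)" for k l
  proof -
    have "(\<lambda>n. of_real (1 - 1/2) * h k n + of_real (1/2) * h l n) \<in> K"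
      by (rule conv[OF hK hK]) linarith+
    moreover have "of_real (1 - 1/2) * h k n + of_real (1/2) * h l n = of_real (1/2) * (h k n + h l n)" for n
      by (simp add: distrib_left)
    ultimately have "(\<lambda>n. of_real (1/2) * (h k n + h l n)) \<in> K" by (simp only:)
    then have "D \<le> nsq (\<lambda>n. of_real (1/2) * (h k n + h l n))" by (rule D)
    then have "4 * D \<le> nsq (\<lambda>n. h k n + h l n)"
      unfolding l2_scale(2)[OF l2_add(1)[OF hl[of k] hl[of l]]] by (simp add: power2_eq_square)
    then have "nsq (\<lambda>n. h k n - h l n) \<le> 2 * nsq (h k) + 2 * nsq (h l) - 4 * D"
      using nsq_parallelogram[OF hl[of k] hl[of l]] by arith
    moreover have "a \<le> 2 * p + 2 * q" if "a \<le> 2 * b + 2 * c - 4 * D" "b < D + p" "c < D + q"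
      for a b c p q :: real
      using that by linarith
    ultimately have "nsq (\<lambda>n. h k n - h l n) \<le> 2 * (1 / real (Suc k)) + 2 * (1 / real (Suc l))"
      using hn by blast
    then show ?thesis by simp
  qed
  have coord: "cmod (h k n - h l n) ^ 2 \<le> 2 / real (Suc k) + 2 / real (Suc l)" for k l n
    using sum_le_nsq[OF l2_diff(1)[OF hl hl], of "{n}" k l] hd[of k l] by simp
  have "Cauchy (\<lambda>k. h k n)" for n
  proof (rule CauchyI)
    fix e :: real assume e: "0 < e"
    obtain M :: nat where M: "4 / e\<^sup>2 < real M" using reals_Archimedean2 by blast
    have Mp: "0 < real M" using M by (rule le_less_trans[rotated]) simp
    show "\<exists>M. \<forall>m\<ge>M. \<forall>l\<ge>M. norm (h m n - h l n) < e"
    proof (intro exI allI impI)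
      fix m l assume ml: "m \<ge> M" "l \<ge> M"
      have "2 / real (Suc j) \<le> 2 / real M" if "j \<ge> M" for j
        using that Mp by (intro divide_left_mono) auto
      then have "cmod (h m n - h l n) ^ 2 \<le> 2 / real M + 2 / real M"
        using coord[of m n l] ml by (meson add_mono order_trans)
      also have "\<dots> < e\<^sup>2" using M Mp e by (simp add: field_simps)
      finally show "norm (h m n - h l n) < e" using e by (simp add: power_less_imp_less_base)
    qed
  qed
  then have "\<exists>l. (\<lambda>k. h k n) \<longlonglongrightarrow> l" for n
    using Cauchy_convergent unfolding convergent_def by blast
  then obtain u where u: "\<And>n. (\<lambda>k. h k n) \<longlonglongrightarrow> u n" by metis
  have hu: "nsq (\<lambda>n. h k n - u n) \<le> 2 / real (Suc k) + 2 / real (Suc m)"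
     and hul: "(\<lambda>n. h k n - u n) \<in> l2" for k m
  proof -
    have *: "nsq (\<lambda>n. h k n - h (l + m) n) \<le> 2 / real (Suc k) + 2 / real (Suc m)" for l
    proof -
      have "2 / real (Suc (l + m)) \<le> 2 / real (Suc m)" by (intro divide_left_mono) auto
      then show ?thesis using hd[of k "l + m"] by linarith
    qed
    have lim: "(\<lambda>l. h k n - h (l + m) n) \<longlonglongrightarrow> h k n - u n" for n
      by (intro tendsto_intros LIMSEQ_ignore_initial_segment u)
    show "nsq (\<lambda>n. h k n - u n) \<le> 2 / real (Suc k) + 2 / real (Suc m)" "(\<lambda>n. h k n - u n) \<in> l2"
      using l2_limit[of "\<lambda>l n. h k n - h (l + m) n", OF l2_diff(1)[OF hl hl] * lim] by auto
  qed
  have ul: "u \<in> l2"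
    using l2_diff(1)[OF hl[of 0] hul[of 0]] by simp
  have uD: "nsq u \<le> D + 1 / real (Suc m)" for m
  proof (rule l2_limit(2)[of "\<lambda>k. h (k + m)"])
    fix k
    have "1 / real (Suc (k + m)) \<le> 1 / real (Suc m)" by (intro divide_left_mono) auto
    then show "nsq (h (k + m)) \<le> D + 1 / real (Suc m)" using hn[of "k + m"] by linarith
  qed (auto intro: hl LIMSEQ_ignore_initial_segment[OF u])
  have lim1: "(\<lambda>m. D + c / real (Suc m)) \<longlonglongrightarrow> D + 0" for c
    using tendsto_mult[OF tendsto_const[of c] LIMSEQ_inverse_real_of_nat]
    by (intro tendsto_intros) (simp_all add: divide_inverse)
  have uD': "nsq u \<le> D"
    using LIMSEQ_le_const[OF lim1[of 1], of "nsq u"] uD by auto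
  \<comment> \<open>The limit \<open>u\<close> need not belong to \<open>K\<close>, so the lower
    bound along the segment from \<open>u\<close> to \<open>x\<close> is inherited from segments
    that start at \<open>h k\<close>. The error is weighted by 1 + 1/e: first k tends to infinity,
    then e to 0.\<close>
  have seg: "D \<le> nsq (\<lambda>n. u n + of_real t * (x n - u n))" if x: "x \<in> K" and t: "0 \<le> t" "t \<le> 1" for x t
  proof -
    have xl: "x \<in> l2" using x K(1) by auto
    define p where "p = (\<lambda>n. u n + of_real t * (x n - u n))"
    have pl: "p \<in> l2" unfolding p_def by (intro l2_add l2_scale l2_diff xl ul)
    have bd: "D \<le> (1 + e) * nsq p" if e: "0 < e" for e
    proof -
      have bk: "D \<le> (1 + e) * nsq p + (1 + 1 / e) * (2 / real (Suc k) + 2 / real (Suc k))" for k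
      proof -
        have "D \<le> nsq (\<lambda>n. of_real (1 - t) * h k n + of_real t * x n)"
          by (intro D conv hK x t)
        also have "nsq (\<lambda>n. of_real (1 - t) * h k n + of_real t * x n)
            = nsq (\<lambda>n. p n + of_real (1 - t) * (h k n - u n))"
          by (simp add: p_def algebra_simps)
        also have "\<dots> \<le> (1 + e) * nsq p + (1 + 1 / e) * nsq (\<lambda>n. of_real (1 - t) * (h k n - u n))"
          by (intro l2_add(2) l2_scale pl hul e)
        also have "nsq (\<lambda>n. of_real (1 - t) * (h k n - u n)) = (1 - t)\<^sup>2 * nsq (\<lambda>n. h k n - u n)"
          by (subst l2_scale(2)[OF hul]) (simp add: norm_of_real del: of_real_diff)
        also have "(1 - t)\<^sup>2 * nsq (\<lambda>n. h k n - u n) \<le> 1 * nsq (\<lambda>n. h k n - u n)"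
          using t by (intro mult_right_mono nsq_nonneg) (simp add: power_le_one)
        also have "1 * nsq (\<lambda>n. h k n - u n) \<le> 2 / real (Suc k) + 2 / real (Suc k)" using hu[of k k] by simp
        finally show ?thesis using e by (simp add: mult_left_mono)
      qed
      have "D \<le> (1 + e) * nsq p + ((1 + 1 / e) * 4) / real (Suc k)" for k
      proof -
        have "(1 + 1 / e) * (2 / real (Suc k) + 2 / real (Suc k)) = ((1 + 1 / e) * 4) / real (Suc k)"
          by (simp add: add_divide_distrib[symmetric])
        then show ?thesis using bk[of k] by simp
      qed
      moreover have "(\<lambda>k. (1 + e) * nsq p + ((1 + 1 / e) * 4) / real (Suc k)) \<longlonglongrightarrow> (1 + e) * nsq p + 0"
        using tendsto_mult[OF tendsto_const[of "(1 + 1 / e) * 4"] LIMSEQ_inverse_real_of_nat]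
        by (intro tendsto_intros) (simp_all add: divide_inverse)
      ultimately show ?thesis
        using LIMSEQ_le_const[of "\<lambda>k. (1 + e) * nsq p + ((1 + 1 / e) * 4) / real (Suc k)" "(1 + e) * nsq p + 0" D]
        by auto
    qed
    have "D \<le> nsq p"
    proof (rule field_le_epsilon)
      fix e :: real assume e: "0 < e"
      have "D \<le> (1 + e / (nsq p + 1)) * nsq p" using e nsq_nonneg[of p] by (intro bd) (auto intro: divide_pos_pos)
      also have "\<dots> \<le> nsq p + e" using e nsq_nonneg[of p] by (simp add: field_simps)
      finally show "D \<le> nsq p + e" .
    qed
    then show ?thesis by (simp add: p_def)
  qed
  define v where "v n = cnj (u n)" for n
  have vl: "v \<in> l2" using ul by (simp add: v_def l2_def)
  show thesis
  proof (rule that[OF vl])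
    fix x assume x: "x \<in> K"
    then have xl: "x \<in> l2" using K(1) by auto
    have yl: "(\<lambda>n. x n - u n) \<in> l2" by (rule l2_diff[OF xl ul])
    define a where "a = Re (\<Sum>\<^sub>\<infinity>n. cnj (u n) * (x n - u n))"
    define b where "b = nsq (\<lambda>n. x n - u n)"
    \<comment> \<open>Along the segment the squared norm is minimal at t = 0, so the linear
      coefficient \<open>a\<close> cannot be negative. This is the variational inequality of the
      projection.\<close>
    have q: "0 \<le> 2 * t * a + t\<^sup>2 * b" if t: "0 \<le> t" "t \<le> 1" for t
      using seg[OF x t] nsq_expand[OF ul yl, of t] uD' by (simp add: a_def b_def)
    have a0: "0 \<le> a"
    proof (rule ccontr)
      assume a: "\<not> 0 \<le> a"
      \<comment> \<open>Small enough for the negative linear term to win: t (b + 1) \<le> -a gives 2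
        a + t b \<le> a - t < 0.\<close>
      define t where "t = min 1 (- a / (b + 1))"
      have b0: "0 \<le> b" unfolding b_def by (rule nsq_nonneg)
      have t: "0 < t" "t \<le> 1" "t \<le> - a / (b + 1)"
        using a b0 by (auto simp: t_def intro: divide_neg_pos)
      then have t': "t * (b + 1) \<le> - a" using b0 pos_le_divide_eq[of "b + 1" t "- a"] by linarith
      have "2 * t * a + t\<^sup>2 * b = t * (2 * a + t * b)" by (simp add: power2_eq_square algebra_simps)
      moreover have "2 * a + t * b < 0" using t t' a by (simp add: algebra_simps)
      ultimately have "2 * t * a + t\<^sup>2 * b < 0" using t(1) by (simp add: mult_pos_neg)
      then show False using q[of t] t by auto
    qed
    have "(\<Sum>\<^sub>\<infinity>n. v n * x n) = (\<Sum>\<^sub>\<infinity>n. cnj (u n) * (x n - u n) + cnj (u n) * u n)"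
      by (simp add: v_def algebra_simps)
    also have "\<dots> = (\<Sum>\<^sub>\<infinity>n. cnj (u n) * (x n - u n)) + (\<Sum>\<^sub>\<infinity>n. cnj (u n) * u n)"
      using pairing_summable'[OF vl yl] pairing_summable'[OF vl ul]
      by (intro infsum_add) (auto simp: v_def)
    finally have split: "(\<Sum>\<^sub>\<infinity>n. v n * x n)
      = (\<Sum>\<^sub>\<infinity>n. cnj (u n) * (x n - u n)) + (\<Sum>\<^sub>\<infinity>n. cnj (u n) * u n)" .
    have "Re (\<Sum>\<^sub>\<infinity>n. v n * x n) = a + nsq u"
    proof -
      have "Re (\<Sum>\<^sub>\<infinity>n. v n * u n) = nsq u"
        unfolding infsum_Re[OF pairing_summable'[OF vl ul], symmetric] nsq_def cmod_power2
        by (simp add: v_def power2_eq_square)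
      then show ?thesis using arg_cong[OF split, of Re] unfolding v_def a_def plus_complex.sel by linarith
    qed
    moreover have "D \<le> nsq u" using seg[OF x, of 0] by simp
    ultimately show "d \<le> Re (\<Sum>\<^sub>\<infinity>n. v n * x n)" using a0 dD by linarith
  qed
qed

section \<open>Fourier coefficients on the circle\<close>

lemma cis_measurable: "cis \<in> borel \<rightarrow>\<^sub>M circle_borel"
  by (rule measurable_restrict_space2) (auto intro!: borel_measurable_continuous_onI continuous_intros)

lemma space_circle_measure [simp]: "space circle_measure = circle"
  by (simp add: circle_measure_def space_restrict_space)

lemma sets_circle_measure [simp]: "sets circle_measure = sets circle_borel"
  by (simp add: circle_measure_def)

lemma prob_space_circle_measure: "prob_space circle_measure"
proof -
  interpret prob_space "uniform_measure lborel {0..2 * pi}"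
    by (rule prob_space_uniform_measure) auto
  show ?thesis unfolding circle_measure_def
    by (rule prob_space_distr) (use cis_measurable in simp)
qed

interpretation circle: prob_space circle_measure
  by (rule prob_space_circle_measure)

lemma measure_circle [simp]: "measure circle_measure circle = 1"
  using circle.prob_space by simp

lemma circle_measurable_continuous:
  fixes f :: "complex \<Rightarrow> 'a::topological_space"
  assumes "continuous_on circle f"
  shows "f \<in> borel_measurable circle_measure"
  using borel_measurable_continuous_on_restrict[OF assms]
  by (simp cong: measurable_cong_sets)

lemma continuous_on_circle_bounded:
  fixes f :: "complex \<Rightarrow> 'a::real_normed_vector"
  assumes "continuous_on circle f"
  obtains B where "0 \<le> B" "\<And>\<zeta>. \<zeta> \<in> circle \<Longrightarrow> norm (f \<zeta>) \<le> B"
proof -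
  have "compact (f ` circle)" by (rule compact_continuous_image[OF assms]) simp
  then have "bounded (f ` circle)" by (rule compact_imp_bounded)
  then obtain B where "\<forall>x\<in>f ` circle. norm x \<le> B" unfolding bounded_iff by blast
  then have "norm (f \<zeta>) \<le> max B 0" if "\<zeta> \<in> circle" for \<zeta>
    using that by (meson image_eqI max.coboundedI1)
  then show thesis using that[of "max B 0"] by simp
qed

lemma circle_integrable_continuous:
  fixes f :: "complex \<Rightarrow> 'a::{banach, second_countable_topology}"
  assumes "continuous_on circle f"
  shows "integrable circle_measure f"
proof -
  obtain B where "\<And>\<zeta>. \<zeta> \<in> circle \<Longrightarrow> norm (f \<zeta>) \<le> B"
    using continuous_on_circle_bounded[OF assms] by blast
  then show ?thesis
    by (intro circle.integrable_const_bound[where B=B] circle_measurable_continuous[OF assms]) auto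
qed

lemma circle_integral_bound:
  fixes f :: "complex \<Rightarrow> 'a::{banach, second_countable_topology}"
  assumes "integrable circle_measure f" "\<And>\<zeta>. \<zeta> \<in> circle \<Longrightarrow> norm (f \<zeta>) \<le> B"
  shows "norm (LINT \<zeta>|circle_measure. f \<zeta>) \<le> B"
proof -
  have "norm (LINT \<zeta>|circle_measure. f \<zeta>) \<le> (LINT \<zeta>|circle_measure. norm (f \<zeta>))"
    by (rule integral_norm_bound)
  also have "\<dots> \<le> (LINT \<zeta>|circle_measure. B)"
    by (rule integral_mono) (use assms in auto)
  finally show ?thesis by (simp add: circle.prob_space)
qed

lemma circle_integral_cong:
  assumes "\<And>\<zeta>. \<zeta> \<in> circle \<Longrightarrow> f \<zeta> = g \<zeta>"
  shows "(LINT \<zeta>|circle_measure. f \<zeta>) = (LINT \<zeta>|circle_measure. g \<zeta>)"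
  by (rule Bochner_Integration.integral_cong) (auto intro: assms)

lemma fourier_cong:
  assumes "\<And>\<zeta>. \<zeta> \<in> circle \<Longrightarrow> f \<zeta> = g \<zeta>"
  shows "fourier f = fourier g"
  unfolding fourier_def by (intro ext circle_integral_cong) (simp add: assms)

lemma norm_powi_circle [simp]: "cmod \<zeta> = 1 \<Longrightarrow> cmod (\<zeta> powi n) = 1"
  by (simp add: norm_power_int)

lemma continuous_powi_circle [continuous_intros]: "continuous_on circle (\<lambda>\<zeta>. \<zeta> powi n)"
  by (intro continuous_intros) auto

lemma circle_integral_powi: "(LINT \<zeta>|circle_measure. \<zeta> powi n) = (if n = 0 then 1 else 0)"
proof (cases "n = 0")
  case True then show ?thesis by (simp add: circle.prob_space)
next
  case False
  have meas: "(\<lambda>\<zeta>. \<zeta> powi n) \<in> borel_measurable circle_borel"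
    using circle_measurable_continuous[OF continuous_powi_circle[of n]] by (simp cong: measurable_cong_sets)
  have "(LINT \<zeta>|circle_measure. \<zeta> powi n) = (LINT x|uniform_measure lborel {0..2 * pi}. cis x powi n)"
    unfolding circle_measure_def
    by (rule integral_distr) (use cis_measurable meas in simp_all)
  also have "\<dots> = (LINT x|lborel. (indicator {0..2 * pi} x / (2 * pi)) *\<^sub>R cis (of_int n * x))"
  proof -
    have "uniform_measure lborel {0..2 * pi} = density lborel (\<lambda>x. ennreal (indicator {0..2 * pi} x / (2 * pi)))"
      unfolding uniform_measure_def
      using divide_ennreal[of 1 "2 * pi"] by (intro density_cong) (auto simp: indicator_def)
    then show ?thesis
      by (simp add: cis_power_int)
        (subst integral_density, auto intro!: borel_measurable_continuous_onI continuous_intros)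
  qed
  also have "\<dots> = (LINT x|lborel. indicator {0..2 * pi} x *\<^sub>R (cis (of_int n * x) / (2 * pi)))"
    by (intro Bochner_Integration.integral_cong) (auto simp: indicator_def scaleR_conv_of_real)
  also have "\<dots> = cis (of_int n * (2 * pi)) / (2 * pi * \<i> * of_int n) - cis (of_int n * 0) / (2 * pi * \<i> * of_int n)"
  proof (rule integral_FTC_Icc)
    show "((\<lambda>x. cis (of_int n * x) / (2 * pi * \<i> * of_int n)) has_vector_derivative cis (of_int n * x) / (2 * pi))
        (at x within {0..2 * pi})" for x
      using False unfolding has_vector_derivative_def
      by (auto intro!: derivative_eq_intros simp: scaleR_conv_of_real field_simps)
  qed (auto intro!: continuous_intros)
  also have "cis (of_int n * (2 * pi)) = 1"
    by (simp add: cis_multiple_2pi mult.commute[of _ "2 * pi"])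
  finally show ?thesis using False by simp
qed

lemma integrable_powi_mult:
  assumes "integrable circle_measure f"
  shows "integrable circle_measure (\<lambda>\<zeta>. \<zeta> powi n * f \<zeta>)"
proof (rule Bochner_Integration.integrable_bound[OF assms])
  show "(\<lambda>\<zeta>. \<zeta> powi n * f \<zeta>) \<in> borel_measurable circle_measure"
    by (intro borel_measurable_times circle_measurable_continuous continuous_powi_circle
        borel_measurable_integrable[OF assms])
qed (auto intro!: AE_I2 simp: norm_mult)

section \<open>Linearity, shifts and bounds for Fourier coefficients\<close>

lemma fourier_add:
  assumes "integrable circle_measure f" "integrable circle_measure g"
  shows "fourier (\<lambda>\<zeta>. f \<zeta> + g \<zeta>) n = fourier f n + fourier g n"
  unfolding fourier_def distrib_left
  by (intro Bochner_Integration.integral_add integrable_powi_mult assms)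

lemma fourier_diff:
  assumes "integrable circle_measure f" "integrable circle_measure g"
  shows "fourier (\<lambda>\<zeta>. f \<zeta> - g \<zeta>) n = fourier f n - fourier g n"
  unfolding fourier_def right_diff_distrib
  by (intro Bochner_Integration.integral_diff integrable_powi_mult assms)

lemma fourier_cmult: "fourier (\<lambda>\<zeta>. c * f \<zeta>) n = c * fourier f n"
  unfolding fourier_def by (simp add: mult.left_commute[of _ c])

lemma fourier_sum:
  assumes "\<And>i. i \<in> I \<Longrightarrow> integrable circle_measure (f i)"
  shows "fourier (\<lambda>\<zeta>. \<Sum>i\<in>I. f i \<zeta>) n = (\<Sum>i\<in>I. fourier (f i) n)"
  unfolding fourier_def sum_distrib_left
  by (intro Bochner_Integration.integral_sum integrable_powi_mult assms)

lemma fourier_shift: "fourier (\<lambda>\<zeta>. f \<zeta> * \<zeta> powi m) n = fourier f (n - m)"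
  unfolding fourier_def
proof (rule circle_integral_cong)
  fix \<zeta> :: complex assume "\<zeta> \<in> circle"
  then have "\<zeta> \<noteq> 0" by auto
  then have "\<zeta> powi (- n) * \<zeta> powi m = \<zeta> powi (- (n - m))" by (simp flip: power_int_add)
  then show "\<zeta> powi (- n) * (f \<zeta> * \<zeta> powi m) = \<zeta> powi (- (n - m)) * f \<zeta>"
    by (simp add: mult.commute mult.left_commute)
qed

lemma fourier_powi: "fourier (\<lambda>\<zeta>. \<zeta> powi k) n = (if n = k then 1 else 0)"
  using fourier_shift[of "\<lambda>_. 1" k n] circle_integral_powi[of "- (n - k)"] by (simp add: fourier_def)

lemma fourier_bound:
  assumes "integrable circle_measure f" "\<And>\<zeta>. \<zeta> \<in> circle \<Longrightarrow> cmod (f \<zeta>) \<le> B"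
  shows "cmod (fourier f n) \<le> B"
  unfolding fourier_def
  by (rule circle_integral_bound) (use assms in \<open>auto intro: integrable_powi_mult simp: norm_mult\<close>)

lemma fourier_diff_bound:
  assumes "continuous_on circle f" "continuous_on circle g" "\<And>\<zeta>. \<zeta> \<in> circle \<Longrightarrow> cmod (f \<zeta> - g \<zeta>) \<le> B"
  shows "cmod (fourier f n - fourier g n) \<le> B"
  unfolding fourier_diff[OF circle_integrable_continuous[OF assms(1)] circle_integrable_continuous[OF assms(2)], symmetric]
  by (rule fourier_bound) (auto intro!: circle_integrable_continuous continuous_intros assms)

section \<open>Fejer means\<close>

text \<open>Written as a squared modulus of a geometric sum, so that positivity is immediate and the
  decay away from 1 follows from the closed form of that sum.\<close>

definition fejer_kernel :: "nat \<Rightarrow> complex \<Rightarrow> real" where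
  "fejer_kernel N u = (cmod (\<Sum>k<N. u ^ k))\<^sup>2 / real N"

text \<open>Each n with |n| < N arises from N - |n| pairs (j, k), so this is the Cesaro mean with
  weights 1 - |n|/N. The double sum matches the expansion of the kernel. For N = 0 the value is
  0.\<close>

definition fejer :: "nat \<Rightarrow> (complex \<Rightarrow> complex) \<Rightarrow> complex \<Rightarrow> complex" where
  "fejer N g z = (\<Sum>j<N. \<Sum>k<N. fourier g (int j - int k) * z powi (int j - int k)) / of_nat N"

lemma fejer_kernel_nonneg: "0 \<le> fejer_kernel N u"
  by (simp add: fejer_kernel_def)

lemma fejer_kernel_expand:
  assumes "cmod u = 1"
  shows "of_real (fejer_kernel N u) = (\<Sum>j<N. \<Sum>k<N. u powi (int j - int k)) / of_nat N"
proof -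
  have u: "u \<noteq> 0" using assms by auto
  have cu: "cnj u = inverse u"
    using assms by (simp add: complex_norm_square inverse_eq_divide nonzero_eq_divide_eq u mult.commute)
      (metis complex_norm_square assms of_real_1 power_one)
  have "of_real ((cmod (\<Sum>k<N. u ^ k))\<^sup>2) = (\<Sum>j<N. u ^ j) * (\<Sum>k<N. (inverse u) ^ k)"
    by (simp only: complex_norm_square cnj_sum complex_cnj_power cu)
  also have "\<dots> = (\<Sum>j<N. \<Sum>k<N. u ^ j * inverse u ^ k)"
    by (simp add: sum_product)
  also have "\<dots> = (\<Sum>j<N. \<Sum>k<N. u powi (int j - int k))"
    using u by (simp add: power_int_diff divide_inverse power_inverse)
  finally show ?thesis by (simp add: fejer_kernel_def)
qed

lemma fejer_kernel_le:
  assumes "cmod u = 1" "u \<noteq> 1"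
  shows "fejer_kernel N u \<le> 4 / (real N * (cmod (u - 1))\<^sup>2)"
proof -
  have "(\<Sum>k<N. u ^ k) = (u ^ N - 1) / (u - 1)"
    using assms(2) by (rule geometric_sum)
  moreover have "cmod (u ^ N - 1) \<le> 2"
    using norm_triangle_ineq4[of "u ^ N" 1] assms(1) by (simp add: norm_power)
  ultimately have "cmod (\<Sum>k<N. u ^ k) \<le> 2 / cmod (u - 1)"
    by (simp add: norm_divide divide_right_mono)
  then have "(cmod (\<Sum>k<N. u ^ k))\<^sup>2 \<le> (2 / cmod (u - 1))\<^sup>2"
    by (intro power_mono) auto
  then have "(cmod (\<Sum>k<N. u ^ k))\<^sup>2 / real N \<le> (2 / cmod (u - 1))\<^sup>2 / real N"
    by (intro divide_right_mono) auto
  then show ?thesis by (simp add: fejer_kernel_def power_divide mult.commute)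
qed

lemma continuous_fejer_kernel:
  "continuous_on circle (\<lambda>w. fejer_kernel N (z / w))"
  unfolding fejer_kernel_def by (cases "N = 0") (auto intro!: continuous_intros)

lemma fejer_eq_integral:
  assumes "integrable circle_measure g" "cmod z = 1"
  shows "fejer N g z = (LINT w|circle_measure. g w * of_real (fejer_kernel N (z / w)))"
proof -
  have "(LINT w|circle_measure. g w * of_real (fejer_kernel N (z / w)))
      = (LINT w|circle_measure. (\<Sum>j<N. \<Sum>k<N. (z powi (int j - int k) / of_nat N) * (w powi (- (int j - int k)) * g w)))"
  proof (rule circle_integral_cong)
    fix w :: complex assume "w \<in> circle"
    then have "cmod (z / w) = 1" using assms by (simp add: norm_divide)
    from fejer_kernel_expand[OF this] show "g w * of_real (fejer_kernel N (z / w))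
        = (\<Sum>j<N. \<Sum>k<N. (z powi (int j - int k) / of_nat N) * (w powi (- (int j - int k)) * g w))"
      by (simp only: power_int_divide_distrib power_int_minus sum_divide_distrib sum_distrib_left)
        (intro sum.cong refl, simp add: divide_inverse mult_ac)
  qed
  also have "\<dots> = (\<Sum>j<N. \<Sum>k<N. (z powi (int j - int k) / of_nat N) * fourier g (int j - int k))"
  proof -
    have "integrable circle_measure (\<lambda>w. (z powi (int j - int k) / of_nat N) * (w powi (- (int j - int k)) * g w))" for j k
      by (intro integrable_mult_right integrable_powi_mult assms)
    then show ?thesis
      unfolding fourier_def
      by (simp only: Bochner_Integration.integral_sum Bochner_Integration.integrable_sum integral_mult_right_zero)
  qed
  also have "\<dots> = fejer N g z"
    unfolding fejer_def sum_divide_distrib by (intro sum.cong refl) simp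
  finally show ?thesis ..
qed

lemma fejer_one:
  assumes "0 < N"
  shows "fejer N (\<lambda>_. 1) z = 1"
proof -
  have "fourier (\<lambda>_. 1) n = (if n = 0 then 1 else 0)" for n
    using fourier_powi[of 0 n] by simp
  then have "fejer N (\<lambda>_. 1) z = (\<Sum>j<N. \<Sum>k<N. if j = k then 1 else 0) / of_nat N"
    unfolding fejer_def by (intro arg_cong2[where f="(/)"] sum.cong refl) auto
  then show ?thesis using assms by simp
qed

lemma integral_fejer_kernel:
  assumes "0 < N" "cmod z = 1"
  shows "(LINT w|circle_measure. fejer_kernel N (z / w)) = 1"
proof -
  have "complex_of_real (LINT w|circle_measure. fejer_kernel N (z / w)) = fejer N (\<lambda>_. 1) z"
    by (subst fejer_eq_integral) (use assms in auto)
  then show ?thesis using fejer_one[OF assms(1)] by simp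
qed

text \<open>The kernel has total mass 1 and so has the circle, so a pointwise bound integrates to A
  + B. The term with A is meant for w near z, the constant B for w far from z.\<close>

lemma norm_fejer_diff_le:
  assumes g: "continuous_on circle g" and z: "cmod z = 1" and N: "0 < N"
    and b: "\<And>w. w \<in> circle \<Longrightarrow> cmod (g w - c) * fejer_kernel N (z / w) \<le> A * fejer_kernel N (z / w) + B"
  shows "cmod (fejer N g z - c) \<le> A + B"
proof -
  have i: "integrable circle_measure (\<lambda>w. fejer_kernel N (z / w))"
    by (intro circle_integrable_continuous continuous_fejer_kernel)
  have ic: "integrable circle_measure (\<lambda>w. (g w - c) * of_real (fejer_kernel N (z / w)))"
    by (intro circle_integrable_continuous continuous_intros g continuous_fejer_kernel)
  have "fejer N g z - c * fejer N (\<lambda>_. 1) z = (LINT w|circle_measure. (g w - c) * of_real (fejer_kernel N (z / w)))"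
  proof -
    have i2: "integrable circle_measure (\<lambda>w. g w * of_real (fejer_kernel N (z / w)))"
      and i3: "integrable circle_measure (\<lambda>w. c * complex_of_real (fejer_kernel N (z / w)))"
      by (intro circle_integrable_continuous continuous_intros g continuous_fejer_kernel)+
    show ?thesis
      by (simp only: fejer_eq_integral[OF circle_integrable_continuous[OF g] z]
        fejer_eq_integral[OF circle_integrable_continuous[OF continuous_on_const] z]
        left_diff_distrib Bochner_Integration.integral_diff[OF i2 i3] integral_mult_right_zero mult_1_left)
  qed
  then have "cmod (fejer N g z - c) = cmod (LINT w|circle_measure. (g w - c) * of_real (fejer_kernel N (z / w)))"
    using fejer_one[OF N] by simp
  also have "\<dots> \<le> (LINT w|circle_measure. cmod ((g w - c) * of_real (fejer_kernel N (z / w))))"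
    by (rule integral_norm_bound)
  also have "\<dots> \<le> (LINT w|circle_measure. A * fejer_kernel N (z / w) + B)"
    using b i ic by (intro integral_mono integrable_norm) (auto simp: norm_mult fejer_kernel_nonneg)
  also have "\<dots> = A + B"
    using i integral_fejer_kernel[OF N z] by (simp add: circle.prob_space)
  finally show ?thesis .
qed

lemma fejer_bound:
  assumes "continuous_on circle g" "\<And>w. w \<in> circle \<Longrightarrow> cmod (g w) \<le> B" "0 \<le> B" "cmod z = 1"
  shows "cmod (fejer N g z) \<le> B"
proof (cases "N = 0")
  case True then show ?thesis using assms by (simp add: fejer_def)
next
  case False
  then show ?thesis
    using norm_fejer_diff_le[OF assms(1,4), of N 0 B 0] assms(2) by (auto simp: mult_right_mono fejer_kernel_nonneg)
qed

lemma continuous_fejer: "continuous_on circle (fejer N g)"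
  unfolding fejer_def[abs_def] by (cases "N = 0") (auto intro!: continuous_intros)

lemma fejer_uniform:
  assumes g: "continuous_on circle g" and e: "0 < e"
  obtains N0 where "\<And>N z. N0 \<le> N \<Longrightarrow> z \<in> circle \<Longrightarrow> cmod (fejer N g z - g z) < e"
proof -
  obtain M where M: "0 \<le> M" "\<And>w. w \<in> circle \<Longrightarrow> cmod (g w) \<le> M"
    using continuous_on_circle_bounded[OF g] by blast
  have "uniformly_continuous_on circle g"
    by (rule compact_uniformly_continuous[OF g]) simp
  then obtain r where r: "0 < r" "\<And>w z. w \<in> circle \<Longrightarrow> z \<in> circle \<Longrightarrow> dist w z < r \<Longrightarrow> dist (g w) (g z) < e / 3"
    unfolding uniformly_continuous_on_def using e by (metis divide_pos_pos zero_less_numeral)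
  \<comment> \<open>Away from z the integrand is at most 2 M times the kernel bound 4 / (N r^2);
    this choice makes the product 8 M / (N r^2) at most e / 3.\<close>
  obtain N0 :: nat where N0: "24 * M / (e * r\<^sup>2) + 1 < real N0" using reals_Archimedean2 by blast
  show thesis
  proof (rule that)
    fix N :: nat and z assume N: "N0 \<le> N" and z: "z \<in> circle"
    have Nr: "24 * M / (e * r\<^sup>2) + 1 < real N" using N N0 by (meson less_le_trans of_nat_le_iff)
    have "0 \<le> 24 * M / (e * r\<^sup>2)" using M e r by simp
    then have Np: "0 < real N" using Nr by linarith
    have small: "8 * M / (real N * r\<^sup>2) \<le> e / 3"
    proof -
      have "0 < e * r\<^sup>2" using e r(1) by simp
      moreover have "24 * M / (e * r\<^sup>2) < real N" using Nr by linarith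
      ultimately have "24 * M < real N * (e * r\<^sup>2)" by (simp add: pos_divide_less_eq)
      then show ?thesis using Np r(1) by (simp add: field_simps)
    qed
    have "cmod (fejer N g z - g z) \<le> e / 3 + 8 * M / (real N * r\<^sup>2)"
    proof (rule norm_fejer_diff_le[OF g])
      fix w :: complex assume w: "w \<in> circle"
      show "cmod (g w - g z) * fejer_kernel N (z / w) \<le> e / 3 * fejer_kernel N (z / w) + 8 * M / (real N * r\<^sup>2)"
      proof (cases "dist w z < r")
        case True
        then have "cmod (g w - g z) \<le> e / 3" using r(2)[OF w z] by (simp add: dist_norm)
        then have "cmod (g w - g z) * fejer_kernel N (z / w) \<le> e / 3 * fejer_kernel N (z / w)"
          by (intro mult_right_mono fejer_kernel_nonneg)
        then show ?thesis using M(1) by (smt (verit) divide_nonneg_nonneg mult_nonneg_nonneg of_nat_0_le_iff zero_le_power2)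
      next
        case False
        have w0: "w \<noteq> 0" using w by auto
        have "z / w - 1 = (z - w) / w" using w0 by (simp add: field_simps)
        then have d: "cmod (z / w - 1) = dist w z" using w by (simp add: norm_divide dist_norm norm_minus_commute)
        have ne: "z / w \<noteq> 1" using d False r(1) by force
        have "fejer_kernel N (z / w) \<le> 4 / (real N * (cmod (z / w - 1))\<^sup>2)"
          by (rule fejer_kernel_le) (use w z ne in \<open>auto simp: norm_divide\<close>)
        also have "\<dots> \<le> 4 / (real N * r\<^sup>2)"
          unfolding d using False r(1) Np
          by (intro divide_left_mono mult_left_mono power_mono mult_pos_pos) auto
        finally have k: "fejer_kernel N (z / w) \<le> 4 / (real N * r\<^sup>2)" .
        have "cmod (g w - g z) \<le> 2 * M"
          using norm_triangle_ineq4[of "g w" "g z"] M(2)[OF w] M(2)[OF z] by linarith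
        then have "cmod (g w - g z) * fejer_kernel N (z / w) \<le> 2 * M * (4 / (real N * r\<^sup>2))"
          using k M(1) by (intro mult_mono) (auto simp: fejer_kernel_nonneg)
        also have "\<dots> = 8 * M / (real N * r\<^sup>2)" by simp
        also have "\<dots> \<le> e / 3 * fejer_kernel N (z / w) + 8 * M / (real N * r\<^sup>2)"
          using e fejer_kernel_nonneg[of N "z / w"] by simp
        finally show ?thesis .
      qed
    qed (use z Np in auto)
    also have "\<dots> < e" using small e by linarith
    finally show "cmod (fejer N g z - g z) < e" .
  qed
qed

text \<open>The multiplier at n is the number of pairs with difference n, divided by N. As it lies
  in [0, 1], Fejer means contract every norm that is monotone in the moduli of the
  coefficients.\<close>

lemma fejer_fourier:
  obtains c where "0 \<le> c" "c \<le> 1" "fourier (fejer N g) n = of_real c * fourier g n"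
proof -
  define c :: real where "c = (\<Sum>j<N. \<Sum>k<N. if n = int j - int k then 1 else 0) / real N"
  have row: "(\<Sum>k<N. if n = int j - int k then 1 else 0 :: real) \<le> 1" for j
  proof -
    have "(\<Sum>k<N. if n = int j - int k then 1 else 0 :: real) = (\<Sum>k<N. if int k = int j - n then 1 else 0)"
      by (intro sum.cong) auto
    also have "\<dots> \<le> (\<Sum>k<N. if k = nat (int j - n) then 1 else 0)"
      by (intro sum_mono) auto
    also have "\<dots> \<le> 1" by simp
    finally show ?thesis .
  qed
  have "(\<Sum>j<N. \<Sum>k<N. if n = int j - int k then 1 else 0 :: real) \<le> (\<Sum>j<N. 1)"
    by (intro sum_mono row)
  then have c1: "c \<le> 1" unfolding c_def by (auto simp: divide_le_eq_1)
  have c0: "0 \<le> c" unfolding c_def by (intro divide_nonneg_nonneg sum_nonneg) auto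
  have "fejer N g = (\<lambda>z. \<Sum>j<N. \<Sum>k<N. (fourier g (int j - int k) / of_nat N) * z powi (int j - int k))"
    by (auto simp: fejer_def sum_divide_distrib)
  have "fourier (fejer N g) n = (\<Sum>j<N. \<Sum>k<N. (fourier g (int j - int k) / of_nat N) * fourier (\<lambda>z. z powi (int j - int k)) n)"
  proof -
    have "integrable circle_measure (\<lambda>z. (fourier g (int j - int k) / of_nat N) * z powi (int j - int k))" for j k
      by (intro circle_integrable_continuous continuous_intros)
    then show ?thesis
      unfolding \<open>fejer N g = _\<close>
      by (simp only: fourier_sum Bochner_Integration.integrable_sum fourier_cmult)
  qed
  also have "\<dots> = (\<Sum>j<N. \<Sum>k<N. (fourier g n / of_nat N) * of_real (if n = int j - int k then 1 else 0))"
    unfolding fourier_powi by (intro sum.cong) auto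
  also have "\<dots> = of_real c * fourier g n"
    unfolding c_def of_real_divide of_real_sum sum_divide_distrib sum_distrib_right
    by (intro sum.cong refl) simp
  finally show thesis using that c0 c1 by blast
qed

section \<open>Bessel, Parseval and rotations\<close>

lemma cnj_powi_circle: "cmod \<zeta> = 1 \<Longrightarrow> cnj (\<zeta> powi n) = \<zeta> powi (- n)"
proof -
  assume a: "cmod \<zeta> = 1"
  then have "\<zeta> * cnj \<zeta> = 1" by (metis complex_norm_square of_real_1 power_one)
  then have "cnj \<zeta> = inverse \<zeta>" by (metis inverse_unique)
  then show ?thesis by (simp add: power_int_minus power_int_inverse)
qed

lemma integral_times_cnj_trig:
  assumes "integrable circle_measure f"
  shows "(LINT \<zeta>|circle_measure. f \<zeta> * cnj (\<Sum>i\<in>I. c i * \<zeta> powi m i)) = (\<Sum>i\<in>I. cnj (c i) * fourier f (m i))"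
proof -
  have i: "integrable circle_measure (\<lambda>\<zeta>. cnj (c i) * (\<zeta> powi (- m i) * f \<zeta>))" for i
    by (intro integrable_mult_right integrable_powi_mult assms)
  have "(LINT \<zeta>|circle_measure. f \<zeta> * cnj (\<Sum>i\<in>I. c i * \<zeta> powi m i))
      = (LINT \<zeta>|circle_measure. (\<Sum>i\<in>I. cnj (c i) * (\<zeta> powi (- m i) * f \<zeta>)))"
    by (rule circle_integral_cong)
      (simp add: cnj_powi_circle sum_distrib_left mult_ac del: complex_cnj_power_int)
  also have "\<dots> = (\<Sum>i\<in>I. cnj (c i) * fourier f (m i))"
    unfolding fourier_def by (simp only: Bochner_Integration.integral_sum i integral_mult_right_zero)
  finally show ?thesis .
qed

lemma fourier_trig_poly:
  assumes "finite F"
  shows "fourier (\<lambda>\<zeta>. \<Sum>n\<in>F. c n * \<zeta> powi n) k = (if k \<in> F then c k else 0)"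
proof -
  have "integrable circle_measure (\<lambda>\<zeta>. c n * \<zeta> powi n)" for n
    by (intro circle_integrable_continuous continuous_intros)
  then have "fourier (\<lambda>\<zeta>. \<Sum>n\<in>F. c n * \<zeta> powi n) k = (\<Sum>n\<in>F. if n = k then c n else 0)"
    by (simp only: fourier_sum fourier_cmult fourier_powi) (intro sum.cong, auto)
  then show ?thesis using assms by simp
qed

lemma bessel:
  assumes f: "continuous_on circle f"
  shows "fourier f \<in> l2" "nsq (fourier f) \<le> (LINT \<zeta>|circle_measure. (cmod (f \<zeta>))\<^sup>2)"
proof -
  have *: "(\<Sum>n\<in>F. (cmod (fourier f n))\<^sup>2) \<le> (LINT \<zeta>|circle_measure. (cmod (f \<zeta>))\<^sup>2)" if F: "finite F" for F
  proof -
    define p where "p \<zeta> = (\<Sum>n\<in>F. fourier f n * \<zeta> powi n)" for \<zeta>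
    define S where "S = (\<Sum>n\<in>F. (cmod (fourier f n))\<^sup>2)"
    have pc: "continuous_on circle p" unfolding p_def by (intro continuous_intros)
    have fp: "(LINT \<zeta>|circle_measure. f \<zeta> * cnj (p \<zeta>)) = of_real S"
      unfolding p_def S_def integral_times_cnj_trig[OF circle_integrable_continuous[OF f]]
      unfolding of_real_sum complex_norm_square by (simp add: mult.commute)
    have pp: "(LINT \<zeta>|circle_measure. p \<zeta> * cnj (p \<zeta>)) = of_real S"
    proof -
      have "(LINT \<zeta>|circle_measure. p \<zeta> * cnj (\<Sum>n\<in>F. fourier f n * \<zeta> powi n)) = (\<Sum>n\<in>F. cnj (fourier f n) * fourier p n)"
        by (rule integral_times_cnj_trig[OF circle_integrable_continuous[OF pc]])
      also have "\<dots> = (\<Sum>n\<in>F. cnj (fourier f n) * fourier f n)"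
        unfolding p_def by (intro sum.cong refl) (simp add: fourier_trig_poly[OF F])
      finally show ?thesis
        unfolding S_def of_real_sum complex_norm_square p_def[symmetric] by (simp add: mult.commute)
    qed
    have e: "of_real ((cmod (f \<zeta> - p \<zeta>))\<^sup>2)
        = of_real ((cmod (f \<zeta>))\<^sup>2) - f \<zeta> * cnj (p \<zeta>) - cnj (f \<zeta> * cnj (p \<zeta>)) + p \<zeta> * cnj (p \<zeta>)" for \<zeta>
      unfolding complex_norm_square by (simp add: algebra_simps)
    have ii: "integrable circle_measure (\<lambda>\<zeta>. complex_of_real ((cmod (f \<zeta>))\<^sup>2))"
      "integrable circle_measure (\<lambda>\<zeta>. f \<zeta> * cnj (p \<zeta>))"
      "integrable circle_measure (\<lambda>\<zeta>. cnj (f \<zeta> * cnj (p \<zeta>)))"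
      "integrable circle_measure (\<lambda>\<zeta>. p \<zeta> * cnj (p \<zeta>))"
      by (intro circle_integrable_continuous continuous_intros f pc)+
    have cj: "(LINT \<zeta>|circle_measure. cnj (f \<zeta> * cnj (p \<zeta>))) = cnj (of_real S)"
      unfolding fp[symmetric] by (rule integral_bounded_linear[OF bounded_linear_cnj ii(2)])
    have "complex_of_real (LINT \<zeta>|circle_measure. (cmod (f \<zeta> - p \<zeta>))\<^sup>2)
       = (LINT \<zeta>|circle_measure. of_real ((cmod (f \<zeta>))\<^sup>2) - f \<zeta> * cnj (p \<zeta>) - cnj (f \<zeta> * cnj (p \<zeta>)) + p \<zeta> * cnj (p \<zeta>))"
      by (simp only: integral_complex_of_real[symmetric] e)
    also have "\<dots> = of_real (LINT \<zeta>|circle_measure. (cmod (f \<zeta>))\<^sup>2) - of_real S - cnj (of_real S) + of_real S"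
      by (simp only: Bochner_Integration.integral_add Bochner_Integration.integral_diff ii
          Bochner_Integration.integrable_diff cj fp pp integral_complex_of_real)
    also have "\<dots> = of_real ((LINT \<zeta>|circle_measure. (cmod (f \<zeta>))\<^sup>2) - S)" by simp
    finally have "(LINT \<zeta>|circle_measure. (cmod (f \<zeta> - p \<zeta>))\<^sup>2) = (LINT \<zeta>|circle_measure. (cmod (f \<zeta>))\<^sup>2) - S"
      by (simp only: of_real_eq_iff)
    moreover have "0 \<le> (LINT \<zeta>|circle_measure. (cmod (f \<zeta> - p \<zeta>))\<^sup>2)"
      by (rule Bochner_Integration.integral_nonneg) simp
    ultimately show ?thesis unfolding S_def by linarith
  qed
  show "fourier f \<in> l2" "nsq (fourier f) \<le> (LINT \<zeta>|circle_measure. (cmod (f \<zeta>))\<^sup>2)"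
    using l2_bound[of "fourier f", OF *] by auto
qed

text \<open>Pairing f with its Fejer mean gives an average over j of finite sums of squared
  coefficients, since the frequencies j - k are distinct for fixed j; such an average is at most
  \<open>nsq\<close>. Uniform convergence replaces the mean by f itself.\<close>

lemma parseval_le:
  assumes f: "continuous_on circle f"
  shows "(LINT \<zeta>|circle_measure. (cmod (f \<zeta>))\<^sup>2) \<le> nsq (fourier f)"
proof (rule field_le_epsilon)
  fix e :: real assume e: "0 < e"
  obtain M where M: "0 \<le> M" "\<And>w. w \<in> circle \<Longrightarrow> cmod (f w) \<le> M"
    using continuous_on_circle_bounded[OF f] by blast
  have "0 < e / (M + 1)" using e M by (intro divide_pos_pos) auto
  then obtain N0 where N0: "\<And>N z. N0 \<le> N \<Longrightarrow> z \<in> circle \<Longrightarrow> cmod (fejer N f z - f z) < e / (M + 1)"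
    by (rule fejer_uniform[OF f]) (rule that)
  define N where "N = Suc N0"
  define p where "p = fejer N f"
  have pc: "continuous_on circle p" unfolding p_def by (rule continuous_fejer)
  have pe: "p = (\<lambda>z. \<Sum>i\<in>{..<N} \<times> {..<N}. (fourier f (int (fst i) - int (snd i)) / of_nat N) * z powi (int (fst i) - int (snd i)))"
    by (auto simp: p_def fejer_def sum_divide_distrib sum.cartesian_product case_prod_beta)
  have row: "(\<Sum>k<N. (cmod (fourier f (int j - int k)))\<^sup>2) \<le> nsq (fourier f)" for j
  proof -
    have "(\<Sum>k<N. (cmod (fourier f (int j - int k)))\<^sup>2)
        = (\<Sum>n\<in>(\<lambda>k. int j - int k) ` {..<N}. (cmod (fourier f n))\<^sup>2)"
      by (subst sum.reindex) (auto simp: inj_on_def)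
    also have "\<dots> \<le> nsq (fourier f)" by (intro sum_le_nsq bessel f) auto
    finally show ?thesis .
  qed
  have "(LINT \<zeta>|circle_measure. f \<zeta> * cnj (p \<zeta>))
      = (\<Sum>i\<in>{..<N} \<times> {..<N}. cnj (fourier f (int (fst i) - int (snd i)) / of_nat N) * fourier f (int (fst i) - int (snd i)))"
    unfolding pe by (rule integral_times_cnj_trig[OF circle_integrable_continuous[OF f]])
  also have "\<dots> = of_real ((\<Sum>j<N. \<Sum>k<N. (cmod (fourier f (int j - int k)))\<^sup>2) / real N)"
    unfolding of_real_divide of_real_sum sum_divide_distrib sum.cartesian_product case_prod_beta
    unfolding complex_norm_square by (intro sum.cong refl) simp
  finally have fp: "(LINT \<zeta>|circle_measure. f \<zeta> * cnj (p \<zeta>))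
    = of_real ((\<Sum>j<N. \<Sum>k<N. (cmod (fourier f (int j - int k)))\<^sup>2) / real N)" .
  have "(\<Sum>j<N. \<Sum>k<N. (cmod (fourier f (int j - int k)))\<^sup>2) \<le> (\<Sum>j<N. nsq (fourier f))"
    by (intro sum_mono row)
  then have "(\<Sum>j<N. \<Sum>k<N. (cmod (fourier f (int j - int k)))\<^sup>2) / real N \<le> nsq (fourier f)"
    by (simp add: N_def divide_le_eq mult.commute)
  then have le: "Re (LINT \<zeta>|circle_measure. f \<zeta> * cnj (p \<zeta>)) \<le> nsq (fourier f)"
    unfolding fp by (simp only: Re_complex_of_real)
  have i: "integrable circle_measure (\<lambda>\<zeta>. f \<zeta> * cnj (f \<zeta>))" "integrable circle_measure (\<lambda>\<zeta>. f \<zeta> * cnj (p \<zeta>))"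
    by (intro circle_integrable_continuous continuous_intros f pc)+
  have "complex_of_real (LINT \<zeta>|circle_measure. (cmod (f \<zeta>))\<^sup>2) - (LINT \<zeta>|circle_measure. f \<zeta> * cnj (p \<zeta>))
     = (LINT \<zeta>|circle_measure. f \<zeta> * cnj (f \<zeta> - p \<zeta>))"
    by (simp only: integral_complex_of_real[symmetric] complex_norm_square complex_cnj_diff right_diff_distrib
        Bochner_Integration.integral_diff i)
  moreover have "cmod (LINT \<zeta>|circle_measure. f \<zeta> * cnj (f \<zeta> - p \<zeta>)) \<le> M * (e / (M + 1))"
  proof (rule circle_integral_bound)
    show "integrable circle_measure (\<lambda>\<zeta>. f \<zeta> * cnj (f \<zeta> - p \<zeta>))"
      by (intro circle_integrable_continuous continuous_intros f pc)
    fix \<zeta> :: complex assume z: "\<zeta> \<in> circle"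
    have "cmod (cnj (f \<zeta> - p \<zeta>)) \<le> e / (M + 1)"
      unfolding complex_mod_cnj using N0[OF _ z, of N] by (simp add: p_def N_def norm_minus_commute)
    then show "cmod (f \<zeta> * cnj (f \<zeta> - p \<zeta>)) \<le> M * (e / (M + 1))"
      unfolding norm_mult using M z by (intro mult_mono) auto
  qed
  moreover have "M * (e / (M + 1)) \<le> e" using M e by (simp add: field_simps)
  ultimately have "cmod (complex_of_real (LINT \<zeta>|circle_measure. (cmod (f \<zeta>))\<^sup>2) - (LINT \<zeta>|circle_measure. f \<zeta> * cnj (p \<zeta>))) \<le> e"
    by simp
  then have "Re (complex_of_real (LINT \<zeta>|circle_measure. (cmod (f \<zeta>))\<^sup>2) - (LINT \<zeta>|circle_measure. f \<zeta> * cnj (p \<zeta>))) \<le> e"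
    by (rule order_trans[OF complex_Re_le_cmod])
  then show "(LINT \<zeta>|circle_measure. (cmod (f \<zeta>))\<^sup>2) \<le> nsq (fourier f) + e" using le by simp
qed

section \<open>Rotations and increments\<close>

lemma continuous_rotate:
  assumes "continuous_on circle f" "cmod u = 1"
  shows "continuous_on circle (\<lambda>\<zeta>. f (u * \<zeta>))"
  by (rule continuous_on_compose2[OF assms(1)]) (auto intro!: continuous_intros simp: norm_mult assms(2))

text \<open>The rotation invariance of arc length, read off from coefficients: the identity is exact
  for trigonometric polynomials, and both sides are stable under the uniform approximation by Fejer
  means.\<close>

lemma fourier_rotate:
  assumes f: "continuous_on circle f" and u: "cmod u = 1"
  shows "fourier (\<lambda>\<zeta>. f (u * \<zeta>)) n = u powi n * fourier f n"
proof -
  have "cmod (fourier (\<lambda>\<zeta>. f (u * \<zeta>)) n - u powi n * fourier f n) \<le> 0 + e" if e: "0 < e" for e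
  proof -
    obtain N where "\<And>M z. N \<le> M \<Longrightarrow> z \<in> circle \<Longrightarrow> cmod (fejer M f z - f z) < e / 2"
      by (rule fejer_uniform[OF f half_gt_zero[OF e]]) (rule that)
    note N = this[OF order_refl]
    define p where "p = fejer N f"
    have pc: "continuous_on circle p" unfolding p_def by (rule continuous_fejer)
    have pe: "p z = (\<Sum>i\<in>{..<N} \<times> {..<N}. (fourier f (int (fst i) - int (snd i)) / of_nat N) * z powi (int (fst i) - int (snd i)))" for z
      by (auto simp: p_def fejer_def sum_divide_distrib sum.cartesian_product case_prod_beta)
    have i: "integrable circle_measure (\<lambda>\<zeta>. c * \<zeta> powi k)" for c k
      by (intro circle_integrable_continuous continuous_intros)
    have "fourier (\<lambda>\<zeta>. p (u * \<zeta>)) n = (\<Sum>i\<in>{..<N} \<times> {..<N}. (fourier f (int (fst i) - int (snd i)) / of_nat N * u powi (int (fst i) - int (snd i))) * (if n = int (fst i) - int (snd i) then 1 else 0))"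
      unfolding pe power_int_mult_distrib mult.assoc[symmetric]
      by (simp only: fourier_sum i fourier_cmult fourier_powi)
    also have "\<dots> = (\<Sum>i\<in>{..<N} \<times> {..<N}. u powi n * (fourier f (int (fst i) - int (snd i)) / of_nat N * (if n = int (fst i) - int (snd i) then 1 else 0)))"
      by (intro sum.cong refl) auto
    also have "\<dots> = u powi n * fourier p n"
      unfolding pe[abs_def] sum_distrib_left[symmetric]
      by (simp only: fourier_sum i fourier_cmult fourier_powi)
    finally have 1: "fourier (\<lambda>\<zeta>. p (u * \<zeta>)) n = u powi n * fourier p n" .
    have 2: "cmod (fourier (\<lambda>\<zeta>. f (u * \<zeta>)) n - fourier (\<lambda>\<zeta>. p (u * \<zeta>)) n) \<le> e / 2"
    proof (rule fourier_diff_bound)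
      fix \<zeta> :: complex assume "\<zeta> \<in> circle"
      then have "u * \<zeta> \<in> circle" using u by (simp add: norm_mult)
      from N[OF this] show "cmod (f (u * \<zeta>) - p (u * \<zeta>)) \<le> e / 2"
        by (simp add: p_def norm_minus_commute)
    qed (intro continuous_rotate f pc u)+
    have 3: "cmod (fourier p n - fourier f n) \<le> e / 2"
      by (rule fourier_diff_bound[OF pc f]) (use N in \<open>auto simp: p_def intro: less_imp_le\<close>)
    have "fourier (\<lambda>\<zeta>. f (u * \<zeta>)) n - u powi n * fourier f n
        = (fourier (\<lambda>\<zeta>. f (u * \<zeta>)) n - fourier (\<lambda>\<zeta>. p (u * \<zeta>)) n) + u powi n * (fourier p n - fourier f n)"
      using 1 by (simp add: algebra_simps)
    also have "cmod \<dots> \<le> cmod (fourier (\<lambda>\<zeta>. f (u * \<zeta>)) n - fourier (\<lambda>\<zeta>. p (u * \<zeta>)) n) + cmod (u powi n * (fourier p n - fourier f n))"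
      by (rule norm_triangle_ineq)
    also have "\<dots> \<le> e / 2 + e / 2"
      using 2 3 u by (intro add_mono) (auto simp: norm_mult)
    finally show ?thesis by simp
  qed
  then have "cmod (fourier (\<lambda>\<zeta>. f (u * \<zeta>)) n - u powi n * fourier f n) \<le> 0" by (rule field_le_epsilon)
  then show ?thesis by simp
qed

lemma fourier_rotate_diff:
  assumes f: "continuous_on circle f"
  shows "fourier (\<lambda>\<zeta>. f (cis s * \<zeta>) - f \<zeta>) n = (cis (of_int n * s) - 1) * fourier f n"
  using fourier_rotate[OF f, of "cis s" n]
  by (subst fourier_diff) (auto intro!: circle_integrable_continuous continuous_rotate f
      simp: cis_power_int left_diff_distrib)

lemma norm_cis_minus_one_sq: "(cmod (cis x - 1))\<^sup>2 = 2 - 2 * cos x"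
proof -
  have "(cmod (cis x - 1))\<^sup>2 = (cos x - 1)\<^sup>2 + (sin x)\<^sup>2" by (simp add: cmod_power2)
  also have "\<dots> = (sin x)\<^sup>2 + (cos x)\<^sup>2 + 1 - 2 * cos x" by (simp add: power2_eq_square algebra_simps)
  finally show ?thesis by (simp only: sin_cos_squared_add)
qed

lemma norm_cis_minus_one_le: "(cmod (cis x - 1))\<^sup>2 \<le> min 4 (x\<^sup>2)"
proof -
  have "cos x = 1 - 2 * (sin (x / 2))\<^sup>2" using cos_double_sin[of "x / 2"] by simp
  moreover have "(sin (x / 2))\<^sup>2 \<le> (x / 2)\<^sup>2"
    unfolding abs_le_square_iff[symmetric] by (rule abs_sin_x_le_abs_x)
  ultimately have "2 - 2 * cos x \<le> x\<^sup>2" by (simp add: power_divide)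
  moreover have "2 - 2 * cos x \<le> 4" using cos_ge_minus_one[of x] by linarith
  ultimately show ?thesis by (simp add: norm_cis_minus_one_sq)
qed

text \<open>Averaging \<open>2 - 2 cos (n s)\<close> over \<open>0 \<le> s \<le> t\<close> gives at least \<open>1\<close> once \<open>\<bar>n\<bar> t \<ge> 2\<close>.\<close>

lemma fourier_tail_bound:
  assumes f: "continuous_on circle f" and t: "0 < t"
    and B: "\<And>s. 0 \<le> s \<Longrightarrow> s \<le> t \<Longrightarrow> (LINT \<zeta>|circle_measure. (cmod (f (cis s * \<zeta>) - f \<zeta>))\<^sup>2) \<le> B"
    and F: "finite F" "\<And>n. n \<in> F \<Longrightarrow> 2 \<le> \<bar>of_int n\<bar> * t"
  shows "(\<Sum>n\<in>F. (cmod (fourier f n))\<^sup>2) \<le> B"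
proof -
  define a where "a n = (cmod (fourier f n))\<^sup>2" for n
  have le: "(\<Sum>n\<in>F. a n * (2 - 2 * cos (of_int n * s))) \<le> B" if s: "0 \<le> s" "s \<le> t" for s
  proof -
    have c: "continuous_on circle (\<lambda>\<zeta>. f (cis s * \<zeta>) - f \<zeta>)"
      by (intro continuous_intros continuous_rotate f) simp
    have "(\<Sum>n\<in>F. a n * (2 - 2 * cos (of_int n * s))) = (\<Sum>n\<in>F. (cmod (fourier (\<lambda>\<zeta>. f (cis s * \<zeta>) - f \<zeta>) n))\<^sup>2)"
      unfolding fourier_rotate_diff[OF f] norm_mult power_mult_distrib norm_cis_minus_one_sq a_def
      by (simp add: mult.commute)
    also have "\<dots> \<le> nsq (fourier (\<lambda>\<zeta>. f (cis s * \<zeta>) - f \<zeta>))"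
      by (rule sum_le_nsq[OF bessel(1)[OF c] F(1)])
    also have "\<dots> \<le> B" using bessel(2)[OF c] B[OF s] by linarith
    finally show ?thesis .
  qed
  have n0: "n \<noteq> 0" if "n \<in> F" for n using F(2)[OF that] by auto
  have int: "((\<lambda>s. 2 - 2 * cos (of_int n * s)) has_integral (2 * t - 2 * sin (of_int n * t) / of_int n)) {0..t}" if "n \<in> F" for n
  proof -
    have "((\<lambda>s. 2 * s - 2 * sin (of_int n * s) / of_int n) has_vector_derivative 2 - 2 * cos (of_int n * s)) (at s within {0..t})" for s
      unfolding has_real_derivative_iff_has_vector_derivative[symmetric]
      using n0[OF that] by (auto intro!: derivative_eq_intros)
    from fundamental_theorem_of_calculus[OF less_imp_le[OF t] this] show ?thesis by simp
  qed
  have "((\<lambda>s. \<Sum>n\<in>F. a n * (2 - 2 * cos (of_int n * s))) has_integral (\<Sum>n\<in>F. a n * (2 * t - 2 * sin (of_int n * t) / of_int n))) {0..t}"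
    by (intro has_integral_sum F(1) has_integral_mult_right int)
  moreover have "((\<lambda>s. B) has_integral t * B) {0..t}"
    using has_integral_const_real[of B 0 t] t by simp
  ultimately have "(\<Sum>n\<in>F. a n * (2 * t - 2 * sin (of_int n * t) / of_int n)) \<le> t * B"
    by (rule has_integral_le) (use le in auto)
  moreover have "t * (\<Sum>n\<in>F. a n) \<le> (\<Sum>n\<in>F. a n * (2 * t - 2 * sin (of_int n * t) / of_int n))"
    unfolding sum_distrib_left
  proof (rule sum_mono)
    fix n assume n: "n \<in> F"
    have "sin (of_int n * t) / of_int n \<le> \<bar>sin (of_int n * t)\<bar> / \<bar>of_int n\<bar>"
      by (metis abs_divide abs_ge_self)
    also have "\<dots> \<le> 1 / \<bar>of_int n\<bar>" by (intro divide_right_mono) auto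
    also have "\<dots> \<le> t / 2" using F(2)[OF n] n0[OF n] by (simp add: field_simps)
    finally have "t \<le> 2 * t - 2 * sin (of_int n * t) / of_int n" by (simp add: mult.commute)
    then have "a n * t \<le> a n * (2 * t - 2 * sin (of_int n * t) / of_int n)"
      by (rule mult_left_mono) (simp add: a_def)
    then show "t * a n \<le> a n * (2 * t - 2 * sin (of_int n * t) / of_int n)" by (simp only: mult.commute)
  qed
  ultimately have "t * (\<Sum>n\<in>F. a n) \<le> t * B" by linarith
  then show ?thesis using t by (simp add: a_def)
qed

text \<open>Parseval for the increment: rotation by s multiplies the coefficient by cis(n s) - 1,
  whose squared modulus is at most 4 and at most n^2 s^2. The cap at 4 is what makes the series
  converge for every continuous function.\<close>

lemma integral_rotate_diff_le:
  assumes h: "continuous_on circle h" and s: "0 \<le> s" "s \<le> 1 / 2 ^ j"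
  shows "(LINT \<zeta>|circle_measure. (cmod (h (cis s * \<zeta>) - h \<zeta>))\<^sup>2)
    \<le> (\<Sum>\<^sub>\<infinity>n. (cmod (fourier h n))\<^sup>2 * min 4 ((of_int n)\<^sup>2 / 4 ^ j))"
    and "(\<lambda>n. (cmod (fourier h n))\<^sup>2 * min 4 ((of_int n)\<^sup>2 / 4 ^ j)) summable_on UNIV"
proof -
  have sm: "(\<lambda>n. (cmod (fourier h n))\<^sup>2 * 4) summable_on UNIV"
    using bessel(1)[OF h] by (intro summable_on_cmult_left) (simp add: l2_def)
  show sm': "(\<lambda>n. (cmod (fourier h n))\<^sup>2 * min 4 ((of_int n)\<^sup>2 / 4 ^ j)) summable_on UNIV"
    by (rule summable_on_comparison_test[OF sm]) (auto intro!: mult_left_mono)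
  have c: "continuous_on circle (\<lambda>\<zeta>. h (cis s * \<zeta>) - h \<zeta>)"
    by (intro continuous_intros continuous_rotate h) simp
  have "(LINT \<zeta>|circle_measure. (cmod (h (cis s * \<zeta>) - h \<zeta>))\<^sup>2) \<le> nsq (fourier (\<lambda>\<zeta>. h (cis s * \<zeta>) - h \<zeta>))"
    by (rule parseval_le[OF c])
  also have "\<dots> \<le> (\<Sum>\<^sub>\<infinity>n. (cmod (fourier h n))\<^sup>2 * min 4 ((of_int n)\<^sup>2 / 4 ^ j))"
    unfolding nsq_def
  proof (rule infsum_mono[OF _ sm'])
    show "(\<lambda>n. (cmod (fourier (\<lambda>\<zeta>. h (cis s * \<zeta>) - h \<zeta>) n))\<^sup>2) summable_on UNIV"
      using bessel(1)[OF c] by (simp add: l2_def)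
    fix n :: int
    have "s\<^sup>2 \<le> (1 / 2 ^ j)\<^sup>2" using s by (intro power_mono) auto
    also have "(1 / 2 ^ j)\<^sup>2 = (1 / 4 ^ j :: real)" by (simp add: power2_eq_square power_mult_distrib[symmetric])
    finally have "(of_int n)\<^sup>2 * s\<^sup>2 \<le> (of_int n)\<^sup>2 * (1 / 4 ^ j)" by (rule mult_left_mono) simp
    then have "(cmod (cis (of_int n * s) - 1))\<^sup>2 \<le> min 4 ((of_int n)\<^sup>2 / 4 ^ j)"
      using norm_cis_minus_one_le[of "of_int n * s"] by (simp add: power_mult_distrib)
    then show "(cmod (fourier (\<lambda>\<zeta>. h (cis s * \<zeta>) - h \<zeta>) n))\<^sup>2 \<le> (cmod (fourier h n))\<^sup>2 * min 4 ((of_int n)\<^sup>2 / 4 ^ j)"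
      unfolding fourier_rotate_diff[OF h] norm_mult power_mult_distrib
      by (subst mult.commute) (rule mult_left_mono, auto)
  qed
  finally show "(LINT \<zeta>|circle_measure. (cmod (h (cis s * \<zeta>) - h \<zeta>))\<^sup>2)
    \<le> (\<Sum>\<^sub>\<infinity>n. (cmod (fourier h n))\<^sup>2 * min 4 ((of_int n)\<^sup>2 / 4 ^ j))" .
qed

section \<open>Domination of norms by increments\<close>

text \<open>The root of the weight is absorbed into the coefficients, so the norm of the weighted
  space becomes the plain norm of \<open>l2\<close> and the abstract results on \<open>l2\<close>
  apply.\<close>

definition wcoeff :: "(nat \<Rightarrow> real) \<Rightarrow> (complex \<Rightarrow> complex) \<Rightarrow> int \<Rightarrow> complex" where
  "wcoeff \<Omega> f n = of_real (sqrt (\<Omega> (nat \<bar>n\<bar>))) * fourier f n"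

lemma sum_lessThan_add:
  fixes g :: "nat \<Rightarrow> real"
  shows "(\<Sum>j<a + b. g j) = (\<Sum>j<a. g j) + (\<Sum>i<b. g (a + i))"
  by (induction b) (auto simp: add.assoc)

lemma
  fixes f :: "'i \<Rightarrow> 'a \<Rightarrow> 'b::{topological_comm_monoid_add, t2_space}"
  assumes "finite I" "\<And>i. i \<in> I \<Longrightarrow> f i summable_on A"
  shows summable_on_finite_sum: "(\<lambda>x. \<Sum>i\<in>I. f i x) summable_on A"
    and infsum_finite_sum: "(\<Sum>\<^sub>\<infinity>x\<in>A. \<Sum>i\<in>I. f i x) = (\<Sum>i\<in>I. infsum (f i) A)"
proof -
  have "(\<lambda>x. \<Sum>i\<in>I. f i x) summable_on A \<and> (\<Sum>\<^sub>\<infinity>x\<in>A. \<Sum>i\<in>I. f i x) = (\<Sum>i\<in>I. infsum (f i) A)"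
    using assms by (induction I rule: finite_induct) (auto intro: summable_on_add simp: infsum_add)
  then show "(\<lambda>x. \<Sum>i\<in>I. f i x) summable_on A" "(\<Sum>\<^sub>\<infinity>x\<in>A. \<Sum>i\<in>I. f i x) = (\<Sum>i\<in>I. infsum (f i) A)"
    by auto
qed

text \<open>Condition \<open>(C\<^sub>3)\<close> enters only through the doubling inequality below; the bound \<open>q < 4\<close> is what
  makes Lipschitz functions belong to the space.\<close>

locale doubling_weight =
  fixes \<Omega> :: "nat \<Rightarrow> real" and q :: real
  assumes pos: "0 < \<Omega> n"
    and mono: "m \<le> n \<Longrightarrow> \<Omega> m \<le> \<Omega> n"
    and doubling: "\<Omega> (2 * n) \<le> q * \<Omega> n"
    and q_less: "q < 4"
begin

lemma q_ge: "1 \<le> q"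
  using doubling[of 0] pos[of 0] by simp

lemma doubling_power: "\<Omega> (2 ^ i * n) \<le> q ^ i * \<Omega> n"
proof (induction i)
  case (Suc i)
  have "\<Omega> (2 ^ Suc i * n) \<le> q * \<Omega> (2 ^ i * n)" using doubling[of "2 ^ i * n"] by (simp add: mult.assoc)
  also have "\<dots> \<le> q * (q ^ i * \<Omega> n)" using Suc q_ge by (intro mult_left_mono) auto
  finally show ?case by (simp add: mult.assoc)
qed simp

text \<open>The first summand pays for the coarse scales, where increments are only bounded by 4;
  the second is the geometric series with ratio q / 4 over the fine scales.\<close>

definition C :: real where "C = 4 * q\<^sup>2 + q ^ 3 / (1 - q / 4)"

lemma C_nonneg: "0 \<le> C"
  using q_ge q_less unfolding C_def by (intro add_nonneg_nonneg divide_nonneg_nonneg) auto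

text \<open>Dyadic jumps of \<Omega>, whose sums telescope. The index is shifted because increments
  by at most 2^-j control exactly the frequencies of size at least 2^(j+1), by the averaging
  argument with t = 2^-j.\<close>

definition b :: "nat \<Rightarrow> real" where "b j = \<Omega> (2 ^ (j + 2)) - \<Omega> (2 ^ (j + 1))"

lemma b_nonneg: "0 \<le> b j"
  unfolding b_def by (simp add: mono)

lemma sum_b: "(\<Sum>j<J. b j) = \<Omega> (2 ^ (J + 1)) - \<Omega> 2"
  by (induction J) (auto simp: b_def)

text \<open>With 2^k comparable to m, the scales j < k telescope to a value of \<Omega> near m. For
  j = k + i the weight \<open>b\<close> grows at most like q^i, while the factor n^2 4^-j decays
  like 4^-i.\<close>

lemma sum_b_min_le: "(\<Sum>j<J. b j * min 4 ((real m)\<^sup>2 / 4 ^ j)) \<le> C * \<Omega> m"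
proof (cases "m = 0")
  case True
  then show ?thesis using C_nonneg pos[of 0] by simp
next
  case False
  define g where "g j = b j * min 4 ((real m)\<^sup>2 / 4 ^ j)" for j
  have g0: "0 \<le> g j" for j unfolding g_def by (intro mult_nonneg_nonneg b_nonneg) auto
  have "\<exists>k. m < 2 ^ k" using less_exp by blast
  \<comment> \<open>The least such k satisfies m < 2^k \<le> 2 m. Hence 2^(k+1) \<le> 2^2 m and
    2^(k+2) \<le> 2^3 m, which is where the powers q^2 and q^3 come from.\<close>
  then obtain k where k: "m < 2 ^ k" "\<And>i. i < k \<Longrightarrow> \<not> m < 2 ^ i"
    using exists_least_iff[of "\<lambda>k. m < 2 ^ k"] by blast
  have "k \<noteq> 0" using k(1) False by (intro notI) simp
  then obtain i where i: "k = Suc i" by (cases k) auto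
  then have km: "2 ^ k \<le> 2 * m" using k(2)[of i] by simp
  have "(\<Sum>j<k. g j) \<le> (\<Sum>j<k. b j * 4)"
    unfolding g_def by (intro sum_mono mult_left_mono b_nonneg) auto
  also have "\<dots> = 4 * (\<Omega> (2 ^ (k + 1)) - \<Omega> 2)" by (simp add: sum_distrib_right[symmetric] sum_b)
  also have "\<dots> \<le> 4 * \<Omega> (2 ^ 2 * m)" using mono[of "2 ^ (k + 1)" "2 ^ 2 * m"] km pos[of 2] by simp
  also have "\<dots> \<le> 4 * (q\<^sup>2 * \<Omega> m)" by (intro mult_left_mono doubling_power) auto
  finally have 1: "(\<Sum>j<k. g j) \<le> 4 * q\<^sup>2 * \<Omega> m" by simp
  have "g (k + i) \<le> (q ^ 3 * \<Omega> m) * (q / 4) ^ i" for i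
  proof -
    have "b (k + i) \<le> \<Omega> (2 ^ i * 2 ^ (k + 2))"
      using pos[of "2 ^ (k + i + 1)"] by (simp add: b_def power_add mult_ac)
    also have "\<dots> \<le> q ^ i * \<Omega> (2 ^ (k + 2))" by (rule doubling_power)
    also have "\<dots> \<le> q ^ i * \<Omega> (2 ^ 3 * m)" using km q_ge by (intro mult_left_mono mono) auto
    also have "\<dots> \<le> q ^ i * (q ^ 3 * \<Omega> m)" using q_ge by (intro mult_left_mono doubling_power) auto
    finally have bb: "b (k + i) \<le> q ^ i * (q ^ 3 * \<Omega> m)" .
    have "real m \<le> 2 ^ k" using k(1) by (metis less_imp_le of_nat_le_iff of_nat_numeral of_nat_power)
    then have "(real m)\<^sup>2 \<le> (2 ^ k)\<^sup>2" by (intro power_mono) auto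
    also have "(2 ^ k)\<^sup>2 = (4 ^ k :: real)" by (simp add: power2_eq_square power_mult_distrib[symmetric])
    finally have "(real m)\<^sup>2 / 4 ^ (k + i) \<le> 4 ^ k / 4 ^ (k + i)" by (rule divide_right_mono) simp
    also have "\<dots> = (1 / 4) ^ i" by (simp add: power_add power_divide)
    finally have "min 4 ((real m)\<^sup>2 / 4 ^ (k + i)) \<le> (1 / 4) ^ i" by simp
    then have "g (k + i) \<le> q ^ i * (q ^ 3 * \<Omega> m) * (1 / 4) ^ i"
      unfolding g_def using bb b_nonneg[of "k + i"] by (intro mult_mono) auto
    then show ?thesis by (simp add: power_divide mult_ac)
  qed
  then have "(\<Sum>i<J. g (k + i)) \<le> (\<Sum>i<J. (q ^ 3 * \<Omega> m) * (q / 4) ^ i)" by (intro sum_mono)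
  also have "\<dots> = (q ^ 3 * \<Omega> m) * (\<Sum>i<J. (q / 4) ^ i)" by (simp add: sum_distrib_left)
  also have "(\<Sum>i<J. (q / 4) ^ i) \<le> 1 / (1 - q / 4)"
  proof -
    have "(\<Sum>i<J. (q / 4) ^ i) \<le> (\<Sum>i. (q / 4) ^ i)"
      using q_ge q_less by (intro sum_le_suminf summable_geometric) auto
    also have "\<dots> = 1 / (1 - q / 4)" using q_ge q_less by (intro suminf_geometric) auto
    finally show ?thesis .
  qed
  finally have 2: "(\<Sum>i<J. g (k + i)) \<le> q ^ 3 * \<Omega> m * (1 / (1 - q / 4))"
    using q_ge pos[of m] by (simp add: mult_left_mono)
  have "(\<Sum>j<J. g j) \<le> (\<Sum>j<k + J. g j)" by (intro sum_mono2) (auto simp: g0)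
  also have "\<dots> = (\<Sum>j<k. g j) + (\<Sum>i<J. g (k + i))" by (rule sum_lessThan_add)
  also have "\<dots> \<le> 4 * q\<^sup>2 * \<Omega> m + q ^ 3 * \<Omega> m * (1 / (1 - q / 4))" using 1 2 by linarith
  also have "\<dots> = C * \<Omega> m" by (simp add: C_def algebra_simps)
  finally show ?thesis by (simp add: g_def)
qed

text \<open>The comparison in the other direction: over the scales visible to m the jumps telescope
  up to the next dyadic point, so they overshoot \<Omega> at m by monotonicity.\<close>

lemma le_sum_b: "m < 2 ^ (J + 1) \<Longrightarrow> \<Omega> m \<le> \<Omega> 2 + (\<Sum>j<J. if 2 ^ (j + 1) \<le> m then b j else 0)"
proof (induction J)
  case 0 then show ?case by (simp add: mono)
next
  case (Suc J)
  show ?case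
  proof (cases "m < 2 ^ (J + 1)")
    case True
    then show ?thesis using Suc.IH b_nonneg[of J] by simp
  next
    case False
    have "2 ^ (j + 1) \<le> m" if "j < Suc J" for j
    proof -
      have "(2::nat) ^ (j + 1) \<le> 2 ^ (J + 1)" using that by (intro power_increasing) auto
      then show ?thesis using False by linarith
    qed
    then have "(\<Sum>j<Suc J. if 2 ^ (j + 1) \<le> m then b j else 0) = (\<Sum>j<Suc J. b j)"
      by (intro sum.cong) auto
    also have "\<dots> = \<Omega> (2 ^ (Suc J + 1)) - \<Omega> 2" by (rule sum_b)
    finally show ?thesis using mono[of m "2 ^ (Suc J + 1)"] Suc.prems by linarith
  qed
qed

lemma norm_wcoeff_sq: "(cmod (wcoeff \<Omega> f n))\<^sup>2 = \<Omega> (nat \<bar>n\<bar>) * (cmod (fourier f n))\<^sup>2"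
  using pos[of "nat \<bar>n\<bar>"] by (simp add: wcoeff_def norm_mult power_mult_distrib)

lemma sum_increments_le:
  assumes h: "continuous_on circle h" and hl: "wcoeff \<Omega> h \<in> l2"
  shows "(\<Sum>j<J. b j * (\<Sum>\<^sub>\<infinity>n. (cmod (fourier h n))\<^sup>2 * min 4 ((of_int n)\<^sup>2 / 4 ^ j))) \<le> C * nsq (wcoeff \<Omega> h)"
proof -
  have s: "(\<lambda>n. (cmod (fourier h n))\<^sup>2 * min 4 ((of_int n)\<^sup>2 / 4 ^ j)) summable_on UNIV" for j
    by (rule integral_rotate_diff_le(2)[OF h, of 0]) auto
  have sw: "(\<lambda>n. (cmod (wcoeff \<Omega> h n))\<^sup>2) summable_on UNIV" using hl by (simp add: l2_def)
  have "(\<Sum>j<J. b j * (\<Sum>\<^sub>\<infinity>n. (cmod (fourier h n))\<^sup>2 * min 4 ((of_int n)\<^sup>2 / 4 ^ j)))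
      = (\<Sum>\<^sub>\<infinity>n. \<Sum>j<J. b j * ((cmod (fourier h n))\<^sup>2 * min 4 ((of_int n)\<^sup>2 / 4 ^ j)))"
    by (subst infsum_finite_sum) (auto intro!: summable_on_cmult_right s simp: infsum_cmult_right')
  also have "\<dots> \<le> (\<Sum>\<^sub>\<infinity>n. C * (cmod (wcoeff \<Omega> h n))\<^sup>2)"
  proof (rule infsum_mono)
    show "(\<lambda>n. \<Sum>j<J. b j * ((cmod (fourier h n))\<^sup>2 * min 4 ((of_int n)\<^sup>2 / 4 ^ j))) summable_on UNIV"
      by (intro summable_on_finite_sum summable_on_cmult_right s) simp
    show "(\<lambda>n. C * (cmod (wcoeff \<Omega> h n))\<^sup>2) summable_on UNIV"
      by (rule summable_on_cmult_right[OF sw])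
    fix n :: int
    have "(\<Sum>j<J. b j * ((cmod (fourier h n))\<^sup>2 * min 4 ((of_int n)\<^sup>2 / 4 ^ j)))
        = (cmod (fourier h n))\<^sup>2 * (\<Sum>j<J. b j * min 4 ((real (nat \<bar>n\<bar>))\<^sup>2 / 4 ^ j))"
      by (simp add: sum_distrib_left mult_ac)
    also have "\<dots> \<le> (cmod (fourier h n))\<^sup>2 * (C * \<Omega> (nat \<bar>n\<bar>))"
      by (intro mult_left_mono sum_b_min_le) auto
    finally show "(\<Sum>j<J. b j * ((cmod (fourier h n))\<^sup>2 * min 4 ((of_int n)\<^sup>2 / 4 ^ j)))
        \<le> C * (cmod (wcoeff \<Omega> h n))\<^sup>2"
      by (simp add: norm_wcoeff_sq mult_ac)
  qed
  also have "\<dots> = C * nsq (wcoeff \<Omega> h)" by (simp add: nsq_def infsum_cmult_right')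
  finally show ?thesis .
qed

text \<open>The norm of \<open>\<ell>\<^sup>2(\<Omega>)\<close> is controlled by the \<open>L\<^sup>2\<close> sizes of the increments under small rotations, just as
  for a Dirichlet form. Hence pointwise domination of increments gives domination of norms.\<close>

lemma dominated_increments:
  assumes f: "continuous_on circle f" and h: "continuous_on circle h" and k: "continuous_on circle k"
    and hl: "wcoeff \<Omega> h \<in> l2" and kl: "wcoeff \<Omega> k \<in> l2" and A: "0 \<le> A" and B: "0 \<le> B"
    and dom: "\<And>s \<zeta>. 0 \<le> s \<Longrightarrow> s \<le> 1 \<Longrightarrow> \<zeta> \<in> circle \<Longrightarrow>
      (cmod (f (cis s * \<zeta>) - f \<zeta>))\<^sup>2 \<le> A * (cmod (h (cis s * \<zeta>) - h \<zeta>))\<^sup>2 + B * (cmod (k (cis s * \<zeta>) - k \<zeta>))\<^sup>2"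
  shows "wcoeff \<Omega> f \<in> l2"
    and "nsq (wcoeff \<Omega> f) \<le> \<Omega> 2 * (LINT \<zeta>|circle_measure. (cmod (f \<zeta>))\<^sup>2) + C * (A * nsq (wcoeff \<Omega> h) + B * nsq (wcoeff \<Omega> k))"
proof -
  define P where "P h j = (\<Sum>\<^sub>\<infinity>n. (cmod (fourier h n))\<^sup>2 * min 4 ((of_int n)\<^sup>2 / 4 ^ j))" for h and j :: nat
  define a where "a n = (cmod (fourier f n))\<^sup>2" for n
  have incr: "(LINT \<zeta>|circle_measure. (cmod (f (cis s * \<zeta>) - f \<zeta>))\<^sup>2) \<le> A * P h j + B * P k j"
    if s: "0 \<le> s" "s \<le> 1 / 2 ^ j" for s j
  proof -
    have s1: "s \<le> 1" using s(2) by (rule order_trans) simp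
    have i: "integrable circle_measure (\<lambda>\<zeta>. (cmod (g (cis s * \<zeta>) - g \<zeta>))\<^sup>2)" if "continuous_on circle g" for g
      by (intro circle_integrable_continuous continuous_intros continuous_rotate that) simp
    have "(LINT \<zeta>|circle_measure. (cmod (f (cis s * \<zeta>) - f \<zeta>))\<^sup>2)
        \<le> (LINT \<zeta>|circle_measure. A * (cmod (h (cis s * \<zeta>) - h \<zeta>))\<^sup>2 + B * (cmod (k (cis s * \<zeta>) - k \<zeta>))\<^sup>2)"
      using s(1) s1 dom
      by (intro integral_mono i f Bochner_Integration.integrable_add integrable_mult_right h k) auto
    also have "\<dots> = A * (LINT \<zeta>|circle_measure. (cmod (h (cis s * \<zeta>) - h \<zeta>))\<^sup>2)
        + B * (LINT \<zeta>|circle_measure. (cmod (k (cis s * \<zeta>) - k \<zeta>))\<^sup>2)"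
      by (simp only: Bochner_Integration.integral_add i h k integrable_mult_right integral_mult_right_zero)
    also have "\<dots> \<le> A * P h j + B * P k j"
      unfolding P_def by (intro add_mono mult_left_mono integral_rotate_diff_le s h k A B)
    finally show ?thesis .
  qed
  have tail: "(\<Sum>n\<in>F. a n) \<le> A * P h j + B * P k j" if F: "finite F" "\<And>n. n \<in> F \<Longrightarrow> 2 ^ (j + 1) \<le> nat \<bar>n\<bar>" for F j
    unfolding a_def
  \<comment> \<open>Averaging over rotations up to t = 2^-j: the requirement 2 \<le> |n| t says
    precisely that |n| is at least 2^(j+1).\<close>
  proof (rule fourier_tail_bound[OF f _ incr F(1)])
    fix n assume "n \<in> F"
    then have "2 ^ (j + 1) \<le> real (nat \<bar>n\<bar>)" using F(2)[of n] by (metis of_nat_le_iff of_nat_numeral of_nat_power)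
    then show "2 \<le> \<bar>of_int n\<bar> * (1 / 2 ^ j :: real)" by (simp add: field_simps)
  qed auto
  have *: "(\<Sum>n\<in>F. (cmod (wcoeff \<Omega> f n))\<^sup>2)
      \<le> \<Omega> 2 * (LINT \<zeta>|circle_measure. (cmod (f \<zeta>))\<^sup>2) + C * (A * nsq (wcoeff \<Omega> h) + B * nsq (wcoeff \<Omega> k))" if F: "finite F" for F
  proof -
    obtain J where J: "\<And>n. n \<in> F \<Longrightarrow> nat \<bar>n\<bar> < 2 ^ (J + 1)"
    proof -
      have "finite ((\<lambda>n. nat \<bar>n\<bar>) ` F)" using F by simp
      then obtain J where "\<forall>m\<in>(\<lambda>n. nat \<bar>n\<bar>) ` F. m < J" using finite_nat_set_iff_bounded by blast
      moreover have "J < 2 ^ (J + 1)" using less_exp[of "J + 1"] by linarith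
      ultimately show thesis using that[of J] by fastforce
    qed
    have "(\<Sum>n\<in>F. (cmod (wcoeff \<Omega> f n))\<^sup>2) = (\<Sum>n\<in>F. \<Omega> (nat \<bar>n\<bar>) * a n)"
      by (simp add: norm_wcoeff_sq a_def)
    \<comment> \<open>A layer-cake argument: with the weight written as a sum of jumps, exchanging
      the sums leaves one tail of squared coefficients for each scale.\<close>
    also have "\<dots> \<le> (\<Sum>n\<in>F. (\<Omega> 2 + (\<Sum>j<J. if 2 ^ (j + 1) \<le> nat \<bar>n\<bar> then b j else 0)) * a n)"
      by (intro sum_mono mult_right_mono le_sum_b J) (auto simp: a_def)
    also have "\<dots> = \<Omega> 2 * (\<Sum>n\<in>F. a n) + (\<Sum>j<J. \<Sum>n\<in>F. (if 2 ^ (j + 1) \<le> nat \<bar>n\<bar> then b j else 0) * a n)"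
      by (simp only: distrib_right sum.distrib sum_distrib_left sum_distrib_right) (subst (2) sum.swap, rule refl)
    also have "\<dots> = \<Omega> 2 * (\<Sum>n\<in>F. a n) + (\<Sum>j<J. b j * (\<Sum>n\<in>{n\<in>F. 2 ^ (j + 1) \<le> nat \<bar>n\<bar>}. a n))"
      using F by (simp only: sum_distrib_left) (intro arg_cong2[where f="(+)"] refl sum.cong sum.mono_neutral_cong_right, auto)
    also have "\<dots> \<le> \<Omega> 2 * (\<Sum>n\<in>F. a n) + (\<Sum>j<J. b j * (A * P h j + B * P k j))"
      using F by (intro add_left_mono sum_mono mult_left_mono b_nonneg tail) auto
    also have "(\<Sum>j<J. b j * (A * P h j + B * P k j)) = A * (\<Sum>j<J. b j * P h j) + B * (\<Sum>j<J. b j * P k j)"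
      by (simp add: distrib_left sum.distrib sum_distrib_left mult.left_commute)
    also have "\<dots> \<le> A * (C * nsq (wcoeff \<Omega> h)) + B * (C * nsq (wcoeff \<Omega> k))"
      unfolding P_def by (intro add_mono mult_left_mono sum_increments_le A B h k hl kl)
    also have "(\<Sum>n\<in>F. a n) \<le> (LINT \<zeta>|circle_measure. (cmod (f \<zeta>))\<^sup>2)"
      unfolding a_def using sum_le_nsq[OF bessel(1)[OF f] F] bessel(2)[OF f] by linarith
    finally show ?thesis using pos[of 2] by (simp add: distrib_left mult_left_mono mult_ac)
  qed
  show "wcoeff \<Omega> f \<in> l2"
    and "nsq (wcoeff \<Omega> f) \<le> \<Omega> 2 * (LINT \<zeta>|circle_measure. (cmod (f \<zeta>))\<^sup>2) + C * (A * nsq (wcoeff \<Omega> h) + B * nsq (wcoeff \<Omega> k))"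
    using l2_bound[of "wcoeff \<Omega> f", OF *] by auto
qed

lemma wcoeff_powi: "wcoeff \<Omega> (\<lambda>\<zeta>. \<zeta> powi k) \<in> l2"
proof -
  have "(\<lambda>n. (cmod (wcoeff \<Omega> (\<lambda>\<zeta>. \<zeta> powi k) n))\<^sup>2) summable_on {k}" by simp
  then show ?thesis unfolding l2_def mem_Collect_eq
    by (subst summable_on_cong_neutral[of "{k}" UNIV]) (auto simp: wcoeff_def fourier_powi)
qed

text \<open>Increments of f are dominated by L times those of h. The separate mean-square term is
  unavoidable, because increments do not see constants.\<close>

lemma wcoeff_contraction:
  assumes f: "continuous_on circle f" and h: "continuous_on circle h" and hl: "wcoeff \<Omega> h \<in> l2"
    and lip: "\<And>x y. x \<in> circle \<Longrightarrow> y \<in> circle \<Longrightarrow> cmod (f x - f y) \<le> L * cmod (h x - h y)"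
  shows "wcoeff \<Omega> f \<in> l2"
    and "nsq (wcoeff \<Omega> f) \<le> \<Omega> 2 * (LINT \<zeta>|circle_measure. (cmod (f \<zeta>))\<^sup>2) + C * (L\<^sup>2 * nsq (wcoeff \<Omega> h))"
proof -
  have "(cmod (f (cis s * \<zeta>) - f \<zeta>))\<^sup>2 \<le> L\<^sup>2 * (cmod (h (cis s * \<zeta>) - h \<zeta>))\<^sup>2 + 0 * (cmod (h (cis s * \<zeta>) - h \<zeta>))\<^sup>2"
    if "\<zeta> \<in> circle" for s \<zeta>
  proof -
    have "(cmod (f (cis s * \<zeta>) - f \<zeta>))\<^sup>2 \<le> (L * cmod (h (cis s * \<zeta>) - h \<zeta>))\<^sup>2"
      using that by (intro power_mono lip) (auto simp: norm_mult)
    then show ?thesis by (simp add: power_mult_distrib)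
  qed
  from dominated_increments[OF f h h hl hl _ _ this]
  show "wcoeff \<Omega> f \<in> l2"
    and "nsq (wcoeff \<Omega> f) \<le> \<Omega> 2 * (LINT \<zeta>|circle_measure. (cmod (f \<zeta>))\<^sup>2) + C * (L\<^sup>2 * nsq (wcoeff \<Omega> h))"
    by auto
qed

text \<open>The comparison function is the identity of the circle, which has a single nonzero
  coefficient.\<close>

lemma wcoeff_lipschitz:
  assumes f: "continuous_on circle f"
    and lip: "\<And>x y. x \<in> circle \<Longrightarrow> y \<in> circle \<Longrightarrow> cmod (f x - f y) \<le> L * cmod (x - y)"
  shows "wcoeff \<Omega> f \<in> l2"
  using wcoeff_contraction(1)[OF f _ _ lip] wcoeff_powi[of 1] by simp

text \<open>A discrete product rule: each increment of f g splits into an increment of f times g and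
  f times an increment of g. The bound is explicit because it must be uniform when g runs through
  Fejer means.\<close>

lemma wcoeff_mult:
  assumes f: "continuous_on circle f" "wcoeff \<Omega> f \<in> l2" and g: "continuous_on circle g" "wcoeff \<Omega> g \<in> l2"
    and Mf: "\<And>\<zeta>. \<zeta> \<in> circle \<Longrightarrow> cmod (f \<zeta>) \<le> Mf" and Mg: "\<And>\<zeta>. \<zeta> \<in> circle \<Longrightarrow> cmod (g \<zeta>) \<le> Mg"
  shows "wcoeff \<Omega> (\<lambda>\<zeta>. f \<zeta> * g \<zeta>) \<in> l2"
    and "nsq (wcoeff \<Omega> (\<lambda>\<zeta>. f \<zeta> * g \<zeta>))
      \<le> \<Omega> 2 * (Mf * Mg)\<^sup>2 + C * (2 * Mg\<^sup>2 * nsq (wcoeff \<Omega> f) + 2 * Mf\<^sup>2 * nsq (wcoeff \<Omega> g))"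
proof -
  have M0: "0 \<le> Mf" "0 \<le> Mg" using Mf[of 1] Mg[of 1] by (auto intro: order_trans[OF norm_ge_zero])
  have fg: "continuous_on circle (\<lambda>\<zeta>. f \<zeta> * g \<zeta>)" by (intro continuous_intros f g)
  have dom: "(cmod (f (cis s * \<zeta>) * g (cis s * \<zeta>) - f \<zeta> * g \<zeta>))\<^sup>2
      \<le> 2 * Mg\<^sup>2 * (cmod (f (cis s * \<zeta>) - f \<zeta>))\<^sup>2 + 2 * Mf\<^sup>2 * (cmod (g (cis s * \<zeta>) - g \<zeta>))\<^sup>2"
    if z: "\<zeta> \<in> circle" for s \<zeta>
  proof -
    have z': "cis s * \<zeta> \<in> circle" using z by (simp add: norm_mult)
    have "f (cis s * \<zeta>) * g (cis s * \<zeta>) - f \<zeta> * g \<zeta>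
        = (f (cis s * \<zeta>) - f \<zeta>) * g (cis s * \<zeta>) + f \<zeta> * (g (cis s * \<zeta>) - g \<zeta>)"
      by (simp add: algebra_simps)
    then have "(cmod (f (cis s * \<zeta>) * g (cis s * \<zeta>) - f \<zeta> * g \<zeta>))\<^sup>2
        \<le> 2 * (cmod ((f (cis s * \<zeta>) - f \<zeta>) * g (cis s * \<zeta>)))\<^sup>2 + 2 * (cmod (f \<zeta> * (g (cis s * \<zeta>) - g \<zeta>)))\<^sup>2"
      using norm_add_sq_le[of 1] by simp
    moreover have "(cmod ((f (cis s * \<zeta>) - f \<zeta>) * g (cis s * \<zeta>)))\<^sup>2 \<le> (cmod (f (cis s * \<zeta>) - f \<zeta>))\<^sup>2 * Mg\<^sup>2"
      unfolding norm_mult power_mult_distrib by (intro mult_left_mono power_mono Mg z') auto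
    moreover have "(cmod (f \<zeta> * (g (cis s * \<zeta>) - g \<zeta>)))\<^sup>2 \<le> Mf\<^sup>2 * (cmod (g (cis s * \<zeta>) - g \<zeta>))\<^sup>2"
      unfolding norm_mult power_mult_distrib by (intro mult_right_mono power_mono Mf z) auto
    ultimately show ?thesis by (simp add: mult.commute)
  qed
  have "(LINT \<zeta>|circle_measure. (cmod (f \<zeta> * g \<zeta>))\<^sup>2) \<le> (LINT \<zeta>|circle_measure. (Mf * Mg)\<^sup>2)"
  proof (rule integral_mono)
    show "integrable circle_measure (\<lambda>\<zeta>. (cmod (f \<zeta> * g \<zeta>))\<^sup>2)"
      by (intro circle_integrable_continuous continuous_intros f g)
  qed (auto intro!: power_mono mult_mono Mf Mg M0 simp: norm_mult)
  then have l: "\<Omega> 2 * (LINT \<zeta>|circle_measure. (cmod (f \<zeta> * g \<zeta>))\<^sup>2) \<le> \<Omega> 2 * (Mf * Mg)\<^sup>2"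
    using pos[of 2] by (intro mult_left_mono) auto
  note d = dominated_increments[OF fg f(1) g(1) f(2) g(2) _ _ dom]
  show "wcoeff \<Omega> (\<lambda>\<zeta>. f \<zeta> * g \<zeta>) \<in> l2" by (rule d(1)) auto
  have "nsq (wcoeff \<Omega> (\<lambda>\<zeta>. f \<zeta> * g \<zeta>))
      \<le> \<Omega> 2 * (LINT \<zeta>|circle_measure. (cmod (f \<zeta> * g \<zeta>))\<^sup>2) + C * (2 * Mg\<^sup>2 * nsq (wcoeff \<Omega> f) + 2 * Mf\<^sup>2 * nsq (wcoeff \<Omega> g))"
    by (rule d(2)) auto
  then show "nsq (wcoeff \<Omega> (\<lambda>\<zeta>. f \<zeta> * g \<zeta>))
      \<le> \<Omega> 2 * (Mf * Mg)\<^sup>2 + C * (2 * Mg\<^sup>2 * nsq (wcoeff \<Omega> f) + 2 * Mf\<^sup>2 * nsq (wcoeff \<Omega> g))"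
    using l by linarith
qed

lemma wcoeff_fejer:
  assumes "wcoeff \<Omega> g \<in> l2"
  shows "wcoeff \<Omega> (fejer N g) \<in> l2" "nsq (wcoeff \<Omega> (fejer N g)) \<le> nsq (wcoeff \<Omega> g)"
proof -
  have "cmod (wcoeff \<Omega> (fejer N g) n) \<le> cmod (wcoeff \<Omega> g n)" for n
  proof -
    obtain c where c: "0 \<le> c" "c \<le> 1" "fourier (fejer N g) n = of_real c * fourier g n"
      by (rule fejer_fourier)
    have "cmod (fourier (fejer N g) n) \<le> cmod (fourier g n)"
      using c by (simp add: norm_mult mult_left_le_one_le)
    then show ?thesis using pos[of "nat \<bar>n\<bar>"] by (simp add: wcoeff_def norm_mult mult_left_mono)
  qed
  from l2_mono[OF assms this] show "wcoeff \<Omega> (fejer N g) \<in> l2" "nsq (wcoeff \<Omega> (fejer N g)) \<le> nsq (wcoeff \<Omega> g)" .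
qed

text \<open>The smallest weight is \<Omega>(0). This absorbs the mean-square term of the contraction
  estimate into the weighted norm.\<close>

lemma L2_le_nsq_wcoeff:
  assumes h: "continuous_on circle h" "wcoeff \<Omega> h \<in> l2"
  shows "\<Omega> 0 * (LINT \<zeta>|circle_measure. (cmod (h \<zeta>))\<^sup>2) \<le> nsq (wcoeff \<Omega> h)"
proof -
  have "cmod (of_real (sqrt (\<Omega> 0)) * fourier h n) \<le> cmod (wcoeff \<Omega> h n)" for n
    using mono[of 0 "nat \<bar>n\<bar>"] pos by (simp add: wcoeff_def norm_mult mult_right_mono less_imp_le)
  from l2_mono(2)[OF h(2) this] have "\<Omega> 0 * nsq (fourier h) \<le> nsq (wcoeff \<Omega> h)"
    unfolding l2_scale(2)[OF bessel(1)[OF h(1)]] using pos[of 0] by simp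
  then show ?thesis using parseval_le[OF h(1)] pos[of 0]
    by (meson mult_left_mono less_imp_le order_trans)
qed

end

section \<open>Smooth functions\<close>

text \<open>Formulated on the line, where a function and all its derivatives are objects of the same
  kind.\<close>

definition smooth_curve :: "(real \<Rightarrow> complex) \<Rightarrow> bool" where
  "smooth_curve f \<longleftrightarrow>
     (\<exists>D::nat \<Rightarrow> real \<Rightarrow> complex. D 0 = f \<and> (\<forall>k \<theta>. (D k has_vector_derivative D (Suc k) \<theta>) (at \<theta>)))"

lemma smooth_on_circle_iff: "smooth_on_circle f \<longleftrightarrow> smooth_curve (\<lambda>\<theta>. f (cis \<theta>))"
  by (simp add: smooth_on_circle_def smooth_curve_def)

text \<open>Choose for each member of the class a derivative that is again a member; iterating this
  choice produces the whole sequence of derivatives at once.\<close>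

lemma smooth_curve_closed:
  assumes A: "\<And>f. f \<in> A \<Longrightarrow> \<exists>f'\<in>A. \<forall>\<theta>. (f has_vector_derivative f' \<theta>) (at \<theta>)" and f: "f \<in> A"
  shows "smooth_curve f"
proof -
  obtain d where d: "\<And>f. f \<in> A \<Longrightarrow> d f \<in> A" "\<And>f \<theta>. f \<in> A \<Longrightarrow> (f has_vector_derivative d f \<theta>) (at \<theta>)"
    using A by metis
  have "(d ^^ k) f \<in> A" for k by (induction k) (auto intro: d f)
  then show ?thesis unfolding smooth_curve_def
    by (intro exI[of _ "\<lambda>k. (d ^^ k) f"]) (auto intro: d)
qed

text \<open>The algebra generated by \<open>G\<close>. Since sums and products differentiate within
  an algebra, only the generators have to be differentiated, and no formula for higher derivatives
  is required.\<close>

inductive_set fun_alg :: "(real \<Rightarrow> complex) set \<Rightarrow> (real \<Rightarrow> complex) set" for G where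
  base: "f \<in> G \<Longrightarrow> f \<in> fun_alg G"
| const: "(\<lambda>_. c) \<in> fun_alg G"
| add: "f \<in> fun_alg G \<Longrightarrow> g \<in> fun_alg G \<Longrightarrow> (\<lambda>\<theta>. f \<theta> + g \<theta>) \<in> fun_alg G"
| mult: "f \<in> fun_alg G \<Longrightarrow> g \<in> fun_alg G \<Longrightarrow> (\<lambda>\<theta>. f \<theta> * g \<theta>) \<in> fun_alg G"

lemma smooth_curve_fun_alg:
  assumes G: "\<And>g. g \<in> G \<Longrightarrow> \<exists>g'\<in>fun_alg G. \<forall>\<theta>. (g has_vector_derivative g' \<theta>) (at \<theta>)" and f: "f \<in> fun_alg G"
  shows "smooth_curve f"
proof (rule smooth_curve_closed[OF _ f])
  fix f assume "f \<in> fun_alg G"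
  then show "\<exists>f'\<in>fun_alg G. \<forall>\<theta>. (f has_vector_derivative f' \<theta>) (at \<theta>)"
  proof induction
    case (base f) then show ?case by (rule G)
  next
    case (const c) show ?case by (rule bexI[of _ "\<lambda>_. 0"]) (auto intro: fun_alg.const)
  next
    case (add f g)
    then obtain f' g' where "f' \<in> fun_alg G" "g' \<in> fun_alg G"
      "\<forall>\<theta>. (f has_vector_derivative f' \<theta>) (at \<theta>)" "\<forall>\<theta>. (g has_vector_derivative g' \<theta>) (at \<theta>)" by blast
    then show ?case
      by (intro bexI[of _ "\<lambda>\<theta>. f' \<theta> + g' \<theta>"]) (auto intro: fun_alg.add has_vector_derivative_add)
  next
    case (mult f g)
    then obtain f' g' where "f' \<in> fun_alg G" "g' \<in> fun_alg G"
      "\<forall>\<theta>. (f has_vector_derivative f' \<theta>) (at \<theta>)" "\<forall>\<theta>. (g has_vector_derivative g' \<theta>) (at \<theta>)" by blast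
    with mult show ?case
      by (intro bexI[of _ "\<lambda>\<theta>. f \<theta> * g' \<theta> + f' \<theta> * g \<theta>"]) (auto intro: fun_alg.intros has_vector_derivative_mult)
  qed
qed

lemma smooth_curve_const: "smooth_curve (\<lambda>_. c)"
  by (rule smooth_curve_fun_alg[of "{}"]) (auto intro: fun_alg.intros)

lemma
  assumes "smooth_curve f" "smooth_curve g"
  shows smooth_curve_add: "smooth_curve (\<lambda>\<theta>. f \<theta> + g \<theta>)"
    and smooth_curve_mult: "smooth_curve (\<lambda>\<theta>. f \<theta> * g \<theta>)"
proof -
  obtain D E where D: "D 0 = f" "\<And>k \<theta>. (D k has_vector_derivative D (Suc k) \<theta>) (at \<theta>)"
    and E: "E 0 = g" "\<And>k \<theta>. (E k has_vector_derivative E (Suc k) \<theta>) (at \<theta>)"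
    using assms unfolding smooth_curve_def by blast
  \<comment> \<open>Taking all derivatives of both functions as generators makes the algebra closed
    under differentiation.\<close>
  let ?G = "range D \<union> range E"
  have G: "\<exists>g'\<in>fun_alg ?G. \<forall>\<theta>. (g has_vector_derivative g' \<theta>) (at \<theta>)" if "g \<in> ?G" for g
  proof -
    have DE: "D k \<in> fun_alg ?G" "E k \<in> fun_alg ?G" for k by (auto intro: fun_alg.base)
    consider k where "g = D k" | k where "g = E k" using \<open>g \<in> ?G\<close> by blast
    then show ?thesis
    proof cases
      case (1 k) then show ?thesis by (intro bexI[OF _ DE(1)[of "Suc k"]]) (simp add: D(2))
    next
      case (2 k) then show ?thesis by (intro bexI[OF _ DE(2)[of "Suc k"]]) (simp add: E(2))
    qed
  qed
  have fg: "f \<in> fun_alg ?G" "g \<in> fun_alg ?G" using D(1) E(1) by (auto intro: fun_alg.base)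
  show "smooth_curve (\<lambda>\<theta>. f \<theta> + g \<theta>)"
    by (rule smooth_curve_fun_alg[of ?G, OF G fun_alg.add[OF fg]])
  show "smooth_curve (\<lambda>\<theta>. f \<theta> * g \<theta>)"
    by (rule smooth_curve_fun_alg[of ?G, OF G fun_alg.mult[OF fg]])
qed

lemma smooth_curve_cis_powi: "smooth_curve (\<lambda>\<theta>. cis \<theta> powi n)"
proof -
  let ?G = "{\<lambda>\<theta>. cis (of_int n * \<theta>)}"
  have 1: "((\<lambda>\<theta>. cis (of_int n * \<theta>)) has_vector_derivative (\<i> * of_int n) * cis (of_int n * \<theta>)) (at \<theta>)" for \<theta>
    unfolding has_vector_derivative_def
    by (auto intro!: derivative_eq_intros simp: scaleR_conv_of_real field_simps)
  have 2: "(\<lambda>\<theta>. (\<i> * of_int n) * cis (of_int n * \<theta>)) \<in> fun_alg ?G"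
    by (intro fun_alg.mult fun_alg.const fun_alg.base) simp
  have "\<exists>g'\<in>fun_alg ?G. \<forall>\<theta>. (g has_vector_derivative g' \<theta>) (at \<theta>)" if "g \<in> ?G" for g
    by (rule bexI[OF _ 2]) (use that 1 in simp)
  then have "smooth_curve (\<lambda>\<theta>. cis (of_int n * \<theta>))"
    by (rule smooth_curve_fun_alg) (auto intro: fun_alg.base)
  then show ?thesis by (simp add: cis_power_int)
qed

lemma smooth_curve_sum:
  assumes "\<And>i. i \<in> I \<Longrightarrow> smooth_curve (f i)"
  shows "smooth_curve (\<lambda>\<theta>. \<Sum>i\<in>I. f i \<theta>)"
  using assms by (induction I rule: infinite_finite_induct) (auto intro: smooth_curve_const smooth_curve_add)

lemma smooth_on_circle_add: "smooth_on_circle f \<Longrightarrow> smooth_on_circle g \<Longrightarrow> smooth_on_circle (\<lambda>\<zeta>. f \<zeta> + g \<zeta>)"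
  and smooth_on_circle_mult: "smooth_on_circle f \<Longrightarrow> smooth_on_circle g \<Longrightarrow> smooth_on_circle (\<lambda>\<zeta>. f \<zeta> * g \<zeta>)"
  and smooth_on_circle_const: "smooth_on_circle (\<lambda>\<zeta>. c)"
  and smooth_on_circle_powi: "smooth_on_circle (\<lambda>\<zeta>. \<zeta> powi n)"
  and smooth_on_circle_sum: "(\<And>i. i \<in> I \<Longrightarrow> smooth_on_circle (h i)) \<Longrightarrow> smooth_on_circle (\<lambda>\<zeta>. \<Sum>i\<in>I. h i \<zeta>)"
  unfolding smooth_on_circle_iff
  by (auto intro: smooth_curve_add smooth_curve_mult smooth_curve_const smooth_curve_cis_powi smooth_curve_sum)

lemma smooth_on_circle_fejer: "smooth_on_circle (fejer N g)"
  unfolding fejer_def[abs_def] divide_inverse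
  by (intro smooth_on_circle_mult smooth_on_circle_sum smooth_on_circle_const smooth_on_circle_powi)

section \<open>A flat cut-off function\<close>

lemma power_le_fact_exp:
  assumes "0 \<le> (x::real)"
  shows "x ^ n \<le> fact n * exp x"
proof -
  have "(\<Sum>k<Suc n. x ^ k /\<^sub>R fact k) \<le> (\<Sum>k. x ^ k /\<^sub>R fact k)"
    by (rule sum_le_suminf[OF summable_exp_generic]) (use assms in auto)
  moreover have "x ^ n /\<^sub>R fact n \<le> (\<Sum>k<Suc n. x ^ k /\<^sub>R fact k)"
    using assms by (simp add: sum_nonneg)
  ultimately have "x ^ n /\<^sub>R fact n \<le> exp x" by (simp add: exp_def)
  then show ?thesis by (simp add: field_simps)
qed

text \<open>The case m = 0 is the classical function exp(-1/x) extended by 0; the negative powers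
  are included so that the family is closed under differentiation up to linear combinations.\<close>

definition flat :: "nat \<Rightarrow> real \<Rightarrow> real" where
  "flat m x = (if 0 < x then exp (- (1 / x)) / x ^ m else 0)"

lemma abs_flat_le: "\<bar>flat m x\<bar> \<le> fact (m + 2) * x\<^sup>2"
proof (cases "0 < x")
  case True
  have "(1 / x) ^ (m + 2) \<le> fact (m + 2) * exp (1 / x)" by (rule power_le_fact_exp) (use True in simp)
  then have "(1 / x) ^ (m + 2) * exp (- (1 / x)) \<le> fact (m + 2) * exp (1 / x) * exp (- (1 / x))"
    by (rule mult_right_mono) simp
  also have "\<dots> = fact (m + 2)" by (simp add: mult.assoc exp_add[symmetric])
  finally have "(1 / x) ^ (m + 2) * exp (- (1 / x)) * x\<^sup>2 \<le> fact (m + 2) * x\<^sup>2" by (rule mult_right_mono) simp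
  moreover have "(1 / x) ^ (m + 2) * exp (- (1 / x)) * x\<^sup>2 = flat m x"
    using True by (simp add: flat_def power_add power_divide field_simps power2_eq_square)
  moreover have "0 \<le> flat m x" using True by (simp add: flat_def)
  ultimately show ?thesis by simp
qed (simp add: flat_def)

text \<open>Away from 0 this is calculus. At 0 the quadratic bound on \<open>flat\<close> bounds the
  difference quotient by a multiple of |h|, so the derivative is 0.\<close>

lemma flat_deriv: "(flat m has_real_derivative flat (m + 2) x - real m * flat (m + 1) x) (at x)"
proof -
  consider "0 < x" | "x < 0" | "x = 0" by linarith
  then show ?thesis
  proof cases
    case 1
    have "((\<lambda>x. exp (- (1 / x)) * inverse (x ^ m)) has_real_derivative
        (exp (- (1 / x)) * (1 / x\<^sup>2) * inverse (x ^ m) + exp (- (1 / x)) * (- (inverse (x ^ m) * (real m * x ^ (m - 1)) * inverse (x ^ m))))) (at x)"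
      using 1 by (auto intro!: derivative_eq_intros simp: power2_eq_square divide_inverse mult_ac)
    also have "exp (- (1 / x)) * (1 / x\<^sup>2) * inverse (x ^ m) + exp (- (1 / x)) * (- (inverse (x ^ m) * (real m * x ^ (m - 1)) * inverse (x ^ m)))
        = flat (m + 2) x - real m * flat (m + 1) x"
      using 1 by (cases m) (auto simp: flat_def field_simps power2_eq_square)
    finally show ?thesis
      by (rule has_field_derivative_transform_within_open[of _ _ _ "{0<..}"]) (use 1 in \<open>auto simp: flat_def divide_inverse\<close>)
  next
    case 2
    have "((\<lambda>_. 0) has_real_derivative 0) (at x)" by simp
    from has_field_derivative_transform_within_open[OF this, of "{..<0}" "flat m"] 2
    show ?thesis by (auto simp: flat_def)
  next
    case 3
    have "((\<lambda>h. (flat m (0 + h) - flat m 0) / h) \<longlongrightarrow> 0) (at 0)"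
    proof (rule Lim_null_comparison)
      show "\<forall>\<^sub>F h in at 0. norm ((flat m (0 + h) - flat m 0) / h) \<le> fact (m + 2) * \<bar>h\<bar>"
        using abs_flat_le[of m] by (intro always_eventually)
          (auto simp: flat_def[of m 0] power2_eq_square divide_le_eq mult.assoc abs_mult_self_eq)
      show "((\<lambda>h. fact (m + 2) * \<bar>h\<bar>) \<longlongrightarrow> 0) (at (0::real))"
        by (auto intro!: tendsto_eq_intros)
    qed
    then show ?thesis using 3 by (simp add: DERIV_def flat_def[of _ 0])
  qed
qed

text \<open>The derivative is \<open>flat 2\<close>, and y^2 exp(-y) \<le> 2! for y = 1/x.\<close>

lemma flat_lipschitz: "\<bar>flat 0 x - flat 0 y\<bar> \<le> 2 * \<bar>x - y\<bar>"
proof -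
  have "\<bar>flat 2 x\<bar> \<le> 2" for x
  proof (cases "0 < x")
    case True
    have "(1 / x)\<^sup>2 * exp (- (1 / x)) \<le> fact 2 * exp (1 / x) * exp (- (1 / x))"
      by (intro mult_right_mono power_le_fact_exp) (use True in auto)
    also have "\<dots> = 2" by (simp add: mult.assoc exp_add[symmetric])
    finally show ?thesis using True by (simp add: flat_def power_divide field_simps)
  qed (simp add: flat_def)
  then have "norm (flat 0 x - flat 0 y) \<le> 2 * norm (x - y)"
    using flat_deriv[of 0, unfolded add_0 of_nat_0 mult_zero_left diff_zero]
    by (intro field_differentiable_bound[of UNIV "flat 0" "flat 2"]) (auto intro: DERIV_subset)
  then show ?thesis by simp
qed

lemma smooth_curve_flat:
  assumes "smooth_curve f"
  shows "smooth_curve (\<lambda>\<theta>. of_real (flat 0 (1 - 2 * Re (f \<theta>))))"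
proof -
  obtain D where D: "D 0 = f" "\<And>k \<theta>. (D k has_vector_derivative D (Suc k) \<theta>) (at \<theta>)"
    using assms unfolding smooth_curve_def by blast
  define v where "v \<theta> = 1 - 2 * Re (f \<theta>)" for \<theta>
  define P where "P m = (\<lambda>\<theta>. complex_of_real (flat m (v \<theta>)))" for m
  define S where "S k = (\<lambda>\<theta>. complex_of_real (Re (D k \<theta>)))" for k
  \<comment> \<open>The chain rule sends a composite with \<open>flat m\<close> to composites with m
    + 1 and m + 2 times the first derivative of the inner function, so these generators
    suffice.\<close>
  let ?G = "range P \<union> range S"
  have S: "(S k has_vector_derivative S (Suc k) \<theta>) (at \<theta>)" for k \<theta>
    unfolding S_def
    by (intro bounded_linear.has_vector_derivative[OF bounded_linear_of_real]
        bounded_linear.has_vector_derivative[OF bounded_linear_Re] D)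
  have v: "(v has_real_derivative - 2 * Re (D 1 \<theta>)) (at \<theta>)" for \<theta>
  proof -
    have "((\<lambda>\<theta>. Re (f \<theta>)) has_real_derivative Re (D 1 \<theta>)) (at \<theta>)"
      unfolding has_real_derivative_iff_has_vector_derivative
      using bounded_linear.has_vector_derivative[OF bounded_linear_Re D(2)[of 0 \<theta>]] D(1) by simp
    from DERIV_diff[OF DERIV_const[of 1] DERIV_cmult[OF this, of 2]]
    show ?thesis by (simp add: v_def[abs_def])
  qed
  have P: "(P m has_vector_derivative (P (m + 2) \<theta> + of_real (- real m) * P (m + 1) \<theta>) * (of_real (- 2) * S 1 \<theta>)) (at \<theta>)" for m \<theta>
  proof -
    have "((\<lambda>\<theta>. flat m (v \<theta>)) has_real_derivative (flat (m + 2) (v \<theta>) - real m * flat (m + 1) (v \<theta>)) * (- 2 * Re (D 1 \<theta>))) (at \<theta>)"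
      by (rule DERIV_chain2[OF flat_deriv v])
    then have "((\<lambda>\<theta>. flat m (v \<theta>)) has_vector_derivative (flat (m + 2) (v \<theta>) - real m * flat (m + 1) (v \<theta>)) * (- 2 * Re (D 1 \<theta>))) (at \<theta>)"
      by (simp only: has_real_derivative_iff_has_vector_derivative)
    from bounded_linear.has_vector_derivative[OF bounded_linear_of_real this]
    show ?thesis by (simp add: P_def S_def)
  qed
  have G: "\<exists>g'\<in>fun_alg ?G. \<forall>\<theta>. (g has_vector_derivative g' \<theta>) (at \<theta>)" if "g \<in> ?G" for g
  proof -
    consider m where "g = P m" | k where "g = S k" using \<open>g \<in> ?G\<close> by blast
    then show ?thesis
    proof cases
      case 1
      have "(\<lambda>\<theta>. (P (m + 2) \<theta> + of_real (- real m) * P (m + 1) \<theta>) * (of_real (- 2) * S 1 \<theta>)) \<in> fun_alg ?G"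
        by (intro fun_alg.mult fun_alg.add fun_alg.const fun_alg.base) auto
      then show ?thesis by (rule bexI[rotated]) (use P[of m] 1 in simp)
    next
      case 2
      have "S (Suc k) \<in> fun_alg ?G" by (intro fun_alg.base) auto
      then show ?thesis by (rule bexI[rotated]) (use S[of k] 2 in simp)
    qed
  qed
  have "P 0 \<in> fun_alg ?G" by (intro fun_alg.base) auto
  from smooth_curve_fun_alg[OF G this] show ?thesis by (simp add: P_def v_def)
qed

section \<open>Arcs and chords; smooth functions are Lipschitz on the circle\<close>

lemma abs_le_norm_cis_minus_one:
  assumes "\<bar>s\<bar> \<le> pi"
  shows "\<bar>s\<bar> \<le> 4 * cmod (cis s - 1)"
proof -
  \<comment> \<open>A crude constant keeps this elementary: up to 1 the mean value theorem applies
    with cosine at least cos(pi/3) = 1/2; beyond 1 the sine is at least sin(pi/6) = 1/2 while x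
    \<le> 2.\<close>
  have sin_ge: "x \<le> 4 * sin x" if x: "0 \<le> x" "x \<le> pi / 2" for x :: real
  proof (cases "x \<le> 1")
    case True
    show ?thesis
    proof (cases "x = 0")
      case False
      have "\<exists>z. 0 < z \<and> z < x \<and> sin x - sin 0 = (x - 0) * cos z"
        by (rule MVT2) (use x False in auto)
      then obtain z where z: "0 < z" "z < x" "sin x = x * cos z" by auto
      have "cos (pi / 3) \<le> cos z"
        by (rule cos_monotone_0_pi_le) (use z True pi_gt3 in auto)
      then have "x * (1 / 2) \<le> x * cos z" using x by (intro mult_left_mono) (auto simp: cos_60)
      then show ?thesis using z(3) x by linarith
    qed simp
  next
    case False
    have "sin (pi / 6) \<le> sin x"
      by (rule sin_monotone_2pi_le) (use x False pi_less_4 in auto)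
    then have "1 / 2 \<le> sin x" by (simp add: sin_30)
    moreover have "x \<le> 2" using x pi_less_4 by simp
    ultimately show ?thesis by linarith
  qed
  have "2 - 2 * cos s = (2 * sin (s / 2))\<^sup>2"
    using cos_double_sin[of "s / 2"] by (simp add: power_mult_distrib)
  then have sq: "(cmod (cis s - 1))\<^sup>2 = (2 * sin (\<bar>s\<bar> / 2))\<^sup>2"
    unfolding norm_cis_minus_one_sq by (cases "0 \<le> s") (auto simp: power_mult_distrib)
  have nn: "0 \<le> sin (\<bar>s\<bar> / 2)" by (rule sin_ge_zero) (use assms in auto)
  have "cmod (cis s - 1) = 2 * sin (\<bar>s\<bar> / 2)"
    by (rule power2_eq_imp_eq[OF sq norm_ge_zero]) (use nn in linarith)
  moreover have "\<bar>s\<bar> / 2 \<le> 4 * sin (\<bar>s\<bar> / 2)" by (rule sin_ge) (use assms in auto)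
  ultimately show ?thesis by linarith
qed

lemma smooth_on_circle_lipschitz:
  assumes "smooth_on_circle f"
  obtains L where "\<And>x y. x \<in> circle \<Longrightarrow> y \<in> circle \<Longrightarrow> cmod (f x - f y) \<le> L * cmod (x - y)"
proof -
  obtain D where D: "D 0 = (\<lambda>\<theta>. f (cis \<theta>))" "\<And>k \<theta>. (D k has_vector_derivative D (Suc k) \<theta>) (at \<theta>)"
    using assms unfolding smooth_on_circle_def by blast
  \<comment> \<open>The angles used below are t and s + t with |s|, |t| \<le> pi < 4, so this
    interval contains them all.\<close>
  have "continuous_on {-8..8} (D 1)"
    by (rule continuous_on_vector_derivative) (use D(2)[of 1] in \<open>auto intro: has_vector_derivative_at_within\<close>)
  then have "compact (D 1 ` {-8..8})" by (rule compact_continuous_image) simp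
  then have "bounded (D 1 ` {-8..8})" by (rule compact_imp_bounded)
  then obtain M where M: "\<And>\<theta>. \<theta> \<in> {-8..8} \<Longrightarrow> cmod (D 1 \<theta>) \<le> M"
    unfolding bounded_iff by blast
  have M0: "0 \<le> M" by (rule order_trans[OF norm_ge_zero M[of 0]]) simp
  have lip: "cmod (f (cis a) - f (cis b)) \<le> M * \<bar>a - b\<bar>" if "a \<in> {-8..8}" "b \<in> {-8..8}" for a b
  proof -
    have "cmod (D 0 a - D 0 b) \<le> M * norm (a - b)"
    proof (rule differentiable_bound[of "{-8..8}" "D 0" "\<lambda>x h. h *\<^sub>R D 1 x"])
      fix x :: real assume x: "x \<in> {-8..8}"
      show "(D 0 has_derivative (\<lambda>h. h *\<^sub>R D 1 x)) (at x within {-8..8})"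
        using D(2)[of 0 x] by (auto simp: has_vector_derivative_def intro: has_derivative_at_withinI)
      show "onorm (\<lambda>h. h *\<^sub>R D 1 x) \<le> M"
        by (rule onorm_le) (use M[OF x] in \<open>auto simp: mult.commute[of M] mult_left_mono\<close>)
    qed (use that in auto)
    then show ?thesis by (simp add: D(1))
  qed
  show thesis
  proof (rule that)
    fix x y :: complex assume x: "x \<in> circle" and y: "y \<in> circle"
    \<comment> \<open>Taking the argument of the quotient selects the short arc from y to x. A
      difference of two arguments could be close to 2 pi for neighbouring points.\<close>
    define s where "s = Arg (x / y)"
    define t where "t = Arg y"
    have ne: "x \<noteq> 0" "y \<noteq> 0" using x y by auto
    have s: "\<bar>s\<bar> \<le> pi" "\<bar>t\<bar> \<le> pi" using Arg_bounded[of "x / y"] Arg_bounded[of y] by (auto simp: s_def t_def)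
    have ct: "cis t = y" using ne y by (simp add: t_def cis_Arg sgn_eq)
    have cs: "cis s = x / y" using ne x y by (simp add: s_def cis_Arg sgn_eq norm_divide)
    have cst: "cis (s + t) = x" using ct cs ne by (simp add: cis_mult[symmetric])
    have "cmod (f (cis (s + t)) - f (cis t)) \<le> M * \<bar>(s + t) - t\<bar>"
      by (rule lip) (use s pi_less_4 in auto)
    also have "\<dots> \<le> M * (4 * cmod (cis s - 1))"
      using abs_le_norm_cis_minus_one[OF s(1)] M0 by (simp add: mult_left_mono)
    also have "cmod (cis s - 1) = cmod (x - y)"
    proof -
      have "cis s - 1 = (x - y) / y" using cs ne by (simp add: field_simps)
      then show ?thesis using y by (simp add: norm_divide)
    qed
    finally show "cmod (f x - f y) \<le> (M * 4) * cmod (x - y)" by (simp add: cst ct mult.assoc)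
  qed
qed

lemma lipschitz_imp_continuous_circle:
  fixes f :: "complex \<Rightarrow> complex"
  assumes "\<And>x y. x \<in> circle \<Longrightarrow> y \<in> circle \<Longrightarrow> cmod (f x - f y) \<le> L * cmod (x - y)"
  shows "continuous_on circle f"
proof -
  have "(max L 0)-lipschitz_on circle f"
    by (rule lipschitz_onI) (auto simp: dist_norm intro!: order_trans[OF assms] mult_right_mono)
  then show ?thesis by (rule lipschitz_on_continuous_on)
qed

lemma smooth_on_circle_continuous:
  assumes "smooth_on_circle f"
  shows "continuous_on circle f"
  by (rule smooth_on_circle_lipschitz[OF assms]) (rule lipschitz_imp_continuous_circle)

lemma (in doubling_weight) wcoeff_smooth:
  assumes "smooth_on_circle f"
  shows "wcoeff \<Omega> f \<in> l2"
proof -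
  obtain L where "\<And>x y. x \<in> circle \<Longrightarrow> y \<in> circle \<Longrightarrow> cmod (f x - f y) \<le> L * cmod (x - y)"
    by (rule smooth_on_circle_lipschitz[OF assms]) (rule that)
  then show ?thesis by (rule wcoeff_lipschitz[OF smooth_on_circle_continuous[OF assms]])
qed

lemma smooth_compact_supportI:
  assumes "smooth_on_circle f" "open V" "E \<subseteq> V" "\<And>\<zeta>. \<zeta> \<in> circle \<Longrightarrow> \<zeta> \<in> V \<Longrightarrow> f \<zeta> = 0"
  shows "f \<in> smooth_compact_support (circle - E)"
proof -
  have "support_on circle f \<subseteq> circle - V" using assms(4) by (auto simp: support_on_def)
  moreover have "closed (circle - V)" using assms(2) by (intro closed_Diff) auto
  ultimately have c: "closure (support_on circle f) \<subseteq> circle - V" by (rule closure_minimal)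
  then have "bounded (closure (support_on circle f))"
    by (rule bounded_subset[rotated]) (auto intro: bounded_subset[OF bounded_sphere])
  then have "compact (closure (support_on circle f))" by (simp add: compact_eq_bounded_closed)
  then show ?thesis using assms(1,3) c by (auto simp: smooth_compact_support_def)
qed

lemma smooth_compact_support_vanishes:
  assumes "f \<in> smooth_compact_support (circle - E)" "\<zeta> \<in> circle" "\<zeta> \<in> E"
  shows "f \<zeta> = 0"
  using assms closure_subset[of "support_on circle f"] by (auto simp: smooth_compact_support_def support_on_def)

section \<open>Duality\<close>

lemma fourier_mult_fejer_tendsto:
  assumes f: "continuous_on circle f" and g: "continuous_on circle g"
  shows "(\<lambda>N. fourier (\<lambda>\<zeta>. f \<zeta> * fejer N g \<zeta>) n) \<longlonglongrightarrow> fourier (\<lambda>\<zeta>. f \<zeta> * g \<zeta>) n"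
proof (rule LIMSEQ_I)
  fix r :: real assume r: "0 < r"
  obtain M where M: "0 \<le> M" "\<And>w. w \<in> circle \<Longrightarrow> cmod (f w) \<le> M"
    by (rule continuous_on_circle_bounded[OF f]) (rule that)
  have "0 < r / (M + 1)" using r M by (intro divide_pos_pos) auto
  then obtain N0 where N0: "\<And>N z. N0 \<le> N \<Longrightarrow> z \<in> circle \<Longrightarrow> cmod (fejer N g z - g z) < r / (M + 1)"
    by (rule fejer_uniform[OF g]) (rule that)
  have "cmod (fourier (\<lambda>\<zeta>. f \<zeta> * fejer N g \<zeta>) n - fourier (\<lambda>\<zeta>. f \<zeta> * g \<zeta>) n) \<le> M * (r / (M + 1))" if N: "N0 \<le> N" for N
  proof (rule fourier_diff_bound)
    fix \<zeta> :: complex assume z: "\<zeta> \<in> circle"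
    have "cmod (f \<zeta> * fejer N g \<zeta> - f \<zeta> * g \<zeta>) = cmod (f \<zeta>) * cmod (fejer N g \<zeta> - g \<zeta>)"
      by (simp add: right_diff_distrib[symmetric] norm_mult)
    also have "\<dots> \<le> M * (r / (M + 1))"
      using M N0[OF N z] z by (intro mult_mono) auto
    finally show "cmod (f \<zeta> * fejer N g \<zeta> - f \<zeta> * g \<zeta>) \<le> M * (r / (M + 1))" .
  qed (intro continuous_intros f g continuous_fejer)+
  moreover have "M * (r / (M + 1)) < r" using M r by (simp add: field_simps)
  ultimately show "\<exists>no. \<forall>N\<ge>no. norm (fourier (\<lambda>\<zeta>. f \<zeta> * fejer N g \<zeta>) n - fourier (\<lambda>\<zeta>. f \<zeta> * g \<zeta>) n) < r"
    by (meson le_less_trans)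
qed

lemma fejer_eq_sum:
  "fejer N g \<zeta> = (\<Sum>i\<in>{..<N} \<times> {..<N}. (fourier g (int (fst i) - int (snd i)) / of_nat N) * \<zeta> powi (int (fst i) - int (snd i)))"
  by (simp add: fejer_def sum_divide_distrib sum.cartesian_product case_prod_beta)

lemma wcoeff_add:
  assumes "integrable circle_measure f" "integrable circle_measure g"
  shows "wcoeff \<Omega> (\<lambda>\<zeta>. f \<zeta> + g \<zeta>) = (\<lambda>n. wcoeff \<Omega> f n + wcoeff \<Omega> g n)"
  by (simp add: wcoeff_def[abs_def] fourier_add[OF assms] distrib_left)

lemma wcoeff_diff:
  assumes "integrable circle_measure f" "integrable circle_measure g"
  shows "wcoeff \<Omega> (\<lambda>\<zeta>. f \<zeta> - g \<zeta>) = (\<lambda>n. wcoeff \<Omega> f n - wcoeff \<Omega> g n)"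
  by (simp add: wcoeff_def[abs_def] fourier_diff[OF assms] right_diff_distrib)

lemma wcoeff_cmult: "wcoeff \<Omega> (\<lambda>\<zeta>. c * f \<zeta>) = (\<lambda>n. c * wcoeff \<Omega> f n)"
  by (simp add: wcoeff_def[abs_def] fourier_cmult mult.left_commute)

definition continuous_ell2 :: "(nat \<Rightarrow> real) \<Rightarrow> (complex \<Rightarrow> complex) set" where
  "continuous_ell2 \<Omega> = {f. continuous_on circle f \<and> wcoeff \<Omega> f \<in> l2}"

context doubling_weight
begin

abbreviation CH :: "(complex \<Rightarrow> complex) set" where "CH \<equiv> continuous_ell2 \<Omega>"

lemma CH_iff: "f \<in> CH \<longleftrightarrow> continuous_on circle f \<and> wcoeff \<Omega> f \<in> l2"
  by (simp add: continuous_ell2_def)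

lemma CH_integrable: "f \<in> CH \<Longrightarrow> integrable circle_measure f"
  by (simp add: CH_iff circle_integrable_continuous)

lemma CH_add: "f \<in> CH \<Longrightarrow> g \<in> CH \<Longrightarrow> (\<lambda>\<zeta>. f \<zeta> + g \<zeta>) \<in> CH"
  by (simp add: CH_iff wcoeff_add circle_integrable_continuous continuous_on_add l2_add)

lemma CH_diff: "f \<in> CH \<Longrightarrow> g \<in> CH \<Longrightarrow> (\<lambda>\<zeta>. f \<zeta> - g \<zeta>) \<in> CH"
  by (simp add: CH_iff wcoeff_diff circle_integrable_continuous continuous_on_diff l2_diff)

lemma CH_cmult: "f \<in> CH \<Longrightarrow> (\<lambda>\<zeta>. c * f \<zeta>) \<in> CH"
  by (simp add: CH_iff wcoeff_cmult continuous_on_mult l2_scale)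

lemma CH_smooth: "smooth_on_circle f \<Longrightarrow> f \<in> CH"
  by (simp add: CH_iff smooth_on_circle_continuous wcoeff_smooth)

lemma CH_sum: "(\<And>i. i \<in> I \<Longrightarrow> f i \<in> CH) \<Longrightarrow> (\<lambda>\<zeta>. \<Sum>i\<in>I. f i \<zeta>) \<in> CH"
  by (induction I rule: infinite_finite_induct) (auto intro: CH_add CH_smooth smooth_on_circle_const)

lemma CH_mult:
  assumes "f \<in> CH" "g \<in> CH"
  shows "(\<lambda>\<zeta>. f \<zeta> * g \<zeta>) \<in> CH"
proof -
  have fg: "continuous_on circle f" "wcoeff \<Omega> f \<in> l2" "continuous_on circle g" "wcoeff \<Omega> g \<in> l2"
    using assms by (auto simp: CH_iff)
  obtain Mf where Mf: "\<And>w. w \<in> circle \<Longrightarrow> cmod (f w) \<le> Mf"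
    by (rule continuous_on_circle_bounded[OF fg(1)]) (rule that)
  obtain Mg where Mg: "\<And>w. w \<in> circle \<Longrightarrow> cmod (g w) \<le> Mg"
    by (rule continuous_on_circle_bounded[OF fg(3)]) (rule that)
  have "wcoeff \<Omega> (\<lambda>\<zeta>. f \<zeta> * g \<zeta>) \<in> l2" by (rule wcoeff_mult(1)[OF fg Mf Mg])
  then show ?thesis using fg by (simp add: CH_iff continuous_on_mult)
qed

section \<open>Passage between \<open>ell2\<close> and weighted coefficient sequences\<close>

lemma ell2_iff:
  "f \<in> ell2 \<Omega> \<longleftrightarrow> f \<in> borel_measurable circle_measure \<and> integrable circle_measure (\<lambda>\<zeta>. (cmod (f \<zeta>))\<^sup>2) \<and> wcoeff \<Omega> f \<in> l2"
  unfolding ell2_def l2_def mem_Collect_eq norm_wcoeff_sq by (simp add: mult.commute)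

lemma ell2_norm_eq: "ell2_norm \<Omega> f = sqrt (nsq (wcoeff \<Omega> f))"
  unfolding ell2_norm_def nsq_def norm_wcoeff_sq by (simp add: mult.commute)

lemma ell2_norm_less: "0 < e \<Longrightarrow> ell2_norm \<Omega> f < e \<longleftrightarrow> nsq (wcoeff \<Omega> f) < e\<^sup>2"
  unfolding ell2_norm_eq by (metis abs_of_pos real_sqrt_abs real_sqrt_less_iff)

lemma ell2_integrable:
  assumes "f \<in> ell2 \<Omega>" shows "integrable circle_measure f"
proof (rule Bochner_Integration.integrable_bound)
  show "integrable circle_measure (\<lambda>\<zeta>. 1 + (cmod (f \<zeta>))\<^sup>2)" "f \<in> borel_measurable circle_measure"
    using assms by (auto simp: ell2_iff)
  have "x \<le> 1 + x\<^sup>2" for x :: real using zero_le_power2[of "x - 1 / 2"] by (simp add: power2_diff power_divide)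
  then show "AE \<zeta> in circle_measure. norm (f \<zeta>) \<le> norm (1 + (cmod (f \<zeta>))\<^sup>2)" by simp
qed

lemma CH_ell2: "f \<in> CH \<Longrightarrow> f \<in> ell2 \<Omega>"
  unfolding CH_iff ell2_iff
  by (auto intro!: circle_measurable_continuous circle_integrable_continuous continuous_intros)

lemma nsq_wcoeff_diff_trans:
  assumes "integrable circle_measure f" "integrable circle_measure g" "integrable circle_measure h"
    "wcoeff \<Omega> f \<in> l2" "wcoeff \<Omega> g \<in> l2" "wcoeff \<Omega> h \<in> l2"
  shows "nsq (wcoeff \<Omega> (\<lambda>\<zeta>. f \<zeta> - h \<zeta>)) \<le> 2 * nsq (wcoeff \<Omega> (\<lambda>\<zeta>. f \<zeta> - g \<zeta>)) + 2 * nsq (wcoeff \<Omega> (\<lambda>\<zeta>. g \<zeta> - h \<zeta>))"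
  using l2_add(2)[OF l2_diff(1)[OF assms(4,5)] l2_diff(1)[OF assms(5,6)], of 1]
  by (simp add: wcoeff_diff assms)

text \<open>For u in \<open>l2\<close> these are the bounded functionals of the weighted space. The
  pairing is bilinear, so it depends complex-linearly on f and can be an integral against a
  measure.\<close>

definition pair :: "(int \<Rightarrow> complex) \<Rightarrow> (complex \<Rightarrow> complex) \<Rightarrow> complex" where
  "pair u f = (\<Sum>\<^sub>\<infinity>n. u n * wcoeff \<Omega> f n)"

lemma pair_add: "u \<in> l2 \<Longrightarrow> f \<in> CH \<Longrightarrow> g \<in> CH \<Longrightarrow> pair u (\<lambda>\<zeta>. f \<zeta> + g \<zeta>) = pair u f + pair u g"
  unfolding pair_def CH_iff
  by (simp add: wcoeff_add circle_integrable_continuous distrib_left infsum_add pairing_summable')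

lemma pair_cmult: "pair u (\<lambda>\<zeta>. c * f \<zeta>) = c * pair u f"
  unfolding pair_def wcoeff_cmult by (simp add: mult.left_commute[of _ c] infsum_cmult_right')

lemma pair_diff: "u \<in> l2 \<Longrightarrow> f \<in> CH \<Longrightarrow> g \<in> CH \<Longrightarrow> pair u (\<lambda>\<zeta>. f \<zeta> - g \<zeta>) = pair u f - pair u g"
  using pair_add[of u f "\<lambda>\<zeta>. (-1) * g \<zeta>"] CH_cmult[of g "-1"] pair_cmult[of u "-1" g] by simp

lemma pair_sum:
  assumes "u \<in> l2" "\<And>i. i \<in> I \<Longrightarrow> f i \<in> CH"
  shows "pair u (\<lambda>\<zeta>. \<Sum>i\<in>I. f i \<zeta>) = (\<Sum>i\<in>I. pair u (f i))"
proof -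
  have "pair u (\<lambda>\<zeta>. 0) = 0" using pair_cmult[of u 0 "\<lambda>_. 0"] by simp
  then show ?thesis using assms(2)
    by (induction I rule: infinite_finite_induct) (auto simp: pair_add assms(1) CH_sum)
qed

lemma pair_powi: "pair u (\<lambda>\<zeta>. \<zeta> powi k) = u k * of_real (sqrt (\<Omega> (nat \<bar>k\<bar>)))"
proof -
  have "pair u (\<lambda>\<zeta>. \<zeta> powi k) = (\<Sum>\<^sub>\<infinity>n\<in>{k}. u n * wcoeff \<Omega> (\<lambda>\<zeta>. \<zeta> powi k) n)"
    unfolding pair_def by (rule infsum_cong_neutral) (auto simp: wcoeff_def fourier_powi)
  then show ?thesis by (simp add: wcoeff_def fourier_powi)
qed

lemma pair_fejer:
  assumes "u \<in> l2"
  shows "pair u (fejer N g) = (\<Sum>i\<in>{..<N} \<times> {..<N}. (fourier g (int (fst i) - int (snd i)) / of_nat N)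
    * (u (int (fst i) - int (snd i)) * of_real (sqrt (\<Omega> (nat \<bar>int (fst i) - int (snd i)\<bar>)))))"
  unfolding fejer_eq_sum[abs_def]
  by (simp only: pair_sum[OF assms] CH_cmult CH_smooth smooth_on_circle_powi pair_cmult pair_powi)

lemma pair_bound:
  assumes "u \<in> l2" "f \<in> CH" "0 < t"
  shows "cmod (pair u f) \<le> (t * nsq u + nsq (wcoeff \<Omega> f) / t) / 2"
  unfolding pair_def by (rule pairing_bound) (use assms in \<open>auto simp: CH_iff\<close>)

text \<open>The products stay bounded in norm, because Fejer means are bounded by g both in sup norm
  and in the weighted norm. Their coefficients converge by uniform convergence, so weak convergence
  follows.\<close>

lemma pair_mult_fejer_tendsto:
  assumes u: "u \<in> l2" and f: "f \<in> CH" and g: "g \<in> CH"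
  shows "(\<lambda>N. pair u (\<lambda>\<zeta>. f \<zeta> * fejer N g \<zeta>)) \<longlonglongrightarrow> pair u (\<lambda>\<zeta>. f \<zeta> * g \<zeta>)"
proof -
  have fg: "continuous_on circle f" "wcoeff \<Omega> f \<in> l2" "continuous_on circle g" "wcoeff \<Omega> g \<in> l2"
    using f g by (auto simp: CH_iff)
  obtain Mf where Mf: "\<And>w. w \<in> circle \<Longrightarrow> cmod (f w) \<le> Mf"
    by (rule continuous_on_circle_bounded[OF fg(1)]) (rule that)
  obtain Mg where Mg: "0 \<le> Mg" "\<And>w. w \<in> circle \<Longrightarrow> cmod (g w) \<le> Mg"
    by (rule continuous_on_circle_bounded[OF fg(3)]) (rule that)
  have Mg': "cmod (fejer N g w) \<le> Mg" if "w \<in> circle" for N w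
    by (rule fejer_bound[OF fg(3) Mg(2,1)]) (use that in auto)
  note m = wcoeff_mult[OF fg(1,2) continuous_fejer wcoeff_fejer(1)[OF fg(4)] Mf Mg']
  have "(\<lambda>N. \<Sum>\<^sub>\<infinity>n. wcoeff \<Omega> (\<lambda>\<zeta>. f \<zeta> * fejer N g \<zeta>) n * u n) \<longlonglongrightarrow> (\<Sum>\<^sub>\<infinity>n. wcoeff \<Omega> (\<lambda>\<zeta>. f \<zeta> * g \<zeta>) n * u n)"
  proof (rule weak_convergence[OF _ _ _ u])
    show "wcoeff \<Omega> (\<lambda>\<zeta>. f \<zeta> * fejer N g \<zeta>) \<in> l2" for N by (rule m(1))
    show "nsq (wcoeff \<Omega> (\<lambda>\<zeta>. f \<zeta> * fejer N g \<zeta>))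
        \<le> \<Omega> 2 * (Mf * Mg)\<^sup>2 + C * (2 * Mg\<^sup>2 * nsq (wcoeff \<Omega> f) + 2 * Mf\<^sup>2 * nsq (wcoeff \<Omega> g))" for N
      by (rule order_trans[OF m(2)], assumption, assumption)
        (intro add_left_mono mult_left_mono wcoeff_fejer(2) fg(4) C_nonneg, simp)
    show "(\<lambda>N. wcoeff \<Omega> (\<lambda>\<zeta>. f \<zeta> * fejer N g \<zeta>) n) \<longlonglongrightarrow> wcoeff \<Omega> (\<lambda>\<zeta>. f \<zeta> * g \<zeta>) n" for n
      unfolding wcoeff_def by (intro tendsto_intros fourier_mult_fejer_tendsto fg)
  qed
  then show ?thesis by (simp add: pair_def mult.commute)
qed

lemma pair_fejer_tendsto:
  assumes "u \<in> l2" "g \<in> CH"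
  shows "(\<lambda>N. pair u (fejer N g)) \<longlonglongrightarrow> pair u g"
  using pair_mult_fejer_tendsto[OF assms(1) CH_smooth[OF smooth_on_circle_const[of 1]] assms(2)] by simp

lemma separation_CH:
  assumes K: "K \<subseteq> CH" "K \<noteq> {}"
    and conv: "\<And>x y t. x \<in> K \<Longrightarrow> y \<in> K \<Longrightarrow> 0 \<le> t \<Longrightarrow> t \<le> 1 \<Longrightarrow>
      (\<lambda>\<zeta>. of_real (1 - t) * x \<zeta> + of_real t * y \<zeta>) \<in> K"
    and d: "\<And>x. x \<in> K \<Longrightarrow> d \<le> nsq (wcoeff \<Omega> x)"
  obtains u where "u \<in> l2" "\<And>x. x \<in> K \<Longrightarrow> d \<le> Re (pair u x)"
proof (rule l2_separation[of "wcoeff \<Omega> ` K" d])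
  show "wcoeff \<Omega> ` K \<subseteq> l2" using K(1) by (auto simp: CH_iff)
  show "wcoeff \<Omega> ` K \<noteq> {}" using K(2) by simp
  show "d \<le> nsq x" if "x \<in> wcoeff \<Omega> ` K" for x using that d by auto
  fix x y and t :: real assume x: "x \<in> wcoeff \<Omega> ` K" and y: "y \<in> wcoeff \<Omega> ` K" and t: "0 \<le> t" "t \<le> 1"
  obtain f g where f: "f \<in> K" "x = wcoeff \<Omega> f" and g: "g \<in> K" "y = wcoeff \<Omega> g" using x y by blast
  have fg: "f \<in> CH" "g \<in> CH" using f g K(1) by auto
  have "(\<lambda>n. of_real (1 - t) * x n + of_real t * y n) = wcoeff \<Omega> (\<lambda>\<zeta>. of_real (1 - t) * f \<zeta> + of_real t * g \<zeta>)"
    by (simp only: f(2) g(2) wcoeff_add wcoeff_cmult CH_integrable CH_cmult fg)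
  then show "(\<lambda>n. of_real (1 - t) * x n + of_real t * y n) \<in> wcoeff \<Omega> ` K"
    using conv[OF f(1) g(1) t] by simp
next
  fix u assume "u \<in> l2" and u: "\<And>x. x \<in> wcoeff \<Omega> ` K \<Longrightarrow> d \<le> Re (\<Sum>\<^sub>\<infinity>n. u n * x n)"
  then show thesis using that[of u] by (auto simp: pair_def)
qed

text \<open>The distance form of Hahn-Banach: separate the affine set \<phi> - M from 0. A lower
  bound for the real part on an affine set forces the functional to vanish on its direction space
  M.\<close>

lemma annihilator:
  assumes M: "M \<subseteq> CH" "(\<lambda>_. 0) \<in> M"
    and lin: "\<And>x y a b. x \<in> M \<Longrightarrow> y \<in> M \<Longrightarrow> (\<lambda>\<zeta>. a * x \<zeta> + b * y \<zeta>) \<in> M"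
    and \<phi>: "\<phi> \<in> CH" and d: "0 < d" "\<And>m. m \<in> M \<Longrightarrow> d \<le> nsq (wcoeff \<Omega> (\<lambda>\<zeta>. \<phi> \<zeta> - m \<zeta>))"
  obtains u where "u \<in> l2" "pair u \<phi> \<noteq> 0" "\<And>m. m \<in> M \<Longrightarrow> pair u m = 0"
proof -
  let ?K = "(\<lambda>m \<zeta>. \<phi> \<zeta> - m \<zeta>) ` M"
  obtain u where u: "u \<in> l2" "\<And>x. x \<in> ?K \<Longrightarrow> d \<le> Re (pair u x)"
  proof (rule separation_CH[of ?K d])
    show "?K \<subseteq> CH" using M(1) \<phi> by (auto intro: CH_diff)
    show "?K \<noteq> {}" using M(2) by auto
    show "d \<le> nsq (wcoeff \<Omega> x)" if "x \<in> ?K" for x using that d by auto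
    fix x y and t :: real assume x: "x \<in> ?K" and y: "y \<in> ?K"
    obtain m k where m: "m \<in> M" "x = (\<lambda>\<zeta>. \<phi> \<zeta> - m \<zeta>)" and k: "k \<in> M" "y = (\<lambda>\<zeta>. \<phi> \<zeta> - k \<zeta>)" using x y by blast
    have "(\<lambda>\<zeta>. of_real (1 - t) * x \<zeta> + of_real t * y \<zeta>) = (\<lambda>\<zeta>. \<phi> \<zeta> - (of_real (1 - t) * m \<zeta> + of_real t * k \<zeta>))"
      by (simp add: m k algebra_simps)
    then show "(\<lambda>\<zeta>. of_real (1 - t) * x \<zeta> + of_real t * y \<zeta>) \<in> ?K"
      using lin[OF m(1) k(1), of "of_real (1 - t)" "of_real t"] by simp
  qed (rule that)
  have zero: "pair u m = 0" if m: "m \<in> M" for m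
  proof (rule ccontr)
    assume ne: "pair u m \<noteq> 0"
    \<comment> \<open>Scaled so that subtracting c m cancels the real part of the value at \<phi>
      exactly, which contradicts the lower bound d > 0.\<close>
    define r where "r = Re (pair u \<phi>) / (cmod (pair u m))\<^sup>2"
    define c where "c = of_real r * cnj (pair u m)"
    have "(\<lambda>\<zeta>. c * m \<zeta> + 0 * m \<zeta>) \<in> M" by (rule lin[OF m m])
    then have cm: "(\<lambda>\<zeta>. c * m \<zeta>) \<in> M" by simp
    then have "d \<le> Re (pair u (\<lambda>\<zeta>. \<phi> \<zeta> - c * m \<zeta>))" by (intro u) auto
    also have "pair u (\<lambda>\<zeta>. \<phi> \<zeta> - c * m \<zeta>) = pair u \<phi> - c * pair u m"
      using cm M(1) by (subst pair_diff) (auto simp: u \<phi> pair_cmult)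
    also have "c * pair u m = of_real (r * (cmod (pair u m))\<^sup>2)"
      unfolding c_def of_real_mult complex_norm_square by simp
    also have "r * (cmod (pair u m))\<^sup>2 = Re (pair u \<phi>)" using ne by (simp add: r_def)
    finally show False using d(1) by simp
  qed
  have "d \<le> Re (pair u (\<lambda>\<zeta>. \<phi> \<zeta> - 0))" using u(2)[OF imageI[OF M(2)]] by simp
  then have "pair u \<phi> \<noteq> 0" using d(1) by auto
  then show thesis using that u(1) zero by blast
qed

section \<open>Multiplication by a fixed trigonometric polynomial\<close>

lemma nsq_wcoeff_shift_le:
  assumes "wcoeff \<Omega> w \<in> l2"
  shows "nsq (wcoeff \<Omega> (\<lambda>\<zeta>. w \<zeta> * \<zeta> powi m)) \<le> max (q ^ nat \<bar>m\<bar>) (\<Omega> (nat \<bar>m\<bar>) / \<Omega> 0) * nsq (wcoeff \<Omega> w)"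
proof (rule l2_bound(2))
  \<comment> \<open>Doubling compares \<Omega> at n and n - m unless n = m: frequency 0 cannot be
    doubled up to m, and the second entry treats this one term.\<close>
  let ?K = "max (q ^ nat \<bar>m\<bar>) (\<Omega> (nat \<bar>m\<bar>) / \<Omega> 0)"
  have K0: "0 \<le> ?K" using q_ge by (simp add: le_max_iff_disj)
  have le: "\<Omega> (nat \<bar>n\<bar>) \<le> ?K * \<Omega> (nat \<bar>n - m\<bar>)" for n
  proof (cases "n = m")
    case True
    have "\<Omega> (nat \<bar>m\<bar>) = (\<Omega> (nat \<bar>m\<bar>) / \<Omega> 0) * \<Omega> 0" using pos[of 0] by simp
    also have "\<dots> \<le> ?K * \<Omega> 0" using pos[of 0] by (intro mult_right_mono) auto
    finally show ?thesis using True by simp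
  next
    case False
    define a where "a = nat \<bar>n - m\<bar>"
    define k where "k = nat \<bar>m\<bar>"
    have "1 \<le> a" using False by (simp add: a_def)
    \<comment> \<open>As a \<ge> 1, the shift costs at most a factor: a + k \<le> (k + 1) a \<le>
      2^k a.\<close>
    have "nat \<bar>n\<bar> \<le> a + k" by (simp add: a_def k_def)
    also have "\<dots> \<le> a + k * a" using \<open>1 \<le> a\<close> by simp
    also have "\<dots> = Suc k * a" by simp
    also have "\<dots> \<le> 2 ^ k * a" using less_exp[of k] by (intro mult_right_mono) (auto simp: Suc_le_eq)
    finally have "\<Omega> (nat \<bar>n\<bar>) \<le> \<Omega> (2 ^ k * a)" by (rule mono)
    also have "\<dots> \<le> q ^ k * \<Omega> a" by (rule doubling_power)
    also have "\<dots> \<le> ?K * \<Omega> a" using pos[of a] by (intro mult_right_mono) (auto simp: k_def)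
    finally show ?thesis by (simp add: a_def)
  qed
  fix F :: "int set" assume F: "finite F"
  have "(\<Sum>n\<in>F. (cmod (wcoeff \<Omega> (\<lambda>\<zeta>. w \<zeta> * \<zeta> powi m) n))\<^sup>2)
      \<le> (\<Sum>n\<in>F. ?K * (cmod (wcoeff \<Omega> w (n - m)))\<^sup>2)"
    unfolding norm_wcoeff_sq fourier_shift mult.assoc[symmetric] by (intro sum_mono mult_right_mono le) auto
  also have "\<dots> = ?K * (\<Sum>n\<in>(\<lambda>n. n - m) ` F. (cmod (wcoeff \<Omega> w n))\<^sup>2)"
    by (subst sum.reindex) (auto simp: sum_distrib_left inj_on_def)
  also have "\<dots> \<le> ?K * nsq (wcoeff \<Omega> w)"
    using F by (intro mult_left_mono sum_le_nsq assms K0) auto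
  finally show "(\<Sum>n\<in>F. (cmod (wcoeff \<Omega> (\<lambda>\<zeta>. w \<zeta> * \<zeta> powi m) n))\<^sup>2) \<le> ?K * nsq (wcoeff \<Omega> w)" .
qed

text \<open>Unlike the general product estimate, this bound involves no sup norm of w. It is
  therefore applicable when w is known to be small only in the weighted norm.\<close>

lemma nsq_wcoeff_trig_mult_le:
  assumes "finite I"
  shows "\<exists>K\<ge>0. \<forall>w\<in>CH. nsq (wcoeff \<Omega> (\<lambda>\<zeta>. \<Sum>n\<in>I. c n * (w \<zeta> * \<zeta> powi n))) \<le> K * nsq (wcoeff \<Omega> w)"
  using assms
proof (induction I rule: finite_induct)
  case empty
  have "wcoeff \<Omega> (\<lambda>\<zeta>. 0) = (\<lambda>n. 0)" using wcoeff_cmult[of \<Omega> 0 "\<lambda>_. 0"] by simp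
  then show ?case by (intro exI[of _ 0]) (simp add: nsq_def)
next
  case (insert k I)
  then obtain K where K: "0 \<le> K" "\<And>w. w \<in> CH \<Longrightarrow> nsq (wcoeff \<Omega> (\<lambda>\<zeta>. \<Sum>n\<in>I. c n * (w \<zeta> * \<zeta> powi n))) \<le> K * nsq (wcoeff \<Omega> w)"
    by blast
  define L where "L = (cmod (c k))\<^sup>2 * max (q ^ nat \<bar>k\<bar>) (\<Omega> (nat \<bar>k\<bar>) / \<Omega> 0)"
  have L0: "0 \<le> L" using q_ge by (simp add: L_def le_max_iff_disj)
  have "nsq (wcoeff \<Omega> (\<lambda>\<zeta>. \<Sum>n\<in>insert k I. c n * (w \<zeta> * \<zeta> powi n))) \<le> (2 * L + 2 * K) * nsq (wcoeff \<Omega> w)"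
    if w: "w \<in> CH" for w
  proof -
    have t: "(\<lambda>\<zeta>. w \<zeta> * \<zeta> powi n) \<in> CH" for n by (intro CH_mult w CH_smooth smooth_on_circle_powi)
    then have 1: "(\<lambda>\<zeta>. c k * (w \<zeta> * \<zeta> powi k)) \<in> CH" "(\<lambda>\<zeta>. \<Sum>n\<in>I. c n * (w \<zeta> * \<zeta> powi n)) \<in> CH"
      by - (intro CH_cmult CH_sum; assumption)+
    have "nsq (wcoeff \<Omega> (\<lambda>\<zeta>. \<Sum>n\<in>insert k I. c n * (w \<zeta> * \<zeta> powi n)))
        \<le> 2 * nsq (wcoeff \<Omega> (\<lambda>\<zeta>. c k * (w \<zeta> * \<zeta> powi k))) + 2 * nsq (wcoeff \<Omega> (\<lambda>\<zeta>. \<Sum>n\<in>I. c n * (w \<zeta> * \<zeta> powi n)))"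
      using insert.hyps l2_add(2)[of "wcoeff \<Omega> (\<lambda>\<zeta>. c k * (w \<zeta> * \<zeta> powi k))" "wcoeff \<Omega> (\<lambda>\<zeta>. \<Sum>n\<in>I. c n * (w \<zeta> * \<zeta> powi n))" 1] 1
      by (simp add: wcoeff_add[OF CH_integrable[OF 1(1)] CH_integrable[OF 1(2)]] CH_iff)
    also have "nsq (wcoeff \<Omega> (\<lambda>\<zeta>. c k * (w \<zeta> * \<zeta> powi k))) \<le> L * nsq (wcoeff \<Omega> w)"
      using nsq_wcoeff_shift_le[of w k] w t[of k]
      by (simp add: wcoeff_cmult l2_scale L_def CH_iff mult.assoc mult_left_mono)
    also have "nsq (wcoeff \<Omega> (\<lambda>\<zeta>. \<Sum>n\<in>I. c n * (w \<zeta> * \<zeta> powi n))) \<le> K * nsq (wcoeff \<Omega> w)" by (rule K(2)[OF w])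
    finally show ?thesis by (simp add: distrib_right mult.assoc)
  qed
  then show ?case using K(1) L0 by (intro exI[of _ "2 * L + 2 * K"]) auto
qed

end

section \<open>Measures of finite energy\<close>

text \<open>Helly selection is available on the line, so the densities are lifted to an interval of
  angles, where tightness is automatic, and the limit is pushed forward by \<open>cis\<close>.
  Continuous functions on the circle lift to bounded continuous functions on the whole line, so
  gluing the endpoints causes no trouble.\<close>

lemma circle_density_weak_limit:
  fixes d :: "nat \<Rightarrow> complex \<Rightarrow> real"
  assumes cont: "\<And>N. continuous_on circle (d N)"
    and nonneg: "\<And>N \<zeta>. \<zeta> \<in> circle \<Longrightarrow> 0 \<le> d N \<zeta>"
    and one: "\<And>N. (LINT \<zeta>|circle_measure. d N \<zeta>) = 1"
  obtains r \<mu> where "strict_mono (r :: nat \<Rightarrow> nat)" "prob_space \<mu>" "sets \<mu> = sets circle_borel"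
    "\<And>f :: complex \<Rightarrow> complex. continuous_on circle f \<Longrightarrow>
      (\<lambda>k. LINT \<zeta>|circle_measure. d (r k) \<zeta> *\<^sub>R f \<zeta>) \<longlonglongrightarrow> (LINT \<zeta>|\<mu>. f \<zeta>)"
proof -
  define \<rho> where "\<rho> = uniform_measure lborel {0..2 * pi}"
  define \<nu> where "\<nu> N = density \<rho> (\<lambda>\<theta>. ennreal (d N (cis \<theta>)))" for N
  have s\<rho>: "sets \<rho> = sets borel" by (simp add: \<rho>_def)
  have cm: "circle_measure = distr \<rho> circle_borel cis" by (simp add: circle_measure_def \<rho>_def)
  have cis\<rho>: "cis \<in> \<rho> \<rightarrow>\<^sub>M circle_borel" using cis_measurable s\<rho> by (simp cong: measurable_cong_sets)
  have cont_cis: "continuous_on UNIV (\<lambda>\<theta>. f (cis \<theta>))" if "continuous_on circle f" for f :: "complex \<Rightarrow> 'b::topological_space"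
    by (rule continuous_on_compose2[OF that]) (auto intro!: continuous_intros)
  have meas_cis: "(\<lambda>\<theta>. f (cis \<theta>)) \<in> borel_measurable \<rho>" if "continuous_on circle f" for f :: "complex \<Rightarrow> 'b::topological_space"
    using borel_measurable_continuous_onI[OF cont_cis[OF that]] s\<rho> by (simp cong: measurable_cong_sets)
  have meas: "f \<in> borel_measurable circle_borel" if "continuous_on circle f" for f :: "complex \<Rightarrow> 'b::topological_space"
    by (rule borel_measurable_continuous_on_restrict[OF that])
  have int: "integral\<^sup>L (\<nu> N) (\<lambda>\<theta>. f (cis \<theta>)) = (LINT \<zeta>|circle_measure. d N \<zeta> *\<^sub>R f \<zeta>)"
    if f: "continuous_on circle f" for f :: "complex \<Rightarrow> complex" and N
  proof -
    have "integral\<^sup>L (\<nu> N) (\<lambda>\<theta>. f (cis \<theta>)) = (LINT \<theta>|\<rho>. d N (cis \<theta>) *\<^sub>R f (cis \<theta>))"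
      unfolding \<nu>_def by (rule integral_density) (auto intro!: meas_cis f cont nonneg)
    also have "\<dots> = (LINT \<zeta>|circle_measure. d N \<zeta> *\<^sub>R f \<zeta>)"
      unfolding cm by (rule integral_distr[symmetric]) (auto intro!: cis\<rho> meas continuous_intros f cont)
    finally show ?thesis .
  qed
  have \<nu>: "real_distribution (\<nu> N)" for N
  proof -
    have "integrable \<rho> (\<lambda>\<theta>. d N (cis \<theta>))"
      using circle_integrable_continuous[OF cont[of N]] unfolding cm
      by (subst (asm) integrable_distr_eq) (auto intro: cis\<rho> meas cont)
    then have "(\<integral>\<^sup>+\<theta>. ennreal (d N (cis \<theta>)) \<partial>\<rho>) = ennreal (LINT \<theta>|\<rho>. d N (cis \<theta>))"
      by (intro nn_integral_eq_integral) (auto intro!: AE_I2 nonneg)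
    also have "(LINT \<theta>|\<rho>. d N (cis \<theta>)) = (LINT \<zeta>|circle_measure. d N \<zeta>)"
      unfolding cm by (rule integral_distr[symmetric]) (auto intro!: cis\<rho> meas cont)
    finally have e: "(\<integral>\<^sup>+\<theta>. ennreal (d N (cis \<theta>)) \<partial>\<rho>) = 1" by (simp add: one)
    have "prob_space (\<nu> N)"
      by (rule prob_spaceI) (use e meas_cis[OF cont[of N]] in \<open>simp add: \<nu>_def emeasure_density\<close>)
    then show ?thesis
      unfolding real_distribution_def real_distribution_axioms_def by (simp add: \<nu>_def s\<rho>)
  qed
  have tight: "tight \<nu>"
    unfolding tight_def
  proof (intro conjI allI impI \<nu>)
    fix e :: real assume e: "0 < e"
    \<comment> \<open>One half-open interval containing [0, 2 pi] serves for all N and e, since it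
      has full measure.\<close>
    have "measure (\<nu> N) {-1<..8} > 1 - e" for N
    proof -
      interpret real_distribution "\<nu> N" by (rule \<nu>)
      have "AE \<theta> in \<rho>. \<theta> \<in> {-1<..8}"
        unfolding \<rho>_def by (rule AE_uniform_measureI) (use pi_less_4 pi_gt3 in \<open>auto intro!: AE_I2\<close>)
      then have "AE \<theta> in \<nu> N. \<theta> \<in> {-1<..8}"
        unfolding \<nu>_def using meas_cis[OF cont[of N]] by (subst AE_density) auto
      then have "prob {-1<..8} = 1" by (subst prob_eq_1) auto
      then show ?thesis using e by simp
    qed
    then show "\<exists>a b. a < b \<and> (\<forall>N. measure (\<nu> N) {a<..b} > 1 - e)"
      by (intro exI[of _ "-1"] exI[of _ 8]) auto
  qed
  obtain r M where r: "strict_mono (r :: nat \<Rightarrow> nat)" and M: "real_distribution M" and wc: "weak_conv_m (\<nu> \<circ> id \<circ> r) M"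
    using tight_imp_convergent_subsubsequence[OF tight, of id] by (auto simp: strict_mono_id)
  interpret M: real_distribution M by (rule M)
  define \<mu> where "\<mu> = distr M circle_borel cis"
  have cisM: "cis \<in> M \<rightarrow>\<^sub>M circle_borel" using cis_measurable by (simp cong: measurable_cong_sets)
  show thesis
  proof (rule that[OF r])
    show "prob_space \<mu>" unfolding \<mu>_def by (rule M.prob_space_distr[OF cisM])
    show "sets \<mu> = sets circle_borel" by (simp add: \<mu>_def)
    fix f :: "complex \<Rightarrow> complex" assume f: "continuous_on circle f"
    obtain B where B: "\<And>\<zeta>. \<zeta> \<in> circle \<Longrightarrow> cmod (f \<zeta>) \<le> B"
      by (rule continuous_on_circle_bounded[OF f]) (rule that)
    have "(\<lambda>k. integral\<^sup>L ((\<nu> \<circ> id \<circ> r) k) (\<lambda>\<theta>. f (cis \<theta>))) \<longlonglongrightarrow> integral\<^sup>L M (\<lambda>\<theta>. f (cis \<theta>))"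
    proof (rule weak_conv_imp_integral_bdd_continuous_conv[OF _ M wc])
      show "real_distribution ((\<nu> \<circ> id \<circ> r) n)" for n by (simp add: \<nu>)
      show "isCont (\<lambda>\<theta>. f (cis \<theta>)) x" for x
        using cont_cis[OF f] by (simp add: continuous_on_eq_continuous_at)
      show "norm (f (cis x)) \<le> B" for x by (rule B) simp
    qed
    moreover have "integral\<^sup>L M (\<lambda>\<theta>. f (cis \<theta>)) = (LINT \<zeta>|\<mu>. f \<zeta>)"
      unfolding \<mu>_def by (rule integral_distr[symmetric, OF cisM meas[OF f]])
    ultimately show "(\<lambda>k. LINT \<zeta>|circle_measure. d (r k) \<zeta> *\<^sub>R f \<zeta>) \<longlonglongrightarrow> (LINT \<zeta>|\<mu>. f \<zeta>)"
      by (simp add: int[OF f])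
  qed
qed

section \<open>Energy and coefficient sequences\<close>

lemma l2_reflect:
  assumes "x \<in> l2" shows "(\<lambda>n::int. x (- n)) \<in> l2"
proof (rule l2_bound(1))
  fix F :: "int set" assume F: "finite F"
  have "(\<Sum>n\<in>F. (cmod (x (- n)))\<^sup>2) = (\<Sum>n\<in>uminus ` F. (cmod (x n))\<^sup>2)"
    by (subst sum.reindex) auto
  also have "\<dots> \<le> nsq x" using F by (intro sum_le_nsq assms) auto
  finally show "(\<Sum>n\<in>F. (cmod (x (- n)))\<^sup>2) \<le> nsq x" .
qed

lemma infsum_ennreal_finite_iff:
  fixes x :: "'a \<Rightarrow> complex"
  shows "(\<Sum>\<^sub>\<infinity>n. ennreal ((cmod (x n))\<^sup>2)) < \<infinity> \<longleftrightarrow> x \<in> l2"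
proof -
  have SUP: "(\<Sum>\<^sub>\<infinity>n. ennreal ((cmod (x n))\<^sup>2)) = (SUP F\<in>{F. finite F \<and> F \<subseteq> UNIV}. \<Sum>n\<in>F. ennreal ((cmod (x n))\<^sup>2))"
    by (rule nonneg_infsum_complete) simp
  show ?thesis
  proof
    assume fin: "(\<Sum>\<^sub>\<infinity>n. ennreal ((cmod (x n))\<^sup>2)) < \<infinity>"
    show "x \<in> l2"
    proof (rule l2_bound(1))
      fix F :: "'a set" assume F: "finite F"
      have "(\<Sum>n\<in>F. ennreal ((cmod (x n))\<^sup>2)) \<le> (\<Sum>\<^sub>\<infinity>n. ennreal ((cmod (x n))\<^sup>2))"
        unfolding SUP by (rule SUP_upper) (simp add: F)
      then have "ennreal (\<Sum>n\<in>F. (cmod (x n))\<^sup>2) \<le> ennreal (enn2real (\<Sum>\<^sub>\<infinity>n. ennreal ((cmod (x n))\<^sup>2)))"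
        using fin by simp
      then show "(\<Sum>n\<in>F. (cmod (x n))\<^sup>2) \<le> enn2real (\<Sum>\<^sub>\<infinity>n. ennreal ((cmod (x n))\<^sup>2))"
        by (subst (asm) ennreal_le_iff) auto
    qed
  next
    assume x: "x \<in> l2"
    have "(\<Sum>\<^sub>\<infinity>n. ennreal ((cmod (x n))\<^sup>2)) \<le> ennreal (nsq x)"
      unfolding SUP
    proof (rule SUP_least)
      fix F :: "'a set" assume "F \<in> {F. finite F \<and> F \<subseteq> UNIV}"
      then show "(\<Sum>n\<in>F. ennreal ((cmod (x n))\<^sup>2)) \<le> ennreal (nsq x)"
        using sum_le_nsq[OF x] by (simp add: ennreal_leI)
    qed
    then show "(\<Sum>\<^sub>\<infinity>n. ennreal ((cmod (x n))\<^sup>2)) < \<infinity>"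
      by (rule le_less_trans) simp
  qed
qed

lemma circle_diff_compact_sets:
  assumes "compact E" shows "circle - E \<in> sets circle_borel"
proof -
  have "E \<in> sets borel" "circle \<in> sets borel"
    by (intro borel_closed compact_imp_closed assms, intro borel_closed closed_sphere)
  then show ?thesis by (simp add: sets_restrict_space_iff sets.Diff)
qed

lemma prob_measures_onD:
  assumes "\<mu> \<in> prob_measures_on E"
  shows "prob_space \<mu>" "sets \<mu> = sets circle_borel" "space \<mu> = circle"
    and "E \<subseteq> circle \<Longrightarrow> compact E \<Longrightarrow> AE \<zeta> in \<mu>. \<zeta> \<in> E"
proof -
  show 1: "prob_space \<mu>" "sets \<mu> = sets circle_borel" using assms by (auto simp: prob_measures_on_def)
  show sp: "space \<mu> = circle" using sets_eq_imp_space_eq[OF 1(2)] by (simp add: space_restrict_space)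
  assume E: "E \<subseteq> circle" "compact E"
  have "circle - E \<in> sets \<mu>"
    unfolding 1(2) by (rule circle_diff_compact_sets[OF E(2)])
  then show "AE \<zeta> in \<mu>. \<zeta> \<in> E"
    using assms sp by (intro AE_I'[of "circle - E"]) (auto simp: prob_measures_on_def null_sets_def)
qed

context doubling_weight
begin

text \<open>The index is reflected so that pairing this sequence with a monomial gives the integral
  of that monomial; the energy is symmetric in n and -n.\<close>

lemma energy_finite_iff:
  assumes "\<And>n. \<Omega> n = 1 / \<omega> n"
  shows "energy \<omega> \<mu> < \<infinity> \<longleftrightarrow> (\<lambda>n. measure_coeff \<mu> (- n) / of_real (sqrt (\<Omega> (nat \<bar>n\<bar>)))) \<in> l2"
proof -
  have w: "\<omega> n = 1 / \<Omega> n" for n using assms[of n] by simp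
  let ?x = "\<lambda>n. measure_coeff \<mu> n / of_real (sqrt (\<Omega> (nat \<bar>n\<bar>)))"
  have "ennreal (\<omega> (nat \<bar>n\<bar>) * (cmod (measure_coeff \<mu> n))\<^sup>2) = ennreal ((cmod (?x n))\<^sup>2)" for n
    using pos[of "nat \<bar>n\<bar>"] by (simp add: w norm_divide power_divide)
  then have "energy \<omega> \<mu> < \<infinity> \<longleftrightarrow> ?x \<in> l2"
    unfolding energy_def infsum_ennreal_finite_iff[symmetric] by simp
  also have "\<dots> \<longleftrightarrow> (\<lambda>n. ?x (- n)) \<in> l2"
    using l2_reflect[of ?x] l2_reflect[of "\<lambda>n. ?x (- n)"] by auto
  finally show ?thesis by simp
qed

text \<open>Both sides agree on trigonometric polynomials by the choice of u. For Fejer means of v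
  the integrals converge because the convergence is uniform, the pairings because it is weak in the
  weighted space.\<close>

lemma pair_finite_energy:
  assumes \<mu>: "prob_space \<mu>" "sets \<mu> = sets circle_borel"
    and u: "u \<in> l2" "\<And>n. u n = measure_coeff \<mu> (- n) / of_real (sqrt (\<Omega> (nat \<bar>n\<bar>)))"
    and v: "v \<in> CH"
  shows "pair u v = (LINT \<zeta>|\<mu>. v \<zeta>)"
proof -
  interpret prob_space \<mu> by (rule \<mu>)
  have sp: "space \<mu> = circle" using sets_eq_imp_space_eq[OF \<mu>(2)] by (simp add: space_restrict_space)
  have meas: "f \<in> borel_measurable \<mu>" if "continuous_on circle f" for f :: "complex \<Rightarrow> complex"
    using borel_measurable_continuous_on_restrict[OF that] \<mu>(2) by (simp cong: measurable_cong_sets)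
  have integ: "integrable \<mu> f" if f: "continuous_on circle f" for f :: "complex \<Rightarrow> complex"
  proof -
    obtain B where "\<And>\<zeta>. \<zeta> \<in> circle \<Longrightarrow> cmod (f \<zeta>) \<le> B"
      by (rule continuous_on_circle_bounded[OF f]) (rule that)
    then show ?thesis by (intro integrable_const_bound[where B=B] meas f) (auto simp: sp)
  qed
  have vc: "continuous_on circle v" using v by (simp add: CH_iff)
  have "(LINT \<zeta>|\<mu>. fejer N v \<zeta>) = pair u (fejer N v)" for N
  proof -
    have i: "integrable \<mu> (\<lambda>\<zeta>. c * \<zeta> powi k)" for c k by (intro integ continuous_intros)
    have "u k * of_real (sqrt (\<Omega> (nat \<bar>k\<bar>))) = (LINT \<zeta>|\<mu>. \<zeta> powi k)" for k
      using pos[of "nat \<bar>k\<bar>"] by (simp add: u(2) measure_coeff_def)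
    then show ?thesis
      unfolding pair_fejer[OF u(1)] unfolding fejer_eq_sum
      by (simp only: Bochner_Integration.integral_sum i integral_mult_right_zero)
  qed
  moreover have "(\<lambda>N. LINT \<zeta>|\<mu>. fejer N v \<zeta>) \<longlonglongrightarrow> (LINT \<zeta>|\<mu>. v \<zeta>)"
  proof (rule LIMSEQ_I)
    fix r :: real assume r: "0 < r"
    obtain N0 where N0: "\<And>N z. N0 \<le> N \<Longrightarrow> z \<in> circle \<Longrightarrow> cmod (fejer N v z - v z) < r / 2"
      by (rule fejer_uniform[OF vc half_gt_zero[OF r]]) (rule that)
    have "cmod ((LINT \<zeta>|\<mu>. fejer N v \<zeta>) - (LINT \<zeta>|\<mu>. v \<zeta>)) < r" if N: "N0 \<le> N" for N
    proof -
      have "(LINT \<zeta>|\<mu>. fejer N v \<zeta>) - (LINT \<zeta>|\<mu>. v \<zeta>) = (LINT \<zeta>|\<mu>. fejer N v \<zeta> - v \<zeta>)"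
        by (rule Bochner_Integration.integral_diff[symmetric]) (intro integ continuous_fejer vc)+
      also have "cmod \<dots> \<le> (LINT \<zeta>|\<mu>. cmod (fejer N v \<zeta> - v \<zeta>))" by (rule integral_norm_bound)
      also have "\<dots> \<le> (LINT \<zeta>|\<mu>. r / 2)"
      proof (rule integral_mono)
        show "integrable \<mu> (\<lambda>\<zeta>. cmod (fejer N v \<zeta> - v \<zeta>))"
          by (intro integrable_norm integ continuous_intros continuous_fejer vc)
      qed (use N0[OF N] in \<open>auto simp: sp intro: less_imp_le\<close>)
      also have "\<dots> < r" using r prob_space by simp
      finally show ?thesis .
    qed
    then show "\<exists>no. \<forall>N\<ge>no. norm ((LINT \<zeta>|\<mu>. fejer N v \<zeta>) - (LINT \<zeta>|\<mu>. v \<zeta>)) < r" by blast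
  qed
  ultimately show ?thesis
    using pair_fejer_tendsto[OF u(1) v] LIMSEQ_unique by fastforce
qed

lemma not_dense_of_capacity:
  assumes w: "\<And>n. \<Omega> n = 1 / \<omega> n" and E: "compact E" "E \<subseteq> circle" and cap: "capacity \<omega> E \<noteq> 0"
    and S: "S \<subseteq> CH" "\<And>h \<zeta>. h \<in> S \<Longrightarrow> \<zeta> \<in> E \<Longrightarrow> h \<zeta> = 0"
  shows "\<not> dense_in_ell2 \<Omega> S"
proof
  assume dense: "dense_in_ell2 \<Omega> S"
  have "\<exists>\<mu>\<in>prob_measures_on E. 1 / energy \<omega> \<mu> \<noteq> 0"
  proof (rule ccontr)
    assume "\<not> (\<exists>\<mu>\<in>prob_measures_on E. 1 / energy \<omega> \<mu> \<noteq> 0)"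
    then have "capacity \<omega> E \<le> 0" unfolding capacity_def by (intro SUP_least) simp
    then show False using cap by simp
  qed
  then obtain \<mu> where \<mu>E: "\<mu> \<in> prob_measures_on E" and ne: "1 / energy \<omega> \<mu> \<noteq> 0" by blast
  then have fin: "energy \<omega> \<mu> < \<infinity>" by (auto simp: less_top)
  note \<mu> = prob_measures_onD[OF \<mu>E]
  interpret prob_space \<mu> by (rule \<mu>)
  define u where "u n = measure_coeff \<mu> (- n) / of_real (sqrt (\<Omega> (nat \<bar>n\<bar>)))" for n
  have u: "u \<in> l2" using fin unfolding energy_finite_iff[OF w] u_def .
  have one: "(\<lambda>_. 1) \<in> CH" by (rule CH_smooth[OF smooth_on_circle_const])
  \<comment> \<open>Approximating 1 by h with squared error below t makes both terms of the pairing
    bound less than 1, whereas the pairing with 1 - h equals the total mass 1.\<close>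
  define t where "t = 1 / (nsq u + 1)"
  have t: "0 < t" "t * nsq u < 1" using nsq_nonneg[of u] by (auto simp: t_def field_simps)
  have "\<forall>g\<in>ell2 \<Omega>. \<forall>\<epsilon>>0. \<exists>h\<in>S. ell2_norm \<Omega> (\<lambda>\<zeta>. g \<zeta> - h \<zeta>) < \<epsilon>"
    using dense unfolding dense_in_ell2_def by (rule conjunct2)
  from this[rule_format, OF CH_ell2[OF one], of "sqrt t"] t(1)
  obtain h where h: "h \<in> S" and "ell2_norm \<Omega> (\<lambda>\<zeta>. 1 - h \<zeta>) < sqrt t" by auto
  then have small: "nsq (wcoeff \<Omega> (\<lambda>\<zeta>. 1 - h \<zeta>)) < t" by (simp add: ell2_norm_eq)
  have hC: "h \<in> CH" using h S(1) by auto
  have "pair u h = (LINT \<zeta>|\<mu>. h \<zeta>)" by (rule pair_finite_energy[OF \<mu>(1,2) u u_def hC])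
  also have "\<dots> = (LINT \<zeta>|\<mu>. 0)"
  proof (rule integral_cong_AE)
    show "AE \<zeta> in \<mu>. h \<zeta> = 0" using \<mu>(4)[OF E(2,1)] S(2)[OF h] by (auto elim: eventually_mono)
    show "h \<in> borel_measurable \<mu>"
      using borel_measurable_continuous_on_restrict[of circle h] hC \<mu>(2) by (simp add: CH_iff cong: measurable_cong_sets)
  qed simp
  finally have "pair u (\<lambda>\<zeta>. 1 - h \<zeta>) = pair u (\<lambda>_. 1)" by (simp add: pair_diff[OF u one hC])
  also have "\<dots> = 1" using pair_finite_energy[OF \<mu>(1,2) u u_def one] prob_space by simp
  finally have "1 \<le> (t * nsq u + nsq (wcoeff \<Omega> (\<lambda>\<zeta>. 1 - h \<zeta>)) / t) / 2"
    using pair_bound[OF u CH_diff[OF one hC] t(1)] by simp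
  moreover have "nsq (wcoeff \<Omega> (\<lambda>\<zeta>. 1 - h \<zeta>)) / t < 1" using small t(1) by simp
  moreover have "(a + b) / 2 < 1" if "a < 1" "b < 1" for a b :: real using that by simp
  ultimately show False using t(2) by (meson not_le)
qed

lemma fejer_real:
  assumes v: "continuous_on circle v" "\<And>\<zeta>. \<zeta> \<in> circle \<Longrightarrow> Im (v \<zeta>) = 0" and z: "z \<in> circle"
  shows "Im (fejer N v z) = 0"
proof -
  have z1: "cmod z = 1" using z by simp
  have "fejer N v z = (LINT w|circle_measure. v w * of_real (fejer_kernel N (z / w)))"
    by (rule fejer_eq_integral[OF circle_integrable_continuous[OF v(1)] z1])
  also have "\<dots> = (LINT w|circle_measure. of_real (Re (v w) * fejer_kernel N (z / w)))"
    by (rule circle_integral_cong) (simp add: complex_eq_iff v(2))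
  also have "\<dots> = of_real (LINT w|circle_measure. Re (v w) * fejer_kernel N (z / w))"
    by (rule integral_complex_of_real)
  finally show ?thesis by simp
qed

text \<open>The measure is the weak limit of the densities obtained by applying the functional to translates
  of the Fejer kernel.\<close>

lemma positive_functional_measure:
  assumes w: "\<And>n. \<Omega> n = 1 / \<omega> n" and E: "compact E" "E \<subseteq> circle" "E \<noteq> {}" and u: "u \<in> l2"
    and pos_u: "\<And>v. smooth_on_circle v \<Longrightarrow> (\<And>\<zeta>. \<zeta> \<in> circle \<Longrightarrow> Im (v \<zeta>) = 0) \<Longrightarrow>
      (\<And>\<zeta>. \<zeta> \<in> E \<Longrightarrow> 0 \<le> Re (v \<zeta>)) \<Longrightarrow> 0 \<le> Re (pair u v)"
    and s: "0 < Re (pair u (\<lambda>_. 1))"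
  obtains \<mu> where "\<mu> \<in> prob_measures_on E" "energy \<omega> \<mu> < \<infinity>"
proof -
  define s where "s = Re (pair u (\<lambda>_. 1))"
  define S where "S k = pair u (\<lambda>\<zeta>. \<zeta> powi k)" for k
  let ?I = "\<lambda>N::nat. {..<N} \<times> {..<N}"
  \<comment> \<open>This is the functional applied to the Fejer kernel centred at \<zeta>.
    Integrating v against it gives the functional at the Fejer mean of v.\<close>
  define D where "D N \<zeta> = (\<Sum>i\<in>?I N. (S (int (fst i) - int (snd i)) / of_nat N) * \<zeta> powi (- (int (fst i) - int (snd i))))" for N \<zeta>
  have s0: "0 < s" using s by (simp add: s_def)
  have Dc: "continuous_on circle (D N)" for N unfolding D_def by (intro continuous_intros)
  have D_int: "(LINT \<zeta>|circle_measure. v \<zeta> * D N \<zeta>) = pair u (fejer N v)" if v: "continuous_on circle v" for v N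
  proof -
    have i: "integrable circle_measure (\<lambda>\<zeta>. c * (\<zeta> powi k * v \<zeta>))" for c k
      by (intro integrable_mult_right integrable_powi_mult circle_integrable_continuous v)
    have "(LINT \<zeta>|circle_measure. v \<zeta> * D N \<zeta>)
        = (LINT \<zeta>|circle_measure. (\<Sum>i\<in>?I N. (S (int (fst i) - int (snd i)) / of_nat N) * (\<zeta> powi (- (int (fst i) - int (snd i))) * v \<zeta>)))"
      by (simp add: D_def sum_distrib_left mult_ac)
    also have "\<dots> = (\<Sum>i\<in>?I N. (S (int (fst i) - int (snd i)) / of_nat N) * fourier v (int (fst i) - int (snd i)))"
      unfolding fourier_def by (simp only: Bochner_Integration.integral_sum i integral_mult_right_zero)
    also have "\<dots> = pair u (fejer N v)"
      unfolding pair_fejer[OF u] S_def pair_powi by (intro sum.cong) auto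
    finally show ?thesis .
  qed
  have D_nonneg: "0 \<le> Re (D N \<zeta>)" if z: "\<zeta> \<in> circle" for N \<zeta>
  proof -
    define k where "k z = (\<Sum>i\<in>?I N. (\<zeta> powi (- (int (fst i) - int (snd i))) / of_nat N) * z powi (int (fst i) - int (snd i)))" for z
    have ks: "smooth_on_circle k"
      unfolding k_def by (intro smooth_on_circle_sum smooth_on_circle_mult smooth_on_circle_const smooth_on_circle_powi)
    have kk: "k z = of_real (fejer_kernel N (z / \<zeta>))" if "z \<in> circle" for z
    proof -
      have "cmod (z / \<zeta>) = 1" using that z by (simp add: norm_divide)
      moreover have "(z / \<zeta>) powi m = \<zeta> powi (- m) * z powi m" for m
        by (simp only: power_int_divide_distrib power_int_minus) (simp add: field_simps)
      ultimately show ?thesis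
        by (simp add: fejer_kernel_expand k_def sum_divide_distrib sum.cartesian_product case_prod_beta)
    qed
    have "pair u k = D N \<zeta>"
      unfolding k_def[abs_def] D_def S_def
      by (simp only: pair_sum[OF u] CH_cmult CH_smooth smooth_on_circle_powi pair_cmult)
        (intro sum.cong refl, simp)
    moreover have "0 \<le> Re (pair u k)"
      using E(2) by (intro pos_u ks) (auto simp: kk fejer_kernel_nonneg)
    ultimately show ?thesis by simp
  qed
  \<comment> \<open>Positivity is known for real parts only, hence the real part; division by
    \<open>s\<close> gives mass 1. The index starts at 1 because the Fejer mean of order 0 is zero
    and could not be normalised.\<close>
  define d where "d N \<zeta> = Re (D (Suc N) \<zeta>) / s" for N \<zeta>
  have dc: "continuous_on circle (d N)" for N unfolding d_def by (intro continuous_intros Dc) (use s0 in auto)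
  have d_real: "(LINT \<zeta>|circle_measure. d N \<zeta> *\<^sub>R v \<zeta>) = of_real (Re (pair u (fejer (Suc N) v)) / s)"
    if v: "continuous_on circle v" "\<And>\<zeta>. \<zeta> \<in> circle \<Longrightarrow> Im (v \<zeta>) = 0" for v N
  proof -
    have "(LINT \<zeta>|circle_measure. d N \<zeta> *\<^sub>R v \<zeta>) = (LINT \<zeta>|circle_measure. of_real (Re (v \<zeta> * D (Suc N) \<zeta>) / s))"
      by (rule circle_integral_cong) (simp add: complex_eq_iff d_def v(2))
    also have "\<dots> = of_real ((LINT \<zeta>|circle_measure. Re (v \<zeta> * D (Suc N) \<zeta>)) / s)"
      by (simp only: integral_complex_of_real integral_divide_zero)
    also have "(LINT \<zeta>|circle_measure. Re (v \<zeta> * D (Suc N) \<zeta>)) = Re (pair u (fejer (Suc N) v))"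
      unfolding D_int[OF v(1), symmetric]
      by (intro integral_Re circle_integrable_continuous continuous_intros v Dc)
    finally show ?thesis .
  qed
  have d_one: "(LINT \<zeta>|circle_measure. d N \<zeta>) = 1" for N
  proof -
    have "fejer (Suc N) (\<lambda>_. 1) = (\<lambda>_. 1)" using fejer_one[of "Suc N"] by auto
    then have "(LINT \<zeta>|circle_measure. d N \<zeta> *\<^sub>R (1::complex)) = 1"
      using d_real[of "\<lambda>_. 1" N] s0 by (simp add: s_def)
    then have "complex_of_real (LINT \<zeta>|circle_measure. d N \<zeta>) = 1"
      by (simp add: scaleR_conv_of_real)
    then show ?thesis by simp
  qed
  obtain r \<mu> where r: "strict_mono (r :: nat \<Rightarrow> nat)" and \<mu>: "prob_space \<mu>" "sets \<mu> = sets circle_borel"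
    and lim: "\<And>f :: complex \<Rightarrow> complex. continuous_on circle f \<Longrightarrow>
      (\<lambda>k. LINT \<zeta>|circle_measure. d (r k) \<zeta> *\<^sub>R f \<zeta>) \<longlonglongrightarrow> (LINT \<zeta>|\<mu>. f \<zeta>)"
    by (rule circle_density_weak_limit[of d, OF dc _ d_one]) (use D_nonneg s0 in \<open>auto simp: d_def intro!: that\<close>)
  interpret prob_space \<mu> by (rule \<mu>)
  have sp: "space \<mu> = circle" using sets_eq_imp_space_eq[OF \<mu>(2)] by (simp add: space_restrict_space)
  have r': "filterlim (\<lambda>k. Suc (r k)) at_top sequentially"
    using filterlim_subseq[OF r] filterlim_Suc filterlim_compose by blast
  \<comment> \<open>A nonnegative continuous function whose zero set is exactly E: if its integral
    vanishes, the measure is carried by E.\<close>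
  define v where "v \<zeta> = complex_of_real (infdist \<zeta> E)" for \<zeta>
  have vc: "continuous_on circle v" unfolding v_def by (intro continuous_intros)
  have small: "Re (LINT \<zeta>|\<mu>. v \<zeta>) \<le> 0 + e" if e: "0 < e" for e
  proof (rule tendsto_upperbound)
    show "(\<lambda>k. Re (LINT \<zeta>|circle_measure. d (r k) \<zeta> *\<^sub>R v \<zeta>)) \<longlonglongrightarrow> Re (LINT \<zeta>|\<mu>. v \<zeta>)"
      by (intro tendsto_intros lim vc)
    obtain N0 where N0: "\<And>N z. N0 \<le> N \<Longrightarrow> z \<in> circle \<Longrightarrow> cmod (fejer N v z - v z) < e"
      by (rule fejer_uniform[OF vc e]) (rule that)
    have "Re (LINT \<zeta>|circle_measure. d N \<zeta> *\<^sub>R v \<zeta>) \<le> 0 + e" if N: "N0 \<le> Suc N" for N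
    proof -
      \<comment> \<open>On E the distance is 0, so its Fejer mean is below e there and f is
        nonnegative on E, although it may be negative elsewhere. Positivity on E alone is decisive
        here.\<close>
      define f where "f \<zeta> = of_real e * 1 + (-1) * fejer (Suc N) v \<zeta>" for \<zeta>
      have sm: "smooth_on_circle (\<lambda>\<zeta>. 1)" "smooth_on_circle (fejer (Suc N) v)"
        by (rule smooth_on_circle_const smooth_on_circle_fejer)+
      have "0 \<le> Re (pair u f)"
      proof (rule pos_u)
        show "smooth_on_circle f" unfolding f_def
          by (intro smooth_on_circle_add smooth_on_circle_mult smooth_on_circle_const smooth_on_circle_fejer)
        show "Im (f \<zeta>) = 0" if "\<zeta> \<in> circle" for \<zeta>
          using fejer_real[OF vc _ that, of "Suc N"] by (simp add: f_def v_def)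
        show "0 \<le> Re (f \<zeta>)" if "\<zeta> \<in> E" for \<zeta>
        proof -
          have z: "\<zeta> \<in> circle" using that E(2) by auto
          have "v \<zeta> = 0" using that by (simp add: v_def)
          then have "cmod (fejer (Suc N) v \<zeta>) < e" using N0[OF N z] by simp
          then show ?thesis using complex_Re_le_cmod[of "fejer (Suc N) v \<zeta>"] by (simp add: f_def)
        qed
      qed
      moreover have "pair u f = of_real e * pair u (\<lambda>_. 1) + (-1) * pair u (fejer (Suc N) v)"
        unfolding f_def by (subst pair_add[OF u]) (simp_all only: CH_cmult CH_smooth sm pair_cmult)
      ultimately have "Re (pair u (fejer (Suc N) v)) \<le> e * s" by (simp add: s_def)
      then have "Re (pair u (fejer (Suc N) v)) / s \<le> e" using s0 by (simp add: pos_divide_le_eq)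
      then show ?thesis using d_real[OF vc, of N] by (simp add: v_def)
    qed
    moreover have "\<forall>\<^sub>F k in sequentially. N0 \<le> Suc (r k)"
      using r' by (simp add: filterlim_at_top)
    ultimately show "\<forall>\<^sub>F k in sequentially. Re (LINT \<zeta>|circle_measure. d (r k) \<zeta> *\<^sub>R v \<zeta>) \<le> 0 + e"
      by (auto elim: eventually_mono)
  qed simp
  then have "Re (LINT \<zeta>|\<mu>. v \<zeta>) \<le> 0" by (rule field_le_epsilon)
  then have le0: "(LINT \<zeta>|\<mu>. infdist \<zeta> E) \<le> 0" by (simp add: v_def)
  have infc: "continuous_on circle (\<lambda>\<zeta>. infdist \<zeta> E)" by (intro continuous_intros)
  have im: "(\<lambda>\<zeta>. infdist \<zeta> E) \<in> borel_measurable \<mu>"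
    using borel_measurable_continuous_on_restrict[OF infc] \<mu>(2) by (simp cong: measurable_cong_sets)
  obtain B where B: "\<And>\<zeta>. \<zeta> \<in> circle \<Longrightarrow> norm (infdist \<zeta> E) \<le> B"
    by (rule continuous_on_circle_bounded[OF infc]) (rule that)
  have ii: "integrable \<mu> (\<lambda>\<zeta>. infdist \<zeta> E)"
    by (rule integrable_const_bound[where B=B, OF _ im]) (rule AE_I2, rule B, simp only: sp)
  have "(LINT \<zeta>|\<mu>. infdist \<zeta> E) = 0"
    by (rule antisym[OF le0]) (rule Bochner_Integration.integral_nonneg, rule infdist_nonneg)
  then have "AE \<zeta> in \<mu>. infdist \<zeta> E = 0"
    using integral_nonneg_eq_0_iff_AE[OF ii] by (simp add: infdist_nonneg)
  moreover have "\<zeta> \<in> E" if "infdist \<zeta> E = 0" for \<zeta>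
    using in_closed_iff_infdist_zero[OF compact_imp_closed[OF E(1)] E(3)] that by simp
  ultimately have "AE \<zeta> in \<mu>. \<zeta> \<notin> circle - E" by (auto elim: eventually_mono)
  moreover have CE: "circle - E \<in> sets \<mu>"
    unfolding \<mu>(2) by (rule circle_diff_compact_sets[OF E(1)])
  ultimately have "emeasure \<mu> (circle - E) = 0"
    by (subst (asm) AE_iff_measurable[OF CE]) (auto simp: sp)
  then have \<mu>E: "\<mu> \<in> prob_measures_on E" using \<mu> by (simp add: prob_measures_on_def)
  \<comment> \<open>Taking real parts of the densities symmetrises the coefficients. After weighting
    they combine u with its conjugate reflection, so they stay in \<open>l2\<close> and the energy
    is finite.\<close>
  have coeff: "(LINT \<zeta>|\<mu>. \<zeta> powi n) = (S n + cnj (S (- n))) / (2 * of_real s)" for n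
  proof (rule LIMSEQ_unique[OF lim])
    have e: "(LINT \<zeta>|circle_measure. d N \<zeta> *\<^sub>R \<zeta> powi n)
        = (pair u (fejer (Suc N) (\<lambda>\<zeta>. \<zeta> powi n)) + cnj (pair u (fejer (Suc N) (\<lambda>\<zeta>. \<zeta> powi (- n))))) / (2 * of_real s)" for N
    proof -
      have i: "integrable circle_measure (\<lambda>\<zeta>. \<zeta> powi n * D (Suc N) \<zeta>)" "integrable circle_measure (\<lambda>\<zeta>. cnj (\<zeta> powi (- n) * D (Suc N) \<zeta>))"
        by (intro circle_integrable_continuous continuous_intros Dc)+
      have "(LINT \<zeta>|circle_measure. d N \<zeta> *\<^sub>R \<zeta> powi n)
          = (LINT \<zeta>|circle_measure. (\<zeta> powi n * D (Suc N) \<zeta> + cnj (\<zeta> powi (- n) * D (Suc N) \<zeta>)) / (2 * of_real s))"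
      proof (rule circle_integral_cong)
        fix \<zeta> :: complex assume "\<zeta> \<in> circle"
        then have "cnj (\<zeta> powi (- n)) = \<zeta> powi n" using cnj_powi_circle[of \<zeta> "- n"] by simp
        then have "\<zeta> powi n * D (Suc N) \<zeta> + cnj (\<zeta> powi (- n) * D (Suc N) \<zeta>) = \<zeta> powi n * of_real (2 * Re (D (Suc N) \<zeta>))"
          by (simp only: complex_cnj_mult distrib_left[symmetric] complex_add_cnj)
        then show "d N \<zeta> *\<^sub>R \<zeta> powi n = (\<zeta> powi n * D (Suc N) \<zeta> + cnj (\<zeta> powi (- n) * D (Suc N) \<zeta>)) / (2 * of_real s)"
          by (simp add: d_def scaleR_conv_of_real)
      qed
      also have "\<dots> = ((LINT \<zeta>|circle_measure. \<zeta> powi n * D (Suc N) \<zeta>) + cnj (LINT \<zeta>|circle_measure. \<zeta> powi (- n) * D (Suc N) \<zeta>)) / (2 * of_real s)"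
      proof -
        have "(LINT \<zeta>|circle_measure. cnj (\<zeta> powi (- n) * D (Suc N) \<zeta>)) = cnj (LINT \<zeta>|circle_measure. \<zeta> powi (- n) * D (Suc N) \<zeta>)"
          by (rule Bochner_Integration.integral_cnj)
        then show ?thesis
          by (simp only: integral_divide_zero Bochner_Integration.integral_add[OF i])
      qed
      also have "\<dots> = (pair u (fejer (Suc N) (\<lambda>\<zeta>. \<zeta> powi n)) + cnj (pair u (fejer (Suc N) (\<lambda>\<zeta>. \<zeta> powi (- n))))) / (2 * of_real s)"
        by (simp only: D_int continuous_powi_circle)
      finally show ?thesis .
    qed
    have t: "(\<lambda>k. pair u (fejer (Suc (r k)) (\<lambda>\<zeta>. \<zeta> powi m))) \<longlonglongrightarrow> S m" for m
      unfolding S_def by (rule filterlim_compose[OF pair_fejer_tendsto[OF u CH_smooth[OF smooth_on_circle_powi]] r'])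
    show "(\<lambda>k. LINT \<zeta>|circle_measure. d (r k) \<zeta> *\<^sub>R \<zeta> powi n) \<longlonglongrightarrow> (S n + cnj (S (- n))) / (2 * of_real s)"
      unfolding e by (intro tendsto_intros t) (use s0 in simp)
  qed (rule continuous_powi_circle)
  have eq: "(\<lambda>n. measure_coeff \<mu> (- n) / of_real (sqrt (\<Omega> (nat \<bar>n\<bar>)))) = (\<lambda>n. (1 / (2 * of_real s)) * (u n + cnj (u (- n))))"
  proof
    fix n
    have "complex_of_real (sqrt (\<Omega> (nat \<bar>n\<bar>))) \<noteq> 0" using pos[of "nat \<bar>n\<bar>"] by simp
    moreover have "S n + cnj (S (- n)) = (u n + cnj (u (- n))) * of_real (sqrt (\<Omega> (nat \<bar>n\<bar>)))"
      by (simp add: S_def pair_powi distrib_right)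
    ultimately show "measure_coeff \<mu> (- n) / of_real (sqrt (\<Omega> (nat \<bar>n\<bar>))) = (1 / (2 * of_real s)) * (u n + cnj (u (- n)))"
      by (simp add: measure_coeff_def coeff)
  qed
  have cl: "(\<lambda>n. cnj (u (- n))) \<in> l2" using l2_reflect[OF u] by (simp add: l2_def)
  have "energy \<omega> \<mu> < \<infinity>"
    unfolding energy_finite_iff[OF w] eq by (intro l2_scale(1) l2_add(1) u cl)
  with \<mu>E show thesis by (rule that)
qed

end

section \<open>The three equivalent conditions\<close>

lemma complex_span_zero: "(\<lambda>_. 0) \<in> complex_span S"
  unfolding complex_span_def by (auto intro!: exI[of _ "{}"])

lemma complex_span_lin:
  assumes "x \<in> complex_span S" "y \<in> complex_span S"
  shows "(\<lambda>\<zeta>. a * x \<zeta> + b * y \<zeta>) \<in> complex_span S"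
proof -
  obtain F c where F: "finite F" "F \<subseteq> S" "x = (\<lambda>\<zeta>. \<Sum>g\<in>F. c g * g \<zeta>)"
    using assms(1) unfolding complex_span_def by blast
  obtain G d where G: "finite G" "G \<subseteq> S" "y = (\<lambda>\<zeta>. \<Sum>g\<in>G. d g * g \<zeta>)"
    using assms(2) unfolding complex_span_def by blast
  define e where "e g = a * (if g \<in> F then c g else 0) + b * (if g \<in> G then d g else 0)" for g
  have "x \<zeta> = (\<Sum>g\<in>F \<union> G. (if g \<in> F then c g else 0) * g \<zeta>)" for \<zeta>
    unfolding F(3) using F(1) G(1) by (intro sum.mono_neutral_cong_left) auto
  moreover have "y \<zeta> = (\<Sum>g\<in>F \<union> G. (if g \<in> G then d g else 0) * g \<zeta>)" for \<zeta>
    unfolding G(3) using F(1) G(1) by (intro sum.mono_neutral_cong_left) auto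
  ultimately have "(\<lambda>\<zeta>. a * x \<zeta> + b * y \<zeta>) = (\<lambda>\<zeta>. \<Sum>g\<in>F \<union> G. e g * g \<zeta>)"
    by (simp only: e_def distrib_right sum.distrib sum_distrib_left mult.assoc)
  then show ?thesis using F G unfolding complex_span_def by blast
qed

lemma complex_span_base: "g \<in> S \<Longrightarrow> g \<in> complex_span S"
  unfolding complex_span_def by (auto intro!: exI[of _ "{g}"] exI[of _ "\<lambda>_. 1"])

lemma complex_span_sum:
  assumes "\<And>i. i \<in> I \<Longrightarrow> x i \<in> complex_span S"
  shows "(\<lambda>\<zeta>. \<Sum>i\<in>I. c i * x i \<zeta>) \<in> complex_span S"
  using assms
proof (induction I rule: infinite_finite_induct)
  case (insert k I)
  then show ?case
    using complex_span_lin[of "x k" S "\<lambda>\<zeta>. \<Sum>i\<in>I. c i * x i \<zeta>" "c k" 1] by simp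
qed (simp_all add: complex_span_zero)

lemma smooth_compact_support_mult:
  assumes "m \<in> smooth_compact_support U" "smooth_on_circle p"
  shows "(\<lambda>\<zeta>. m \<zeta> * p \<zeta>) \<in> smooth_compact_support U"
proof -
  have "closure (support_on circle (\<lambda>\<zeta>. m \<zeta> * p \<zeta>)) \<subseteq> closure (support_on circle m)"
    by (rule closure_mono) (auto simp: support_on_def)
  moreover have "compact (closure (support_on circle m))" "closure (support_on circle m) \<subseteq> U"
    using assms(1) by (auto simp: smooth_compact_support_def)
  ultimately have "compact (closure (support_on circle (\<lambda>\<zeta>. m \<zeta> * p \<zeta>)))" "closure (support_on circle (\<lambda>\<zeta>. m \<zeta> * p \<zeta>)) \<subseteq> U"
    by (meson bounded_subset closed_closure compact_eq_bounded_closed, blast)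
  then show ?thesis using assms by (simp add: smooth_compact_support_def smooth_on_circle_mult)
qed

context doubling_weight
begin

text \<open>The Lipschitz inequality supplies the continuity of f as well, so it need not be
  assumed.\<close>

lemma CH_contraction:
  assumes h: "h \<in> CH" and lip: "\<And>x y. x \<in> circle \<Longrightarrow> y \<in> circle \<Longrightarrow> cmod (f x - f y) \<le> L * cmod (h x - h y)"
  shows "f \<in> CH"
proof -
  have hc: "continuous_on circle h" "wcoeff \<Omega> h \<in> l2" using h by (auto simp: CH_iff)
  have "continuous_on circle f"
    unfolding continuous_on_def
  proof (intro ballI)
    fix x :: complex assume x: "x \<in> circle"
    have "((\<lambda>y. L * cmod (h y - h x)) \<longlongrightarrow> L * cmod (h x - h x)) (at x within circle)"
      using hc(1) x by (intro tendsto_intros) (simp add: continuous_on_def)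
    then have "((\<lambda>y. L * cmod (h y - h x)) \<longlongrightarrow> 0) (at x within circle)" by simp
    then have "((\<lambda>y. f y - f x) \<longlongrightarrow> 0) (at x within circle)"
      by (rule Lim_null_comparison[rotated]) (use lip x in \<open>auto simp: eventually_at_filter\<close>)
    then show "(f \<longlongrightarrow> f x) (at x within circle)" by (rule LIM_zero_cancel)
  qed
  moreover from wcoeff_contraction(1)[OF this hc lip] have "wcoeff \<Omega> f \<in> l2" .
  ultimately show ?thesis by (simp add: CH_iff)
qed

lemma small_majorant:
  assumes w: "\<And>n. \<Omega> n = 1 / \<omega> n" and E: "compact E" "E \<subseteq> circle" and cap: "capacity \<omega> E = 0" and e: "0 < e"
  obtains h where "smooth_on_circle h" "\<And>\<zeta>. \<zeta> \<in> E \<Longrightarrow> 1 \<le> Re (h \<zeta>)" "nsq (wcoeff \<Omega> h) < e"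
proof -
  define K where "K = {h. smooth_on_circle h \<and> (\<forall>\<zeta>\<in>circle. Im (h \<zeta>) = 0) \<and> (\<forall>\<zeta>\<in>E. 1 \<le> Re (h \<zeta>))}"
  have "\<exists>h\<in>K. nsq (wcoeff \<Omega> h) < e"
  proof (rule ccontr)
    assume "\<not> (\<exists>h\<in>K. nsq (wcoeff \<Omega> h) < e)"
    then have ge: "e \<le> nsq (wcoeff \<Omega> h)" if "h \<in> K" for h using that by force
    have one: "(\<lambda>_. 1) \<in> K" by (simp add: K_def smooth_on_circle_const)
    have KC: "K \<subseteq> CH" by (auto simp: K_def intro: CH_smooth)
    have "E \<noteq> {}"
    proof
      assume "E = {}"
      then have "(\<lambda>_. 0) \<in> K" by (simp add: K_def smooth_on_circle_const)
      moreover have "wcoeff \<Omega> (\<lambda>_. 0) = (\<lambda>n. 0)" using wcoeff_cmult[of \<Omega> 0 "\<lambda>_. 0"] by simp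
      ultimately show False using ge[of "\<lambda>_. 0"] e by (simp add: nsq_def)
    qed
    obtain u where u: "u \<in> l2" and Re_u: "\<And>x. x \<in> K \<Longrightarrow> e \<le> Re (pair u x)"
    proof (rule separation_CH[OF KC])
      show "K \<noteq> {}" using one by auto
      show "e \<le> nsq (wcoeff \<Omega> x)" if "x \<in> K" for x by (rule ge[OF that])
      fix x y and t :: real assume x: "x \<in> K" and y: "y \<in> K" and t: "0 \<le> t" "t \<le> 1"
      have "1 \<le> (1 - t) * Re (x \<zeta>) + t * Re (y \<zeta>)" if "\<zeta> \<in> E" for \<zeta>
      proof -
        have "(1 - t) * 1 + t * 1 \<le> (1 - t) * Re (x \<zeta>) + t * Re (y \<zeta>)"
          using x y t that by (intro add_mono mult_left_mono) (auto simp: K_def)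
        then show ?thesis by simp
      qed
      then show "(\<lambda>\<zeta>. of_real (1 - t) * x \<zeta> + of_real t * y \<zeta>) \<in> K"
        using x y by (auto simp: K_def intro!: smooth_on_circle_add smooth_on_circle_mult smooth_on_circle_const)
    qed (rule that)
    have pos_u: "0 \<le> Re (pair u v)"
      if v: "smooth_on_circle v" "\<And>\<zeta>. \<zeta> \<in> circle \<Longrightarrow> Im (v \<zeta>) = 0" "\<And>\<zeta>. \<zeta> \<in> E \<Longrightarrow> 0 \<le> Re (v \<zeta>)" for v
    proof (rule ccontr)
      assume neg: "\<not> 0 \<le> Re (pair u v)"
      \<comment> \<open>Adding a nonnegative multiple of v to 1 stays in \<open>K\<close>; this
        multiple brings the real part of the functional down to 0, below e.\<close>
      define t where "t = Re (pair u (\<lambda>_. 1)) / - Re (pair u v)"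
      have "0 < Re (pair u (\<lambda>_. 1))" using Re_u[OF one] e by linarith
      then have t: "0 \<le> t" using neg by (simp add: t_def divide_nonneg_neg divide_nonneg_pos)
      have "(\<lambda>\<zeta>. 1 + of_real t * v \<zeta>) \<in> K"
        using v t by (auto simp: K_def intro!: smooth_on_circle_add smooth_on_circle_mult smooth_on_circle_const)
      then have "e \<le> Re (pair u (\<lambda>\<zeta>. 1 + of_real t * v \<zeta>))" by (rule Re_u)
      also have "pair u (\<lambda>\<zeta>. 1 + of_real t * v \<zeta>) = pair u (\<lambda>_. 1) + of_real t * pair u v"
        using one KC v(1) by (subst pair_add[OF u]) (auto intro: CH_cmult CH_smooth simp: pair_cmult)
      also have "Re \<dots> = 0" using neg by (simp add: t_def)
      finally show False using e by simp
    qed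
    obtain \<mu> where \<mu>: "\<mu> \<in> prob_measures_on E" "energy \<omega> \<mu> < \<infinity>"
    proof (rule positive_functional_measure[OF w E \<open>E \<noteq> {}\<close> u pos_u])
      show "0 < Re (pair u (\<lambda>_. 1))" using Re_u[OF one] e by linarith
    qed (auto intro: that)
    have "1 / energy \<omega> \<mu> \<le> capacity \<omega> E" unfolding capacity_def by (rule SUP_upper[OF \<mu>(1)])
    then have "1 / energy \<omega> \<mu> = 0" using cap by simp
    then show False using \<mu>(2) by (simp add: divide_ennreal_def)
  qed
  then show thesis using that unfolding K_def by auto
qed

lemma one_approx:
  assumes w: "\<And>n. \<Omega> n = 1 / \<omega> n" and E: "compact E" "E \<subseteq> circle" and cap: "capacity \<omega> E = 0" and e: "0 < e"
  obtains m where "m \<in> smooth_compact_support (circle - E)" "nsq (wcoeff \<Omega> (\<lambda>\<zeta>. 1 - m \<zeta>)) < e"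
proof -
  \<comment> \<open>The Lipschitz constant of the cut-off: 2 from \<open>flat\<close>, 2 from the
    inner factor, and e from the normalisation.\<close>
  define L where "L = 4 * exp (1 :: real)"
  \<comment> \<open>The factor lost in passing from h to 1 - m: the mean-square term, then the
    increments.\<close>
  define A where "A = \<Omega> 2 * (L\<^sup>2 / \<Omega> 0) + C * L\<^sup>2"
  have A0: "0 \<le> A" unfolding A_def using pos[of 2] pos[of 0] C_nonneg by simp
  have "0 < e / (A + 1)" using e A0 by simp
  then obtain h where h: "smooth_on_circle h" "\<And>\<zeta>. \<zeta> \<in> E \<Longrightarrow> 1 \<le> Re (h \<zeta>)" "nsq (wcoeff \<Omega> h) < e / (A + 1)"
    by (rule small_majorant[OF w E cap]) (rule that)
  have hc: "continuous_on circle h" "wcoeff \<Omega> h \<in> l2"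
    using CH_smooth[OF h(1)] by (auto simp: CH_iff)
  \<comment> \<open>Equal to 1 where the real part of h is 0, and to 0 where it is at least 1/2. As
    it is at least 1 on E, the function vanishes on a whole neighbourhood of E in the
    circle.\<close>
  define m where "m \<zeta> = complex_of_real (exp 1) * of_real (flat 0 (1 - 2 * Re (h \<zeta>)))" for \<zeta>
  have "smooth_curve (\<lambda>\<theta>. of_real (flat 0 (1 - 2 * Re (h (cis \<theta>)))))"
    using smooth_curve_flat h(1) unfolding smooth_on_circle_iff .
  then have ms: "smooth_on_circle m"
    unfolding m_def smooth_on_circle_iff by (rule smooth_curve_mult[OF smooth_curve_const])
  have "openin (top_of_set circle) (circle \<inter> (\<lambda>\<zeta>. Re (h \<zeta>)) -` {1 / 2<..})"
    by (rule continuous_openin_preimage_gen) (auto intro!: continuous_intros hc)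
  then obtain V where V: "open V" "circle \<inter> (\<lambda>\<zeta>. Re (h \<zeta>)) -` {1 / 2<..} = circle \<inter> V"
    unfolding openin_open by blast
  have "m \<in> smooth_compact_support (circle - E)"
  proof (rule smooth_compact_supportI[OF ms V(1)])
    show "E \<subseteq> V"
    proof
      fix \<zeta> assume z: "\<zeta> \<in> E"
      then have "\<zeta> \<in> circle \<inter> (\<lambda>\<zeta>. Re (h \<zeta>)) -` {1 / 2<..}" using h(2)[OF z] E(2) by auto
      then show "\<zeta> \<in> V" unfolding V(2) by simp
    qed
    fix \<zeta> :: complex assume "\<zeta> \<in> circle" "\<zeta> \<in> V"
    then have "\<zeta> \<in> circle \<inter> (\<lambda>\<zeta>. Re (h \<zeta>)) -` {1 / 2<..}" unfolding V(2) by simp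
    then show "m \<zeta> = 0" by (simp add: m_def flat_def)
  qed
  moreover have "nsq (wcoeff \<Omega> (\<lambda>\<zeta>. 1 - m \<zeta>)) < e"
  proof -
    have dflat: "exp 1 * \<bar>flat 0 (1 - 2 * a) - flat 0 (1 - 2 * b)\<bar> \<le> L * \<bar>a - b\<bar>" for a b
    proof -
      have "(1 - 2 * a) - (1 - 2 * b) = 2 * (b - a)" by simp
      then have "\<bar>(1 - 2 * a) - (1 - 2 * b)\<bar> = 2 * \<bar>a - b\<bar>"
        by (simp only: abs_mult abs_minus_commute[of b a] abs_numeral)
      then show ?thesis using flat_lipschitz[of "1 - 2 * a" "1 - 2 * b"] by (simp add: L_def)
    qed
    have lip: "cmod ((1 - m x) - (1 - m y)) \<le> L * cmod (h x - h y)" for x y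
    proof -
      have "cmod ((1 - m x) - (1 - m y)) = cmod (of_real (exp 1 * (flat 0 (1 - 2 * Re (h y)) - flat 0 (1 - 2 * Re (h x)))))"
        by (simp add: m_def algebra_simps)
      also have "\<dots> = exp 1 * \<bar>flat 0 (1 - 2 * Re (h y)) - flat 0 (1 - 2 * Re (h x))\<bar>"
        by (simp only: norm_of_real abs_mult abs_exp_cancel)
      also have "\<dots> \<le> L * \<bar>Re (h y) - Re (h x)\<bar>" by (rule dflat)
      also have "\<dots> \<le> L * cmod (h x - h y)"
        using abs_Re_le_cmod[of "h x - h y"] by (intro mult_left_mono) (auto simp: L_def abs_minus_commute)
      finally show ?thesis .
    qed
    \<comment> \<open>The same Lipschitz bound, comparing h(x) with the value 0, at which the
      cut-off equals 1.\<close>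
    have val: "cmod (1 - m x) \<le> L * cmod (h x)" for x
    proof -
      have "1 - m x = of_real (exp 1 * (flat 0 (1 - 2 * 0) - flat 0 (1 - 2 * Re (h x))))"
        by (simp add: m_def flat_def[of 0 1] right_diff_distrib exp_add[symmetric])
      then have "cmod (1 - m x) = exp 1 * \<bar>flat 0 (1 - 2 * 0) - flat 0 (1 - 2 * Re (h x))\<bar>"
        by (simp only: norm_of_real abs_mult abs_exp_cancel)
      also have "\<dots> \<le> L * \<bar>0 - Re (h x)\<bar>" by (rule dflat)
      also have "\<dots> \<le> L * cmod (h x)"
        using abs_Re_le_cmod[of "h x"] by (intro mult_left_mono) (auto simp: L_def)
      finally show ?thesis .
    qed
    have mc: "continuous_on circle (\<lambda>\<zeta>. 1 - m \<zeta>)"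
      by (intro continuous_intros smooth_on_circle_continuous ms)
    have "(LINT \<zeta>|circle_measure. (cmod (1 - m \<zeta>))\<^sup>2) \<le> (LINT \<zeta>|circle_measure. L\<^sup>2 * (cmod (h \<zeta>))\<^sup>2)"
    proof (rule integral_mono)
      show "(cmod (1 - m \<zeta>))\<^sup>2 \<le> L\<^sup>2 * (cmod (h \<zeta>))\<^sup>2" for \<zeta>
        unfolding power_mult_distrib[symmetric] by (intro power_mono val) simp
    qed (intro circle_integrable_continuous continuous_intros hc mc)+
    also have "\<dots> = L\<^sup>2 * (LINT \<zeta>|circle_measure. (cmod (h \<zeta>))\<^sup>2)" by simp
    also have "\<dots> \<le> L\<^sup>2 * (nsq (wcoeff \<Omega> h) / \<Omega> 0)"
      using L2_le_nsq_wcoeff[OF hc] pos[of 0] by (intro mult_left_mono) (auto simp: pos_le_divide_eq mult.commute)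
    finally have "\<Omega> 2 * (LINT \<zeta>|circle_measure. (cmod (1 - m \<zeta>))\<^sup>2) \<le> \<Omega> 2 * (L\<^sup>2 * (nsq (wcoeff \<Omega> h) / \<Omega> 0))"
      using pos[of 2] by (intro mult_left_mono) auto
    then have "nsq (wcoeff \<Omega> (\<lambda>\<zeta>. 1 - m \<zeta>)) \<le> \<Omega> 2 * (L\<^sup>2 * (nsq (wcoeff \<Omega> h) / \<Omega> 0)) + C * (L\<^sup>2 * nsq (wcoeff \<Omega> h))"
      using wcoeff_contraction(2)[OF mc hc lip] by linarith
    also have "\<dots> = A * nsq (wcoeff \<Omega> h)" by (simp add: A_def algebra_simps)
    also have "\<dots> \<le> A * (e / (A + 1))" using h(3) A0 by (intro mult_left_mono) auto
    also have "\<dots> < e" using A0 e by (simp add: field_simps)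
    finally show ?thesis .
  qed
  ultimately show thesis by (rule that)
qed

lemma dense_smooth_of_capacity_zero:
  assumes w: "\<And>n. \<Omega> n = 1 / \<omega> n" and E: "compact E" "E \<subseteq> circle" and cap: "capacity \<omega> E = 0"
  shows "dense_in_ell2 \<Omega> (smooth_compact_support (circle - E))"
  unfolding dense_in_ell2_def
proof (intro conjI ballI allI impI)
  show "smooth_compact_support (circle - E) \<subseteq> ell2 \<Omega>"
    by (auto simp: smooth_compact_support_def intro: CH_ell2 CH_smooth)
  fix g and e :: real assume g: "g \<in> ell2 \<Omega>" and e: "0 < e"
  have gl: "wcoeff \<Omega> g \<in> l2" using g by (simp add: ell2_iff)
  \<comment> \<open>Two errors of size d, each doubled by the quadratic triangle inequality, add up
    to e^2 / 2.\<close>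
  define d where "d = e\<^sup>2 / 8"
  have d0: "0 < d" using e by (simp add: d_def)
  obtain F where F: "finite F" "nsq (\<lambda>n. if n \<in> F then 0 else wcoeff \<Omega> g n) \<le> d"
    by (rule l2_truncate[OF gl d0])
  define p where "p \<zeta> = (\<Sum>n\<in>F. fourier g n * \<zeta> powi n)" for \<zeta>
  have ps: "smooth_on_circle p" unfolding p_def
    by (intro smooth_on_circle_sum smooth_on_circle_mult smooth_on_circle_const smooth_on_circle_powi)
  have pC: "p \<in> CH" by (rule CH_smooth[OF ps])
  have "wcoeff \<Omega> (\<lambda>\<zeta>. g \<zeta> - p \<zeta>) = (\<lambda>n. if n \<in> F then 0 else wcoeff \<Omega> g n)"
  proof
    fix n
    have "fourier p n = (if n \<in> F then fourier g n else 0)"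
      unfolding p_def by (rule fourier_trig_poly[OF F(1)])
    then show "wcoeff \<Omega> (\<lambda>\<zeta>. g \<zeta> - p \<zeta>) n = (if n \<in> F then 0 else wcoeff \<Omega> g n)"
      by (simp add: wcoeff_diff[OF ell2_integrable[OF g] CH_integrable[OF pC]] wcoeff_def)
  qed
  then have gp: "nsq (wcoeff \<Omega> (\<lambda>\<zeta>. g \<zeta> - p \<zeta>)) \<le> d" using F(2) by simp
  obtain K where K: "0 \<le> K" "\<And>w. w \<in> CH \<Longrightarrow> nsq (wcoeff \<Omega> (\<lambda>\<zeta>. \<Sum>n\<in>F. fourier g n * (w \<zeta> * \<zeta> powi n))) \<le> K * nsq (wcoeff \<Omega> w)"
    using nsq_wcoeff_trig_mult_le[OF F(1), of "fourier g"] by blast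
  have "0 < d / (K + 1)" using d0 K(1) by simp
  then obtain m where m: "m \<in> smooth_compact_support (circle - E)" "nsq (wcoeff \<Omega> (\<lambda>\<zeta>. 1 - m \<zeta>)) < d / (K + 1)"
    by (rule one_approx[OF w E cap]) (rule that)
  define h where "h = (\<lambda>\<zeta>. m \<zeta> * p \<zeta>)"
  have hD: "h \<in> smooth_compact_support (circle - E)"
    unfolding h_def by (rule smooth_compact_support_mult[OF m(1) ps])
  then have hC: "h \<in> CH" by (auto simp: smooth_compact_support_def intro: CH_smooth)
  have mC: "m \<in> CH" using m(1) by (auto simp: smooth_compact_support_def intro: CH_smooth)
  have "p \<zeta> - h \<zeta> = (\<Sum>n\<in>F. fourier g n * ((1 - m \<zeta>) * \<zeta> powi n))" for \<zeta>
    unfolding h_def p_def by (simp add: sum_distrib_left sum_subtractf[symmetric] algebra_simps)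
  then have "nsq (wcoeff \<Omega> (\<lambda>\<zeta>. p \<zeta> - h \<zeta>)) \<le> K * nsq (wcoeff \<Omega> (\<lambda>\<zeta>. 1 - m \<zeta>))"
    using K(2)[OF CH_diff[OF CH_smooth[OF smooth_on_circle_const[of 1]] mC]] by simp
  also have "\<dots> \<le> K * (d / (K + 1))" using m(2) K(1) by (intro mult_left_mono) auto
  also have "\<dots> \<le> d" using K(1) d0 by (simp add: field_simps)
  finally have ph: "nsq (wcoeff \<Omega> (\<lambda>\<zeta>. p \<zeta> - h \<zeta>)) \<le> d" .
  have "nsq (wcoeff \<Omega> (\<lambda>\<zeta>. g \<zeta> - h \<zeta>)) \<le> 2 * nsq (wcoeff \<Omega> (\<lambda>\<zeta>. g \<zeta> - p \<zeta>)) + 2 * nsq (wcoeff \<Omega> (\<lambda>\<zeta>. p \<zeta> - h \<zeta>))"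
    using pC hC by (intro nsq_wcoeff_diff_trans ell2_integrable g gl CH_integrable) (auto simp: CH_iff)
  also have "\<dots> \<le> 4 * d" using gp ph by linarith
  also have "\<dots> < e\<^sup>2" using e by (simp add: d_def)
  finally have "ell2_norm \<Omega> (\<lambda>\<zeta>. g \<zeta> - h \<zeta>) < e" using ell2_norm_less[OF e] by simp
  with hD show "\<exists>h\<in>smooth_compact_support (circle - E). ell2_norm \<Omega> (\<lambda>\<zeta>. g \<zeta> - h \<zeta>) < e" by blast
qed

section \<open>Spans of shifts and bicyclic functions\<close>

abbreviation shifts :: "(complex \<Rightarrow> complex) \<Rightarrow> (complex \<Rightarrow> complex) set" where
  "shifts f \<equiv> range (\<lambda>n::int. \<lambda>\<zeta>. f \<zeta> * \<zeta> powi n)"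

lemma span_shifts_CH:
  assumes "f \<in> CH" shows "complex_span (shifts f) \<subseteq> CH"
proof
  fix x assume "x \<in> complex_span (shifts f)"
  then obtain F c where F: "F \<subseteq> shifts f" "x = (\<lambda>\<zeta>. \<Sum>g\<in>F. c g * g \<zeta>)"
    unfolding complex_span_def by blast
  have "g \<in> CH" if "g \<in> F" for g
    using F(1) that CH_mult[OF assms CH_smooth[OF smooth_on_circle_powi]] by auto
  then show "x \<in> CH" unfolding F(2) by (intro CH_sum CH_cmult)
qed

lemma mult_fejer_span: "(\<lambda>\<zeta>. f \<zeta> * fejer N g \<zeta>) \<in> complex_span (shifts f)"
proof -
  have "(\<lambda>\<zeta>. f \<zeta> * fejer N g \<zeta>) = (\<lambda>\<zeta>. \<Sum>i\<in>{..<N} \<times> {..<N}. (fourier g (int (fst i) - int (snd i)) / of_nat N) * (f \<zeta> * \<zeta> powi (int (fst i) - int (snd i))))"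
    by (simp add: fejer_eq_sum sum_distrib_left mult_ac)
  also have "\<dots> \<in> complex_span (shifts f)" by (intro complex_span_sum complex_span_base) auto
  finally show ?thesis .
qed

text \<open>A smooth function supported off the zero set of \<open>f\<close> is a product \<open>f g\<close> with \<open>g\<close> in the algebra \<open>CH\<close>, and
  the products of \<open>f\<close> with the Fejer means of \<open>g\<close> converge to it weakly.\<close>

lemma span_shifts_approx:
  assumes f: "f \<in> CH" and \<phi>: "\<phi> \<in> smooth_compact_support (circle - {\<zeta>\<in>circle. f \<zeta> = 0})" and e: "0 < e"
  obtains m where "m \<in> complex_span (shifts f)" "nsq (wcoeff \<Omega> (\<lambda>\<zeta>. \<phi> \<zeta> - m \<zeta>)) < e"
proof -
  have fc: "continuous_on circle f" using f by (simp add: CH_iff)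
  have \<phi>C: "\<phi> \<in> CH" using \<phi> by (auto simp: smooth_compact_support_def intro: CH_smooth)
  define T where "T = closure (support_on circle \<phi>)"
  have T: "compact T" "T \<subseteq> circle" "\<And>\<zeta>. \<zeta> \<in> T \<Longrightarrow> f \<zeta> \<noteq> 0"
    using \<phi> by (auto simp: T_def smooth_compact_support_def)
  have T': "\<phi> \<zeta> = 0" if "\<zeta> \<in> circle" "\<zeta> \<notin> T" for \<zeta>
    using that closure_subset[of "support_on circle \<phi>"] by (auto simp: T_def support_on_def)
  obtain a where a: "0 < a" "\<And>\<zeta>. \<zeta> \<in> T \<Longrightarrow> a \<le> cmod (f \<zeta>)"
  proof (cases "T = {}")
    case True then show ?thesis using that[of 1] by simp
  next
    case False
    have "continuous_on T (\<lambda>\<zeta>. cmod (f \<zeta>))"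
      by (intro continuous_intros continuous_on_subset[OF fc T(2)])
    from continuous_attains_inf[OF T(1) False this]
    obtain x where "x \<in> T" "\<forall>y\<in>T. cmod (f x) \<le> cmod (f y)" by blast
    then show ?thesis using that[of "cmod (f x)"] T(3) by auto
  qed
  \<comment> \<open>The reciprocal modulus, truncated at the lower bound \<open>a\<close> of |f| on
    the support. The truncation makes it a Lipschitz image of f with constant 1/a^2, so it lies in
    the space.\<close>
  define r where "r \<zeta> = complex_of_real (1 / max (cmod (f \<zeta>)) a)" for \<zeta>
  have rC: "r \<in> CH"
  proof (rule CH_contraction[OF f])
    fix x y :: complex
    let ?p = "max (cmod (f x)) a" and ?q = "max (cmod (f y)) a"
    have pq: "a \<le> ?p" "a \<le> ?q" by auto
    have "\<bar>1 / ?p - 1 / ?q\<bar> = \<bar>?q - ?p\<bar> / (?p * ?q)"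
    proof -
      have "1 / ?p - 1 / ?q = (?q - ?p) / (?p * ?q)" using pq a(1) by (simp add: diff_frac_eq)
      moreover have "\<bar>?p * ?q\<bar> = ?p * ?q" using pq a(1) by simp
      ultimately show ?thesis by (simp only: abs_divide)
    qed
    also have "\<dots> \<le> \<bar>?q - ?p\<bar> / (a * a)"
      using pq a(1) by (intro divide_left_mono mult_mono mult_pos_pos) auto
    also have "\<bar>?q - ?p\<bar> \<le> \<bar>cmod (f x) - cmod (f y)\<bar>" by (auto simp: max_def)
    also have "\<dots> \<le> cmod (f x - f y)" by (rule norm_triangle_ineq3)
    finally have "\<bar>1 / ?p - 1 / ?q\<bar> \<le> cmod (f x - f y) / (a * a)" using a(1) by (simp add: divide_right_mono)
    then show "cmod (r x - r y) \<le> (1 / (a * a)) * cmod (f x - f y)"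
      unfolding r_def of_real_diff[symmetric] norm_of_real by simp
  qed
  have cC: "(\<lambda>\<zeta>. cnj (f \<zeta>)) \<in> CH"
    by (rule CH_contraction[OF f, of _ 1]) (simp flip: complex_cnj_diff)
  \<comment> \<open>On the support of \<phi> the last factors are conjugate f over |f|^2, that is
    1/f; off the support \<phi> vanishes and the truncated value does not matter.\<close>
  define g where "g \<zeta> = \<phi> \<zeta> * cnj (f \<zeta>) * (r \<zeta> * r \<zeta>)" for \<zeta>
  have gC: "g \<in> CH" unfolding g_def by (intro CH_mult \<phi>C cC rC)
  have fg: "f \<zeta> * g \<zeta> = \<phi> \<zeta>" if z: "\<zeta> \<in> circle" for \<zeta>
  proof (cases "\<zeta> \<in> T")
    case True
    then have "r \<zeta> = of_real (1 / cmod (f \<zeta>))" using a(2)[OF True] by (simp add: r_def max_def)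
    moreover have "f \<zeta> * cnj (f \<zeta>) = of_real (cmod (f \<zeta>)) * of_real (cmod (f \<zeta>))"
      by (metis complex_norm_square of_real_mult power2_eq_square)
    moreover have "f \<zeta> * g \<zeta> = \<phi> \<zeta> * (f \<zeta> * cnj (f \<zeta>)) * (r \<zeta> * r \<zeta>)" by (simp add: g_def mult_ac)
    ultimately show ?thesis using T(3)[OF True] by simp
  next
    case False
    then show ?thesis using T'[OF z] by (simp add: g_def)
  qed
  have "\<exists>m\<in>complex_span (shifts f). nsq (wcoeff \<Omega> (\<lambda>\<zeta>. \<phi> \<zeta> - m \<zeta>)) < e"
  proof (rule ccontr)
    assume "\<not> (\<exists>m\<in>complex_span (shifts f). nsq (wcoeff \<Omega> (\<lambda>\<zeta>. \<phi> \<zeta> - m \<zeta>)) < e)"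
    then have ge: "e \<le> nsq (wcoeff \<Omega> (\<lambda>\<zeta>. \<phi> \<zeta> - m \<zeta>))" if "m \<in> complex_span (shifts f)" for m
      using that by force
    obtain u where u: "u \<in> l2" "pair u \<phi> \<noteq> 0" "\<And>m. m \<in> complex_span (shifts f) \<Longrightarrow> pair u m = 0"
      by (rule annihilator[OF span_shifts_CH[OF f] complex_span_zero complex_span_lin \<phi>C e ge], assumption+) (rule that)
    have "(\<lambda>N. pair u (\<lambda>\<zeta>. f \<zeta> * fejer N g \<zeta>)) \<longlonglongrightarrow> pair u (\<lambda>\<zeta>. f \<zeta> * g \<zeta>)"
      by (rule pair_mult_fejer_tendsto[OF u(1) f gC])
    then have "pair u (\<lambda>\<zeta>. f \<zeta> * g \<zeta>) = 0"
      by (simp add: u(3)[OF mult_fejer_span] LIMSEQ_const_iff)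
    moreover have "fourier (\<lambda>\<zeta>. f \<zeta> * g \<zeta>) = fourier \<phi>" by (rule fourier_cong) (rule fg)
    then have "pair u (\<lambda>\<zeta>. f \<zeta> * g \<zeta>) = pair u \<phi>" by (simp add: pair_def wcoeff_def)
    ultimately show False using u(2) by simp
  qed
  then show thesis using that by blast
qed

lemma bicyclic_of_dense_smooth:
  assumes dense: "dense_in_ell2 \<Omega> (smooth_compact_support (circle - E))"
    and f: "f \<in> CH" and zeros: "{\<zeta>\<in>circle. f \<zeta> = 0} \<subseteq> E"
  shows "bicyclic \<Omega> f"
  unfolding bicyclic_def dense_in_ell2_def
proof (intro conjI ballI allI impI)
  show "complex_span (shifts f) \<subseteq> ell2 \<Omega>" using span_shifts_CH[OF f] CH_ell2 by auto
  fix g and e :: real assume g: "g \<in> ell2 \<Omega>" and e: "0 < e"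
  have e2: "0 < e / 2" "0 < (e / 2)\<^sup>2" using e by auto
  have "\<forall>g\<in>ell2 \<Omega>. \<forall>\<epsilon>>0. \<exists>h\<in>smooth_compact_support (circle - E). ell2_norm \<Omega> (\<lambda>\<zeta>. g \<zeta> - h \<zeta>) < \<epsilon>"
    using dense unfolding dense_in_ell2_def by (rule conjunct2)
  from this[rule_format, OF g e2(1)]
  obtain \<phi> where \<phi>: "\<phi> \<in> smooth_compact_support (circle - E)" and "ell2_norm \<Omega> (\<lambda>\<zeta>. g \<zeta> - \<phi> \<zeta>) < e / 2"
    by blast
  then have g\<phi>: "nsq (wcoeff \<Omega> (\<lambda>\<zeta>. g \<zeta> - \<phi> \<zeta>)) < (e / 2)\<^sup>2" using ell2_norm_less[OF e2(1)] by simp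
  have \<phi>': "\<phi> \<in> smooth_compact_support (circle - {\<zeta>\<in>circle. f \<zeta> = 0})"
    using \<phi> zeros by (auto simp: smooth_compact_support_def)
  obtain m where m: "m \<in> complex_span (shifts f)" "nsq (wcoeff \<Omega> (\<lambda>\<zeta>. \<phi> \<zeta> - m \<zeta>)) < (e / 2)\<^sup>2"
    by (rule span_shifts_approx[OF f \<phi>' e2(2)])
  have C: "\<phi> \<in> CH" "m \<in> CH"
    using \<phi> m(1) span_shifts_CH[OF f] by (auto simp: smooth_compact_support_def intro: CH_smooth)
  have gl: "wcoeff \<Omega> g \<in> l2" using g by (simp add: ell2_iff)
  have "nsq (wcoeff \<Omega> (\<lambda>\<zeta>. g \<zeta> - m \<zeta>)) \<le> 2 * nsq (wcoeff \<Omega> (\<lambda>\<zeta>. g \<zeta> - \<phi> \<zeta>)) + 2 * nsq (wcoeff \<Omega> (\<lambda>\<zeta>. \<phi> \<zeta> - m \<zeta>))"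
    using C by (intro nsq_wcoeff_diff_trans ell2_integrable g gl CH_integrable) (auto simp: CH_iff)
  also have "\<dots> < 4 * (e / 2)\<^sup>2" using g\<phi> m(2) by linarith
  also have "\<dots> = e\<^sup>2" by (simp add: power_divide)
  finally have "ell2_norm \<Omega> (\<lambda>\<zeta>. g \<zeta> - m \<zeta>) < e" using ell2_norm_less[OF e] by simp
  with m(1) show "\<exists>h\<in>complex_span (shifts f). ell2_norm \<Omega> (\<lambda>\<zeta>. g \<zeta> - h \<zeta>) < e" by blast
qed

lemma capacity_empty: "capacity \<omega> {} = 0"
proof -
  have "\<mu> \<notin> prob_measures_on {}" for \<mu>
  proof
    assume \<mu>: "\<mu> \<in> prob_measures_on {}"
    interpret prob_space \<mu> by (rule prob_measures_onD[OF \<mu>])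
    have "emeasure \<mu> (space \<mu>) = 0"
      using \<mu> by (simp add: prob_measures_onD(3)[OF \<mu>] prob_measures_on_def)
    then show False using emeasure_space_1 by simp
  qed
  then have "prob_measures_on {} = {}" by blast
  then show ?thesis by (simp add: capacity_def bot_ennreal)
qed

lemma capacity_zero_equivalences:
  assumes w: "\<And>n. \<Omega> n = 1 / \<omega> n" and E: "compact E" "E \<subseteq> circle"
  shows "(capacity \<omega> E = 0 \<longleftrightarrow>
            (\<forall>f. continuous_on circle f \<and> f \<in> ell2 \<Omega> \<and> {\<zeta>\<in>circle. f \<zeta> = 0} \<subseteq> E \<longrightarrow> bicyclic \<Omega> f)) \<and>
         (capacity \<omega> E = 0 \<longleftrightarrow> dense_in_ell2 \<Omega> (smooth_compact_support (circle - E)))"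
proof -
  have i_iii: "capacity \<omega> E = 0 \<Longrightarrow> dense_in_ell2 \<Omega> (smooth_compact_support (circle - E))"
    by (rule dense_smooth_of_capacity_zero[OF w E])
  have iii_ii: "bicyclic \<Omega> f" if "dense_in_ell2 \<Omega> (smooth_compact_support (circle - E))"
    "continuous_on circle f" "f \<in> ell2 \<Omega>" "{\<zeta>\<in>circle. f \<zeta> = 0} \<subseteq> E" for f
    using that by (intro bicyclic_of_dense_smooth) (auto simp: CH_iff ell2_iff)
  have iii_i: "capacity \<omega> E = 0" if "dense_in_ell2 \<Omega> (smooth_compact_support (circle - E))"
  proof (rule ccontr)
    assume "capacity \<omega> E \<noteq> 0"
    then have "\<not> dense_in_ell2 \<Omega> (smooth_compact_support (circle - E))"
    proof (rule not_dense_of_capacity[OF w E])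
      show "smooth_compact_support (circle - E) \<subseteq> CH"
        by (auto simp: smooth_compact_support_def intro: CH_smooth)
      show "h \<zeta> = 0" if "h \<in> smooth_compact_support (circle - E)" "\<zeta> \<in> E" for h \<zeta>
        using smooth_compact_support_vanishes[OF that(1) _ that(2)] that(2) E(2) by auto
    qed
    then show False using that by simp
  qed
  have ii_i: "capacity \<omega> E = 0"
    if ii: "\<And>f. continuous_on circle f \<Longrightarrow> f \<in> ell2 \<Omega> \<Longrightarrow> {\<zeta>\<in>circle. f \<zeta> = 0} \<subseteq> E \<Longrightarrow> bicyclic \<Omega> f"
  proof (rule ccontr)
    assume cap: "capacity \<omega> E \<noteq> 0"
    \<comment> \<open>By convention the distance to the empty set is 0, so the test function below
      would vanish everywhere.\<close>
    then have ne: "E \<noteq> {}" using capacity_empty by auto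
    \<comment> \<open>Lipschitz, hence in the space, with zero set exactly E. All its shifts vanish
      on E, so positive capacity obstructs bicyclicity.\<close>
    define f where "f \<zeta> = complex_of_real (infdist \<zeta> E)" for \<zeta>
    have lip: "cmod (f x - f y) \<le> 1 * cmod (x - y)" for x y
      unfolding f_def of_real_diff[symmetric] norm_of_real
      using infdist_triangle_abs[of x E y] by (simp add: dist_norm)
    have id: "(\<lambda>\<zeta>. \<zeta> powi 1) \<in> CH" by (rule CH_smooth[OF smooth_on_circle_powi])
    have fC: "f \<in> CH" by (rule CH_contraction[OF id, of f 1]) (use lip in simp)
    have "{\<zeta>\<in>circle. f \<zeta> = 0} \<subseteq> E"
      using in_closed_iff_infdist_zero[OF compact_imp_closed[OF E(1)] ne] by (auto simp: f_def)
    then have "bicyclic \<Omega> f" using fC by (intro ii CH_ell2) (auto simp: CH_iff)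
    then have "dense_in_ell2 \<Omega> (complex_span (shifts f))" by (simp add: bicyclic_def)
    moreover have "\<not> dense_in_ell2 \<Omega> (complex_span (shifts f))"
    proof (rule not_dense_of_capacity[OF w E cap span_shifts_CH[OF fC]])
      fix h \<zeta> assume h: "h \<in> complex_span (shifts f)" and z: "\<zeta> \<in> E"
      then obtain F c where F: "F \<subseteq> shifts f" "h = (\<lambda>\<zeta>. \<Sum>g\<in>F. c g * g \<zeta>)"
        unfolding complex_span_def by blast
      have "g \<zeta> = 0" if "g \<in> F" for g using F(1) that z by (auto simp: f_def)
      then show "h \<zeta> = 0" unfolding F(2) by (simp add: sum.neutral)
    qed
    ultimately show False by simp
  qed
  show ?thesis using i_iii iii_ii iii_i ii_i by metis
qed

end

section \<open>Moment sequences\<close>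

locale integrable_weight =
  fixes W :: "real \<Rightarrow> real"
  assumes W_nonneg: "\<And>t. 0 < t \<Longrightarrow> t \<le> 1 \<Longrightarrow> 0 \<le> W t"
    and W_integrable: "set_integrable lborel {0<..1} W"
begin

text \<open>The integrand of the moment after reflecting r = 1 - t, extended by 0 to the line so
  that affine substitutions apply directly.\<close>

definition G :: "nat \<Rightarrow> real \<Rightarrow> real" where
  "G n t = (1 - t) ^ n * (indicator {0<..1} t *\<^sub>R W t)"

lemma G_nonneg: "0 \<le> G n t"
  using W_nonneg by (auto simp: G_def indicator_def)

lemma G_antimono: "m \<le> n \<Longrightarrow> G n t \<le> G m t"
  unfolding G_def using W_nonneg
  by (auto simp: indicator_def intro!: mult_right_mono power_decreasing)

lemma G_integrable: "integrable lborel (G n)"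
proof (rule Bochner_Integration.integrable_bound)
  show i: "integrable lborel (\<lambda>t. indicator {0<..1} t *\<^sub>R W t)"
    using W_integrable by (simp add: set_integrable_def)
  show "G n \<in> borel_measurable lborel"
    unfolding G_def[abs_def] using borel_measurable_integrable[OF i] by measurable
  show "AE t in lborel. norm (G n t) \<le> norm (indicator {0<..1} t *\<^sub>R W t)"
  proof (rule AE_I2)
    fix t
    have "\<bar>G n t\<bar> \<le> \<bar>G 0 t\<bar>" using G_antimono[of 0 n t] G_nonneg[of n t] by linarith
    then show "norm (G n t) \<le> norm (indicator {0<..1} t *\<^sub>R W t)" by (simp add: G_def[of 0])
  qed
qed

lemma moment_seq_eq: "moment_seq W n = (LINT t|lborel. G n t)"
proof -
  have "moment_seq W n = (LINT r|lborel. G n (1 + (-1) * r))"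
    unfolding moment_seq_def set_lebesgue_integral_def
    by (intro Bochner_Integration.integral_cong) (auto simp: G_def indicator_def)
  also have "\<dots> = (LINT t|lborel. G n t)"
    using lborel_integral_real_affine[of "-1" "G n" 1] by simp
  finally show ?thesis .
qed

lemma moment_seq_antimono: "m \<le> n \<Longrightarrow> moment_seq W n \<le> moment_seq W m"
  unfolding moment_seq_eq by (intro integral_mono G_integrable G_antimono)

text \<open>A vanishing moment would force the nonnegative weight to be 0 almost everywhere, and the
  divergent integral in \<open>weight_C2\<close> would be 0.\<close>

lemma moment_seq_pos:
  assumes "weight_C2 W" shows "0 < moment_seq W n"
proof (rule ccontr)
  assume "\<not> 0 < moment_seq W n"
  moreover have "0 \<le> moment_seq W n"
    unfolding moment_seq_eq by (rule Bochner_Integration.integral_nonneg) (rule G_nonneg)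
  ultimately have "(LINT t|lborel. G n t) = 0" by (simp add: moment_seq_eq)
  then have G0: "AE t in lborel. G n t = 0"
    using integral_nonneg_eq_0_iff_AE[OF G_integrable, of n] by (simp add: G_nonneg)
  have AE0: "AE t in lborel. ennreal (W t / t) * indicator {0<..1} t = 0"
    using G0 AE_lborel_singleton[of 1]
  proof eventually_elim
    fix t :: real assume "G n t = 0" "t \<noteq> 1"
    then show "ennreal (W t / t) * indicator {0<..1} t = 0" by (auto simp: G_def indicator_def split: if_splits)
  qed
  have "(\<integral>\<^sup>+t. ennreal (W t / t) * indicator {0<..1} t \<partial>lborel) = (\<integral>\<^sup>+t. 0 \<partial>(lborel :: real measure))"
    by (intro nn_integral_cong_AE AE0)
  then show False using assms by (simp add: weight_C2_def)
qed

text \<open>The bound on the weight gives the factor c, the substitution t = s/2 gives the factor 2,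
  and 1 - s \<le> (1 - s/2)^2 turns the power n into 2 n.\<close>

lemma moment_seq_doubling:
  assumes c: "0 < c" "\<And>t. 0 < t \<Longrightarrow> t < 1 \<Longrightarrow> W t \<le> c * W (t / 2)"
  shows "moment_seq W n \<le> 2 * c * moment_seq W (2 * n)"
proof -
  have i: "integrable lborel (\<lambda>s. G (2 * n) (0 + (1 / 2) * s))"
    by (rule lborel_integrable_real_affine[OF G_integrable]) simp
  have "(LINT s|lborel. G n s) \<le> (LINT s|lborel. c * G (2 * n) (0 + (1 / 2) * s))"
  proof (rule integral_mono_AE[OF G_integrable integrable_mult_right[OF i]])
    show "AE s in lborel. G n s \<le> c * G (2 * n) (0 + (1 / 2) * s)"
      \<comment> \<open>The assumed inequality is restricted to t < 1, so the endpoint is discarded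
        as a null set; for n = 0 the integrand need not vanish there.\<close>
      using AE_lborel_singleton[of 1]
    proof eventually_elim
      fix s :: real assume s1: "s \<noteq> 1"
      show "G n s \<le> c * G (2 * n) (0 + (1 / 2) * s)"
      proof (cases "0 < s \<and> s < 1")
        case True
        have "1 - s \<le> (1 - s / 2)\<^sup>2" by (simp add: power2_eq_square algebra_simps)
        then have "(1 - s) ^ n \<le> ((1 - s / 2)\<^sup>2) ^ n" using True by (intro power_mono) auto
        also have "\<dots> = (1 - s / 2) ^ (2 * n)" by (simp add: power_mult)
        finally have "(1 - s) ^ n * W s \<le> (1 - s / 2) ^ (2 * n) * (c * W (s / 2))"
          using True c(2)[of s] W_nonneg[of s] by (intro mult_mono) auto
        then show ?thesis using True by (simp add: G_def mult_ac)
      next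
        case False
        then have "G n s = 0" using s1 by (auto simp: G_def indicator_def)
        then show ?thesis using c(1) G_nonneg by simp
      qed
    qed
  qed
  also have "\<dots> = c * (LINT s|lborel. G (2 * n) (0 + (1 / 2) * s))" by simp
  also have "(LINT s|lborel. G (2 * n) (0 + (1 / 2) * s)) = 2 * (LINT t|lborel. G (2 * n) t)"
    using lborel_integral_real_affine[of "1 / 2" "G (2 * n)" 0] by simp
  finally show ?thesis by (simp add: moment_seq_eq)
qed

end

theorem theorem2p4:
  fixes W :: "real \<Rightarrow> real" and \<omega> \<Omega> :: "nat \<Rightarrow> real" and E :: "complex set"
  assumes "weight W" and "weight_C1 W" and "weight_C2 W" and "weight_C3 W"
    and "\<And>n. \<omega> n = moment_seq W n"
    and "\<And>n. \<Omega> n = 1 / \<omega> n"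
    and "compact E" and "E \<subseteq> circle"
  shows "(capacity \<omega> E = 0 \<longleftrightarrow>
            (\<forall>f. continuous_on circle f \<and> f \<in> ell2 \<Omega> \<and> {\<zeta>\<in>circle. f \<zeta> = 0} \<subseteq> E
                 \<longrightarrow> bicyclic \<Omega> f)) \<and>
         (capacity \<omega> E = 0 \<longleftrightarrow> dense_in_ell2 \<Omega> (smooth_compact_support (circle - E)))"
proof -
  interpret integrable_weight W
    using assms(1) by unfold_locales (auto simp: weight_def)
  obtain c where c: "0 < c" "c < 2" "\<And>t. 0 < t \<Longrightarrow> t < 1 \<Longrightarrow> W t \<le> c * W (t / 2)"
    using assms(4) unfolding weight_C3_def by blast
  have \<omega>_pos: "0 < \<omega> n" for n unfolding assms(5) by (rule moment_seq_pos[OF assms(3)])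
  \<comment> \<open>The condition c < 2 becomes q = 2 c < 4, the threshold at which Lipschitz
    functions are controlled.\<close>
  interpret doubling_weight \<Omega> "2 * c"
  proof
    show "0 < \<Omega> n" for n using \<omega>_pos[of n] by (simp add: assms(6))
    show "\<Omega> m \<le> \<Omega> n" if "m \<le> n" for m n
      using moment_seq_antimono[OF that] \<omega>_pos[of n] by (simp add: assms(5,6) divide_left_mono)
    show "\<Omega> (2 * n) \<le> 2 * c * \<Omega> n" for n
    proof -
      have "\<omega> n \<le> 2 * c * \<omega> (2 * n)" unfolding assms(5) by (rule moment_seq_doubling[OF c(1,3)])
      then show ?thesis using \<omega>_pos[of n] \<omega>_pos[of "2 * n"] by (simp add: assms(6) field_simps)
    qed
    show "2 * c < 4" using c(2) by simp
  qed
  show ?thesis by (rule capacity_zero_equivalences[OF assms(6-8)])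
qed

end
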